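(* Let $2\leq p<\infty$ and let $X$ be a $p$-uniformly PL-convex complex Banach space. Then there exists $C>0$ such that for any $f\in\mathscr{H}^+_p(X)$, $$\|f(+\infty)\|_X+\left(\int_0^{+\infty}\|f'_{\sigma}\|^p_{\mathscr{H}_p(X)}\sigma^{p-1}\,d\sigma\right)^{1/p}\leq C\|f\|_{\mathscr{H}^+_p(X)}.$$
   Context: For a complex Banach space $X$, $\mathcal{D}(X)$ denotes the space of Dirichlet series $\sum_{n\geq1}x_nn^{-s}$ with coefficients $x_n\in X$ that converge at some point $s_0\in\mathbb{C}$. $\mathbb{T}^\infty$ is the countably infinite product of unit circles $\mathbb{T}\subset\mathbb{C}$, with normalized Haar measure $m_\infty$ (the product of normalized Lebesgue measures $m$ on $\mathbb{T}$). $\mathbb{Z}^{(\infty)}$ is the set of eventually null integer sequences and $\mathbb{N}_0^{(\infty)}$ the subset of those with all entries $\geq 0$; $z^\nu=\prod_j z_j^{\nu_j}$. For $F$ in the Bochner space $L_1(\mathbb{T}^\infty,X)$, $\widehat F(\nu)=\int_{\mathbb{T}^\infty}F(z)z^{-\nu}\,dm_\infty(z)$. For $1\le p<\infty$, $H_p(\mathbb{T}^\infty,X)$ is the closed subspace of $L_p(\mathbb{T}^\infty,X)$ of those $F$ with $\widehat F(\nu)=0$ for all $\nu\in\mathbb{Z}^{(\infty)}\setminus\mathbb{N}_0^{(\infty)}$. Let $\mathfrak{p}_1<\mathfrak{p}_2<\cdots$ be the primes; for $n\in\mathbb{N}$, $\nu(n)\in\mathbb{N}_0^{(\infty)}$ is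 the unique multi-index with $n=\prod_j\mathfrak{p}_j^{\nu(n)_j}$. The Bohr transform of $F\in H_1(\mathbb{T}^\infty,X)$ is the Dirichlet series $\mathfrak{B}(F)(s)=\sum_{n\ge1}\widehat F(\nu(n))n^{-s}$. The Hardy space $\mathscr{H}_p(X)$ is $\mathfrak{B}(H_p(\mathbb{T}^\infty,X))$ with norm $\|f\|_{\mathscr{H}_p(X)}=\|\mathfrak{B}^{-1}(f)\|_{H_p(\mathbb{T}^\infty,X)}$. For $u\in\mathbb{C}$, $f_u(\cdot)=f(\cdot+u)$. $\mathscr{H}_p^+(X)$ is the space of $f\in\mathcal{D}(X)$ such that $f_\sigma\in\mathscr{H}_p(X)$ for every $\sigma>0$ and $\|f\|_{\mathscr{H}_p^+(X)}=\sup_{\sigma>0}\|f_\sigma\|_{\mathscr{H}_p(X)}<\infty$. For $f(s)=\sum_{n\ge1}x_nn^{-s}$, $f(+\infty)$ denotes $x_1$, $f'(s)=-\sum_{n\ge2}x_n(\log n)n^{-s}$, and $f'_\sigma(s)=f'(s+\sigma)$. For $2\le p<\infty$, $X$ is $p$-uniformly PL-convex if there exists $C>0$ such that $\int_{\mathbb{T}}\|x+\xi y\|_X^p\,dm(\xi)\ge\|x\|_X^p+C\|y\|_X^p$ for all $x,y\in X$. *)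

theory Defs
  imports "HOL-Analysis.Analysis" "HOL-Computational_Algebra.Primes"
begin

section \<open>Complex Banach spaces\<close>

text \<open>The distribution only has real Banach spaces. A complex Banach space is a real one with a
  compatible complex scalar multiplication for which the norm is homogeneous.\<close>

class complex_banach = banach +
  fixes scaleC :: "complex \<Rightarrow> 'a \<Rightarrow> 'a"  (infixr \<open>*\<^sub>C\<close> 75)
  assumes scaleC_add_right: "a *\<^sub>C (x + y) = a *\<^sub>C x + a *\<^sub>C y"
    and scaleC_add_left: "(a + b) *\<^sub>C x = a *\<^sub>C x + b *\<^sub>C x"
    and scaleC_scaleC: "a *\<^sub>C (b *\<^sub>C x) = (a * b) *\<^sub>C x"
    and scaleC_of_real: "complex_of_real r *\<^sub>C x = r *\<^sub>R x"
    and norm_scaleC: "norm (a *\<^sub>C x) = cmod a * norm x"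

instantiation complex :: complex_banach
begin
definition "scaleC = (\<lambda>a x. a * x :: complex)"
instance
  by standard (simp_all add: scaleC_complex_def algebra_simps norm_mult scaleR_conv_of_real)
end

section \<open>Bochner integration without separability\<close>

text \<open>The library's Bochner integral is restricted to second countable target spaces. The definitions
  below are the library's, with that sort constraint removed: the library's
  simple_bochner_integrable and simple_bochner_integral carry no such constraint.\<close>

definition has_bochner_int :: "'b measure \<Rightarrow> ('b \<Rightarrow> 'a::banach) \<Rightarrow> 'a \<Rightarrow> bool" where
  "has_bochner_int M F x \<longleftrightarrow> F \<in> borel_measurable M \<and>
     (\<exists>s. (\<forall>i::nat. Bochner_Integration.simple_bochner_integrable M (s i)) \<and>
          (\<lambda>i. \<integral>\<^sup>+ z. ennreal (norm (F z - s i z)) \<partial>M) \<longlonglongrightarrow> 0 \<and>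
          (\<lambda>i. Bochner_Integration.simple_bochner_integral M (s i)) \<longlonglongrightarrow> x)"

definition bochner_int :: "'b measure \<Rightarrow> ('b \<Rightarrow> 'a::banach) \<Rightarrow> 'a" where
  "bochner_int M F = (if \<exists>x. has_bochner_int M F x then THE x. has_bochner_int M F x else 0)"

text \<open>Strong measurability: an almost everywhere limit of simple functions. As M need not be
  complete, Borel measurability is required in addition; every class of almost everywhere equal
  strongly measurable functions has such a representative.\<close>

definition strongly_measurable :: "'b measure \<Rightarrow> ('b \<Rightarrow> 'a::banach) \<Rightarrow> bool" where
  "strongly_measurable M F \<longleftrightarrow> F \<in> borel_measurable M \<and>
     (\<exists>s. (\<forall>i::nat. simple_function M (s i)) \<and> (AE z in M. (\<lambda>i. s i z) \<longlonglongrightarrow> F z))"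

text \<open>The elements of Bochner spaces are functions here, not classes modulo almost everywhere
  equality.\<close>

definition Lp_space :: "'b measure \<Rightarrow> real \<Rightarrow> ('b \<Rightarrow> 'a::banach) set" where
  "Lp_space M p = {F. strongly_measurable M F \<and> integrable M (\<lambda>z. norm (F z) powr p)}"

definition Lp_norm :: "'b measure \<Rightarrow> real \<Rightarrow> ('b \<Rightarrow> 'a::banach) \<Rightarrow> real" where
  "Lp_norm M p F = (\<integral>z. norm (F z) powr p \<partial>M) powr (1 / p)"

section \<open>The infinite polytorus\<close>

definition circle_measure :: "complex measure" where
  "circle_measure = distr (uniform_measure lborel {0..<2 * pi}) (restrict_space borel (sphere 0 1)) cis"

text \<open>Coordinates, and below the primes, are numbered from 0.\<close>

definition torus_measure :: "(nat \<Rightarrow> complex) measure" where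
  "torus_measure = PiM UNIV (\<lambda>_. circle_measure)"

definition eventually_null :: "(nat \<Rightarrow> int) set" where
  "eventually_null = {\<nu>. finite {j. \<nu> j \<noteq> 0}}"

definition monomial :: "(nat \<Rightarrow> int) \<Rightarrow> (nat \<Rightarrow> complex) \<Rightarrow> complex" where
  "monomial \<nu> z = (\<Prod>j | \<nu> j \<noteq> 0. z j powi \<nu> j)"

definition fourier_coeff :: "((nat \<Rightarrow> complex) \<Rightarrow> 'a::complex_banach) \<Rightarrow> (nat \<Rightarrow> int) \<Rightarrow> 'a" where
  "fourier_coeff F \<nu> = bochner_int torus_measure (\<lambda>z. monomial (\<lambda>j. - \<nu> j) z *\<^sub>C F z)"

definition Hardy_torus :: "real \<Rightarrow> ((nat \<Rightarrow> complex) \<Rightarrow> 'a::complex_banach) set" where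
  "Hardy_torus p = {F \<in> Lp_space torus_measure p.
     \<forall>\<nu> \<in> eventually_null - {\<nu>. \<forall>j. 0 \<le> \<nu> j}. fourier_coeff F \<nu> = 0}"

section \<open>Dirichlet series\<close>

text \<open>A Dirichlet series is given by its coefficients at n \<open>\<ge>\<close> 1. The unused value at 0 is
  normalised to 0, so that a series is determined by its coefficient function.\<close>

definition dirichlet_series :: "(nat \<Rightarrow> 'a::complex_banach) set" where
  "dirichlet_series =
     {f. f 0 = 0 \<and> (\<exists>s0::complex. summable (\<lambda>n. (of_nat n powr (- s0)) *\<^sub>C f n))}"

text \<open>f(s + u) has the coefficients \<open>n\<^sup>-\<^sup>u x\<^sub>n\<close>.\<close>

definition ds_translate :: "complex \<Rightarrow> (nat \<Rightarrow> 'a::complex_banach) \<Rightarrow> nat \<Rightarrow> 'a" where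
  "ds_translate u f = (\<lambda>n. (of_nat n powr (- u)) *\<^sub>C f n)"

definition ds_deriv :: "(nat \<Rightarrow> 'a::complex_banach) \<Rightarrow> nat \<Rightarrow> 'a" where
  "ds_deriv f = (\<lambda>n. if n \<ge> 2 then - (ln (real n) *\<^sub>R f n) else 0)"

definition ds_at_infinity :: "(nat \<Rightarrow> 'a) \<Rightarrow> 'a" where
  "ds_at_infinity f = f 1"

definition nth_prime :: "nat \<Rightarrow> nat" where
  "nth_prime = enumerate {p. prime p}"

definition prime_index :: "nat \<Rightarrow> nat \<Rightarrow> int" where
  "prime_index n = (\<lambda>j. int (multiplicity (nth_prime j) n))"

lemma prime_index_correct:
  assumes "n > 0"
  shows "prime_index n \<in> eventually_null" "0 \<le> prime_index n j"
    "n = (\<Prod>j | prime_index n j \<noteq> 0. nth_prime j ^ nat (prime_index n j))"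
proof -
  have bij: "bij_betw nth_prime UNIV {p. prime p}"
    unfolding nth_prime_def using primes_infinite by (rule bij_enumerate)
  have pr: "prime (nth_prime j)" for j
    using bij by (auto simp: bij_betw_def)
  have set: "{j. prime_index n j \<noteq> 0} = {j. nth_prime j \<in> prime_factors n}"
    using pr assms by (auto simp: prime_index_def prime_factors_multiplicity)
  have img: "nth_prime ` {j. nth_prime j \<in> prime_factors n} = prime_factors n"
  proof -
    have "\<exists>j. q = nth_prime j" if "q \<in> prime_factors n" for q
      using bij in_prime_factors_imp_prime[OF that] by (auto simp: bij_betw_def)
    thus ?thesis by auto
  qed
  have inj: "inj_on nth_prime {j. nth_prime j \<in> prime_factors n}"
    using bij by (auto simp: bij_betw_def intro: inj_on_subset)
  show "prime_index n \<in> eventually_null"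
    using finite_imageD[of nth_prime, OF _ inj] img by (simp add: eventually_null_def set)
  show "0 \<le> prime_index n j" by (simp add: prime_index_def)
  have "n = (\<Prod>p\<in>prime_factors n. p ^ multiplicity p n)"
    using prime_factorization_nat assms by blast
  also have "\<dots> = (\<Prod>j | prime_index n j \<noteq> 0. nth_prime j ^ nat (prime_index n j))"
    unfolding set using prod.reindex[OF inj, of "\<lambda>p. p ^ multiplicity p n", unfolded img]
    by (simp add: prime_index_def)
  finally show "n = (\<Prod>j | prime_index n j \<noteq> 0. nth_prime j ^ nat (prime_index n j))" .
qed

definition bohr :: "((nat \<Rightarrow> complex) \<Rightarrow> 'a::complex_banach) \<Rightarrow> nat \<Rightarrow> 'a" where
  "bohr F = (\<lambda>n. if n = 0 then 0 else fourier_coeff F (prime_index n))"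

definition Hardy :: "real \<Rightarrow> (nat \<Rightarrow> 'a::complex_banach) set" where
  "Hardy p = bohr ` Hardy_torus p"

text \<open>The Bohr transform is injective only up to almost everywhere equality, which does not
  affect the norm of the preimage picked by inv_into. Only meaningful for members of Hardy p.\<close>

definition Hardy_norm :: "real \<Rightarrow> (nat \<Rightarrow> 'a::complex_banach) \<Rightarrow> real" where
  "Hardy_norm p f = Lp_norm torus_measure p (inv_into (Hardy_torus p) bohr f)"

definition Hardy_plus :: "real \<Rightarrow> (nat \<Rightarrow> 'a::complex_banach) set" where
  "Hardy_plus p = {f \<in> dirichlet_series.
     (\<forall>\<sigma>>0. ds_translate (complex_of_real \<sigma>) f \<in> Hardy p) \<and>
     bdd_above ((\<lambda>\<sigma>. Hardy_norm p (ds_translate (complex_of_real \<sigma>) f)) ` {0<..})}"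

definition Hardy_plus_norm :: "real \<Rightarrow> (nat \<Rightarrow> 'a::complex_banach) \<Rightarrow> real" where
  "Hardy_plus_norm p f = (SUP \<sigma>\<in>{0<..}. Hardy_norm p (ds_translate (complex_of_real \<sigma>) f))"

section \<open>Uniform PL-convexity\<close>

definition uniformly_PL_convex :: "real \<Rightarrow> 'a::complex_banach itself \<Rightarrow> bool" where
  "uniformly_PL_convex p X \<longleftrightarrow> (\<exists>C>0. \<forall>x y :: 'a.
     (\<integral>\<xi>. norm (x + \<xi> *\<^sub>C y) powr p \<partial>circle_measure) \<ge> norm x powr p + C * norm y powr p)"

end

theory Submission
  imports Defs "HOL-Probability.Infinite_Product_Measure"
begin

text \<open>The proof studies how the p-th power of the norm of \<open>f\<^sub>\<sigma>\<close> changes with \<open>\<sigma>\<close>. On the side of the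
  torus, a translation by an imaginary number is a rotation, so the norm of \<open>f\<^sub>s\<close> depends only on
  the real part of s. Averaging \<open>f\<^sub>s\<close> over the circle of radius r about \<open>\<sigma>\<close>, against the nonnegative
  kernel \<open>1 + Re (\<xi> * cnj \<eta>)\<close>, gives \<open>f\<^sub>\<sigma> + \<eta> (r / 2) f'\<^sub>\<sigma>\<close> with \<open>\<bar>\<eta>\<bar> = 1\<close>, because the dependence
  on s is analytic. PL-convexity of X, Jensen's inequality and Tonelli's theorem then yield
  (\<open>dpoly_PL_inequality\<close>)

  \<open>\<parallel>f\<^sub>\<sigma>\<parallel>\<^sup>p + C (r / 2)\<^sup>p \<parallel>f'\<^sub>\<sigma>\<parallel>\<^sup>p \<le>\<close> mean over \<open>\<xi>\<close> of \<open>\<parallel>f\<^sub>t\<parallel>\<^sup>p\<close> at \<open>t = \<sigma> + r Re \<xi>\<close>.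

  With \<open>r = \<sigma> / 2\<close> the right side is a mean over dilations of \<open>\<sigma>\<close> by factors between 1/2 and 3/2.
  Integrate against \<open>d\<sigma> / \<sigma>\<close>. This measure is invariant under dilations, so the two integrals of
  \<open>\<parallel>f\<^sub>\<sigma>\<parallel>\<^sup>p\<close> cancel up to end pieces that are bounded by a multiple of the supremum of \<open>\<parallel>f\<^sub>\<sigma>\<parallel>\<^sup>p\<close>
  (\<open>nn_integral_mean_dilation_bound\<close>). What is left is the asserted bound for the integral of
  \<open>\<parallel>f'\<^sub>\<sigma>\<parallel>\<^sup>p \<sigma>\<^sup>p\<^sup>-\<^sup>1\<close> (\<open>dpoly_Littlewood_Paley\<close>). The remaining term \<open>f(+\<infinity>)\<close> is a Fourier coefficient
  and is bounded by the norm.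

  These steps are carried out for Dirichlet polynomials. Fejer means lead to the general case. They
  are convolutions with probability densities, hence contractions (\<open>fejer_contraction\<close>), and they
  converge to the function in \<open>L\<^sub>p\<close> (\<open>fejer_tendsto\<close>) because trigonometric polynomials are dense
  (\<open>trig_poly_dense\<close>). On the side of Dirichlet series they multiply each coefficient by a number
  depending only on n, so they commute with translation and differentiation. Thus the norms of f and
  of its derivative are limits of norms of Dirichlet polynomials, and the inequality passes to the
  limit by Fatou's lemma. That \<open>f'\<^sub>\<sigma>\<close> belongs to the Hardy space at all follows from the same
  inequality, applied to differences of Fejer means (\<open>ds_deriv_translate_Hardy\<close>), and completeness
  (\<open>trig_poly_complete\<close>).

  As X may be nonseparable, the basic facts on strongly measurable functions and on the Bochner
  integral are proved first.\<close>

section \<open>Measurability without separability\<close>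

lemma bounded_bilinear_scaleC: "bounded_bilinear ((*\<^sub>C) :: complex \<Rightarrow> 'a::complex_banach \<Rightarrow> 'a)"
proof (standard, goal_cases)
  case (3 r a b)
  show ?case
    by (metis scaleC_of_real scaleC_scaleC scaleR_conv_of_real)
next
  case (4 a r b)
  show ?case
    by (metis scaleC_of_real scaleC_scaleC mult.commute)
next
  case 5
  show ?case by (rule exI[of _ 1]) (simp add: norm_scaleC)
qed (simp_all add: scaleC_add_left scaleC_add_right)

interpretation scaleC: bounded_bilinear "(*\<^sub>C) :: complex \<Rightarrow> 'a::complex_banach \<Rightarrow> 'a"
  by (rule bounded_bilinear_scaleC)

lemma scaleC_one [simp]: "1 *\<^sub>C (x :: 'a::complex_banach) = x"
  using scaleC_of_real[of 1 x] by simp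

text \<open>For a nonseparable space the Borel sets of the square can be more than the product \<sigma>-algebra, and
  the sum of two Borel functions can fail to be Borel. With one second countable factor every open
  set is a countable union of open rectangles. This is enough to multiply with scalar functions and
  to add scalar functions times fixed vectors, the only operations used below.\<close>
lemma borel_measurable_continuous_pair:
  fixes h :: "'b::topological_space \<Rightarrow> 'c::second_countable_topology \<Rightarrow> 'd::topological_space"
  assumes F: "F \<in> borel_measurable M" and \<phi>: "\<phi> \<in> borel_measurable M"
    and cont: "continuous_on UNIV (\<lambda>(x, u). h x u)"
  shows "(\<lambda>z. h (F z) (\<phi> z)) \<in> borel_measurable M"
proof (rule borel_measurableI)
  fix S :: "'d set" assume S: "open S"
  obtain B :: "'c set set" where B: "countable B" "topological_basis B"
    using ex_countable_basis by blast
  \<comment> \<open>the largest open set whose product with U is mapped into S\<close>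
  define V where "V U = \<Union>{V. open V \<and> V \<times> U \<subseteq> (\<lambda>(x, u). h x u) -` S}" for U :: "'c set"
  have opV: "open (V U)" for U unfolding V_def by auto
  have pre: "open ((\<lambda>(x, u). h x u) -` S)"
    by (rule open_vimage[OF S cont])
  have eq: "(\<lambda>z. h (F z) (\<phi> z)) -` S \<inter> space M =
      (\<Union>U\<in>B. (F -` V U \<inter> space M) \<inter> (\<phi> -` U \<inter> space M))"
  proof (intro set_eqI iffI)
    fix z assume z: "z \<in> (\<lambda>z. h (F z) (\<phi> z)) -` S \<inter> space M"
    then have "(F z, \<phi> z) \<in> (\<lambda>(x, u). h x u) -` S" by auto
    from open_prod_elim[OF pre this] obtain A C where AC: "open A" "open C"
      "(F z, \<phi> z) \<in> A \<times> C" "A \<times> C \<subseteq> (\<lambda>(x, u). h x u) -` S" by blast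
    then obtain U where U: "U \<in> B" "\<phi> z \<in> U" "U \<subseteq> C"
      using topological_basisE[OF B(2), of C "\<phi> z"] by auto
    have "A \<times> U \<subseteq> (\<lambda>(x, u). h x u) -` S" using AC U by blast
    then have "F z \<in> V U" using AC unfolding V_def by blast
    then show "z \<in> (\<Union>U\<in>B. (F -` V U \<inter> space M) \<inter> (\<phi> -` U \<inter> space M))"
      using z U by auto
  next
    fix z assume "z \<in> (\<Union>U\<in>B. (F -` V U \<inter> space M) \<inter> (\<phi> -` U \<inter> space M))"
    then show "z \<in> (\<lambda>z. h (F z) (\<phi> z)) -` S \<inter> space M"
      unfolding V_def by auto
  qed
  have "F -` V U \<inter> space M \<in> sets M" for U
    by (rule measurable_sets[OF F]) (use opV in auto)
  moreover have "\<phi> -` U \<inter> space M \<in> sets M" if "U \<in> B" for U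
    by (rule measurable_sets[OF \<phi>]) (use topological_basis_open[OF B(2) that] in auto)
  ultimately show "(\<lambda>z. h (F z) (\<phi> z)) -` S \<inter> space M \<in> sets M"
    unfolding eq using B(1) by (intro sets.countable_UN' sets.Int) auto
qed

lemma borel_measurable_compose_simple:
  assumes s: "simple_function M s" and h: "\<And>y. (\<lambda>z. h (F z) y) \<in> borel_measurable M"
  shows "(\<lambda>z. h (F z) (s z)) \<in> borel_measurable M"
proof (rule measurable_compose_countable'[where f = "\<lambda>y z. h (F z) y" and I = "s ` space M"])
  have "finite (s ` space M)" using s by (simp add: simple_function_def)
  then show "countable (s ` space M)" by (rule countable_finite)
  show "s \<in> M \<rightarrow>\<^sub>M count_space (s ` space M)"
    using s by (subst measurable_count_space_eq2) (auto simp: simple_function_def)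
qed (rule h)

lemma borel_measurable_translate:
  fixes F :: "'b \<Rightarrow> 'a::real_normed_vector"
  assumes "F \<in> borel_measurable M"
  shows "(\<lambda>z. F z - y) \<in> borel_measurable M" "(\<lambda>z. F z + y) \<in> borel_measurable M"
  using assms by (auto intro!: borel_measurable_continuous_on[of "\<lambda>x. x - y"]
    borel_measurable_continuous_on[of "\<lambda>x. x + y"] continuous_intros)

lemma borel_measurable_diff_simple:
  fixes F :: "'b \<Rightarrow> 'a::real_normed_vector"
  assumes "F \<in> borel_measurable M" "simple_function M s"
  shows "(\<lambda>z. F z - s z) \<in> borel_measurable M"
  by (rule borel_measurable_compose_simple[OF assms(2)]) (rule borel_measurable_translate[OF assms(1)])

lemma borel_measurable_add_scaleC:
  fixes c :: "'a::complex_banach"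
  assumes F: "F \<in> borel_measurable M" and "\<phi> \<in> borel_measurable M"
  shows "(\<lambda>z. F z + \<phi> z *\<^sub>C c) \<in> borel_measurable M"
  by (rule borel_measurable_continuous_pair[OF assms])
     (auto simp: case_prod_unfold intro!: continuous_intros scaleC.continuous_on)

lemma borel_measurable_scaleC:
  fixes F :: "'b \<Rightarrow> 'a::complex_banach"
  assumes F: "F \<in> borel_measurable M" and "\<phi> \<in> borel_measurable M"
  shows "(\<lambda>z. \<phi> z *\<^sub>C F z) \<in> borel_measurable M"
  by (rule borel_measurable_continuous_pair[OF assms])
     (auto simp: case_prod_unfold intro!: continuous_intros scaleC.continuous_on)

lemma strongly_measurable_zero [simp]: "strongly_measurable M (\<lambda>_. 0)"
  unfolding strongly_measurable_def by (auto intro!: exI[of _ "\<lambda>_ _. 0"])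

lemma complex_simple_limit:
  assumes "\<phi> \<in> borel_measurable M"
  obtains t :: "nat \<Rightarrow> 'b \<Rightarrow> complex" where "\<And>i. simple_function M (t i)"
    "\<And>z. z \<in> space M \<Longrightarrow> (\<lambda>i. t i z) \<longlonglongrightarrow> \<phi> z"
  using borel_measurable_implies_sequence_metric[OF assms, of 0] by blast

lemma strongly_measurable_scaleC:
  fixes F :: "'b \<Rightarrow> 'a::complex_banach"
  assumes F: "strongly_measurable M F" and \<phi>: "\<phi> \<in> borel_measurable M"
  shows "strongly_measurable M (\<lambda>z. \<phi> z *\<^sub>C F z)"
proof -
  obtain s where s: "\<And>i::nat. simple_function M (s i)" "AE z in M. (\<lambda>i. s i z) \<longlonglongrightarrow> F z"
    and Fm: "F \<in> borel_measurable M"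
    using F unfolding strongly_measurable_def by blast
  obtain t where t: "\<And>i. simple_function M (t i)" "\<And>z. z \<in> space M \<Longrightarrow> (\<lambda>i. t i z) \<longlonglongrightarrow> \<phi> z"
    using complex_simple_limit[OF \<phi>] by blast
  have "AE z in M. (\<lambda>i. t i z *\<^sub>C s i z) \<longlonglongrightarrow> \<phi> z *\<^sub>C F z"
    using s(2) AE_space by eventually_elim (auto intro!: scaleC.tendsto t(2))
  moreover have "simple_function M (\<lambda>z. t i z *\<^sub>C s i z)" for i
    by (rule simple_function_compose2[where h = "(*\<^sub>C)", OF t(1) s(1)])
  ultimately show ?thesis
    unfolding strongly_measurable_def using borel_measurable_scaleC[OF Fm \<phi>]
    by (intro conjI exI[of _ "\<lambda>i z. t i z *\<^sub>C s i z"]) auto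
qed

lemma strongly_measurable_add_scaleC:
  fixes c :: "'a::complex_banach"
  assumes F: "strongly_measurable M F" and \<phi>: "\<phi> \<in> borel_measurable M"
  shows "strongly_measurable M (\<lambda>z. F z + \<phi> z *\<^sub>C c)"
proof -
  obtain s where s: "\<And>i::nat. simple_function M (s i)" "AE z in M. (\<lambda>i. s i z) \<longlonglongrightarrow> F z"
    and Fm: "F \<in> borel_measurable M"
    using F unfolding strongly_measurable_def by blast
  obtain t where t: "\<And>i. simple_function M (t i)" "\<And>z. z \<in> space M \<Longrightarrow> (\<lambda>i. t i z) \<longlonglongrightarrow> \<phi> z"
    using complex_simple_limit[OF \<phi>] by blast
  have "AE z in M. (\<lambda>i. s i z + t i z *\<^sub>C c) \<longlonglongrightarrow> F z + \<phi> z *\<^sub>C c"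
    using s(2) AE_space by eventually_elim (auto intro!: tendsto_add scaleC.tendsto t(2))
  moreover have "simple_function M (\<lambda>z. s i z + t i z *\<^sub>C c)" for i
    by (intro simple_function_compose2[where h = "\<lambda>x u. x + u *\<^sub>C c"] s t)
  ultimately show ?thesis
    unfolding strongly_measurable_def using borel_measurable_add_scaleC[OF Fm \<phi>]
    by (intro conjI exI[of _ "\<lambda>i z. s i z + t i z *\<^sub>C c"]) auto
qed

lemma strongly_measurable_add_sum_scaleC:
  fixes c :: "'i \<Rightarrow> 'a::complex_banach"
  assumes "finite I" and F: "strongly_measurable M F"
    and \<phi>: "\<And>i. i \<in> I \<Longrightarrow> \<phi> i \<in> borel_measurable M"
  shows "strongly_measurable M (\<lambda>z. F z + (\<Sum>i\<in>I. \<phi> i z *\<^sub>C c i))"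
  using assms(1) \<phi>
proof (induction I rule: finite_induct)
  case (insert i I)
  have "strongly_measurable M (\<lambda>z. (F z + (\<Sum>i\<in>I. \<phi> i z *\<^sub>C c i)) + \<phi> i z *\<^sub>C c i)"
    using insert by (intro strongly_measurable_add_scaleC) auto
  then show ?case using insert.hyps by (simp add: add_ac)
qed (use F in simp)

lemma strongly_measurable_sum_scaleC:
  fixes c :: "'i \<Rightarrow> 'a::complex_banach"
  assumes "finite I" and "\<And>i. i \<in> I \<Longrightarrow> \<phi> i \<in> borel_measurable M"
  shows "strongly_measurable M (\<lambda>z. \<Sum>i\<in>I. \<phi> i z *\<^sub>C c i)"
  using strongly_measurable_add_sum_scaleC[OF assms(1) strongly_measurable_zero,
    where \<phi> = \<phi> and c = c] assms by simp

lemma strongly_measurable_borel: "strongly_measurable M F \<Longrightarrow> F \<in> borel_measurable M"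
  by (simp add: strongly_measurable_def)

lemma borel_measurable_norm_nonseparable:
  fixes F :: "'b \<Rightarrow> 'a::real_normed_vector"
  shows "F \<in> borel_measurable M \<Longrightarrow> (\<lambda>z. norm (F z)) \<in> borel_measurable M"
  by (rule borel_measurable_continuous_on[where f = norm]) (intro continuous_intros)

lemma strongly_measurable_norm:
  "strongly_measurable M F \<Longrightarrow> (\<lambda>z. norm (F z)) \<in> borel_measurable M"
  by (intro borel_measurable_norm_nonseparable) (simp add: strongly_measurable_def)

text \<open>The approximating simple functions are set to 0 where their norm exceeds twice that of F. At a
  point with F \<noteq> 0 this affects only finitely many of them.\<close>
lemma strongly_measurable_dominated_approx:
  assumes F: "strongly_measurable M F"
  obtains s where "\<And>i::nat. simple_function M (s i)" "AE z in M. (\<lambda>i. s i z) \<longlonglongrightarrow> F z"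
    "\<And>i z. norm (s i z) \<le> 2 * norm (F z)"
proof -
  obtain s where s: "\<And>i::nat. simple_function M (s i)" "AE z in M. (\<lambda>i. s i z) \<longlonglongrightarrow> F z"
    and Fm: "F \<in> borel_measurable M"
    using F unfolding strongly_measurable_def by blast
  have nF [measurable]: "(\<lambda>z. norm (F z)) \<in> borel_measurable M" using F by (rule strongly_measurable_norm)
  define s' where "s' i z = (if norm (s i z) \<le> 2 * norm (F z) then s i z else 0)" for i z
  have ns [measurable]: "(\<lambda>z. norm (s i z)) \<in> borel_measurable M" for i
    by (rule borel_measurable_simple_function) (rule simple_function_compose1[OF s(1)])
  have "simple_function M (s' i)" for i
    unfolding s'_def by (intro simple_function_If s(1)) (auto)
  moreover have "AE z in M. (\<lambda>i. s' i z) \<longlonglongrightarrow> F z"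
    using s(2)
  proof eventually_elim
    case (elim z)
    show ?case
    proof (cases "F z = 0")
      case True
      then have "s' i z = 0" for i by (auto simp: s'_def)
      then show ?thesis using True by simp
    next
      case False
      have "(\<lambda>i. norm (s i z)) \<longlonglongrightarrow> norm (F z)" using elim by (rule tendsto_norm)
      then have "\<forall>\<^sub>F i in sequentially. norm (s i z) < 2 * norm (F z)"
        using False by (intro order_tendstoD) auto
      then have "\<forall>\<^sub>F i in sequentially. s i z = s' i z"
        by eventually_elim (auto simp: s'_def)
      then show ?thesis using elim by (rule Lim_transform_eventually[rotated])
    qed
  qed
  moreover have "norm (s' i z) \<le> 2 * norm (F z)" for i z by (auto simp: s'_def)
  ultimately show ?thesis by (rule that)
qed

text \<open>The p-th power of the \<open>L\<^sub>p\<close> norm. Without the root and with values in \<open>[0, \<infinity>]\<close>, it can be handled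
  directly by Tonelli's theorem and Fatou's lemma.\<close>
definition LpN :: "'b measure \<Rightarrow> real \<Rightarrow> ('b \<Rightarrow> 'a::real_normed_vector) \<Rightarrow> ennreal" where
  "LpN M p F = (\<integral>\<^sup>+ z. ennreal (norm (F z) powr p) \<partial>M)"

lemma LpN_one: "LpN M 1 F = (\<integral>\<^sup>+ z. ennreal (norm (F z)) \<partial>M)"
  by (simp add: LpN_def)

lemma LpN_cong: "(\<And>z. z \<in> space M \<Longrightarrow> norm (F z) = norm (G z)) \<Longrightarrow> LpN M p F = LpN M p G"
  unfolding LpN_def by (intro nn_integral_cong) simp

lemma LpN_dominated_convergence:
  fixes F :: "nat \<Rightarrow> 'b \<Rightarrow> 'a::real_normed_vector"
  assumes p: "p > 0" and m [measurable]: "\<And>i. (\<lambda>z. norm (F i z)) \<in> borel_measurable M" "w \<in> borel_measurable M"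
    and w: "(\<integral>\<^sup>+ z. ennreal (w z powr p) \<partial>M) < \<infinity>"
    and le: "\<And>i z. z \<in> space M \<Longrightarrow> norm (F i z) \<le> w z" and lim: "AE z in M. (\<lambda>i. F i z) \<longlonglongrightarrow> 0"
  shows "(\<lambda>i. LpN M p (F i)) \<longlonglongrightarrow> 0"
proof -
  have "(\<lambda>i. LpN M p (F i)) \<longlonglongrightarrow> (\<integral>\<^sup>+ z. 0 \<partial>M)"
    unfolding LpN_def
  proof (rule nn_integral_dominated_convergence[where w = "\<lambda>z. ennreal (w z powr p)"])
    show "AE z in M. ennreal (norm (F i z) powr p) \<le> ennreal (w z powr p)" for i
      using le p by (intro AE_I2 ennreal_leI powr_mono2) auto
    show "AE z in M. (\<lambda>i. ennreal (norm (F i z) powr p)) \<longlonglongrightarrow> 0"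
      using lim
    proof eventually_elim
      case (elim z)
      have "(\<lambda>i. norm (F i z) powr p) \<longlonglongrightarrow> 0 powr p"
        using p tendsto_norm_zero[OF elim] by (intro tendsto_powr2[OF _ tendsto_const]) auto
      then have "(\<lambda>i. ennreal (norm (F i z) powr p)) \<longlonglongrightarrow> ennreal 0"
        by (intro tendsto_ennrealI) simp
      then show ?case by simp
    qed
  qed (use w in auto)
  then show ?thesis by simp
qed

lemma LpN_simple_approx:
  fixes F :: "'b \<Rightarrow> 'a::banach"
  assumes F: "strongly_measurable M F" and p: "p > 0" and fin: "LpN M p F < \<infinity>"
  obtains s where "\<And>i::nat. simple_function M (s i)" "(\<lambda>i. LpN M p (\<lambda>z. F z - s i z)) \<longlonglongrightarrow> 0"
proof -
  obtain s where s: "\<And>i::nat. simple_function M (s i)" "AE z in M. (\<lambda>i. s i z) \<longlonglongrightarrow> F z"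
    and bd: "\<And>i z. norm (s i z) \<le> 2 * norm (F z)"
    using strongly_measurable_dominated_approx[OF F] by blast
  have [measurable]: "(\<lambda>z. norm (F z)) \<in> borel_measurable M"
    using F by (rule strongly_measurable_norm)
  have "(\<lambda>i. LpN M p (\<lambda>z. F z - s i z)) \<longlonglongrightarrow> 0"
  proof (rule LpN_dominated_convergence[OF p, where w = "\<lambda>z. 3 * norm (F z)"])
    show "(\<lambda>z. norm (F z - s i z)) \<in> borel_measurable M" for i
      by (intro borel_measurable_norm_nonseparable borel_measurable_diff_simple strongly_measurable_borel F s)
    show "norm (F z - s i z) \<le> 3 * norm (F z)" for i z
      using norm_triangle_ineq4[of "F z" "s i z"] bd[of i z] by simp
    have "(\<integral>\<^sup>+ z. ennreal ((3 * norm (F z)) powr p) \<partial>M) = ennreal (3 powr p) * LpN M p F"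
      unfolding LpN_def by (simp add: powr_mult ennreal_mult nn_integral_cmult)
    also have "\<dots> < \<infinity>" using fin by (simp add: ennreal_mult_less_top)
    finally show "(\<integral>\<^sup>+ z. ennreal ((3 * norm (F z)) powr p) \<partial>M) < \<infinity>" .
    show "AE z in M. (\<lambda>i. F z - s i z) \<longlonglongrightarrow> 0"
      using s(2)
    proof eventually_elim
      case (elim z)
      show ?case using tendsto_diff[OF tendsto_const elim, of "F z"] by simp
    qed
  qed simp
  then show ?thesis using s(1) by (intro that)
qed

section \<open>The Bochner integral without separability\<close>

abbreviation "sb_integrable \<equiv> Bochner_Integration.simple_bochner_integrable"
abbreviation "sb_integral \<equiv> Bochner_Integration.simple_bochner_integral"

lemma simple_bochner_integrable_finite_measure:
  assumes "finite_measure M" "simple_function M s"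
  shows "sb_integrable M s"
  using assms finite_measure.emeasure_finite[of M] by (auto intro!: simple_bochner_integrable.intros)

lemma simple_bochner_integrable_simple_function:
  "sb_integrable M s \<Longrightarrow> simple_function M s"
  by (rule simple_bochner_integrable.cases)

lemma simple_bochner_integral_norm_nn_integral:
  assumes "sb_integrable M s"
  shows "ennreal (norm (sb_integral M s)) \<le> (\<integral>\<^sup>+ z. ennreal (norm (s z)) \<partial>M)"
proof -
  have "sb_integrable M (\<lambda>z. norm (s z))"
    using simple_bochner_integrable_compose2[OF _ assms assms, of "\<lambda>x y. norm x"] by simp
  then have "ennreal (sb_integral M (\<lambda>z. norm (s z))) = (\<integral>\<^sup>+ z. ennreal (norm (s z)) \<partial>M)"
    by (intro simple_bochner_integral_eq_nn_integral) auto
  then show ?thesis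
    using ennreal_leI[OF simple_bochner_integral_norm_bound[OF assms]] by metis
qed

lemma simple_bochner_integral_dist:
  fixes F :: "'b \<Rightarrow> 'a::banach"
  assumes F: "F \<in> borel_measurable M"
    and s: "sb_integrable M s"
    and t: "sb_integrable M t"
  shows "ennreal (dist (sb_integral M s) (sb_integral M t)) \<le>
    (\<integral>\<^sup>+ z. ennreal (norm (F z - s z)) \<partial>M) + (\<integral>\<^sup>+ z. ennreal (norm (F z - t z)) \<partial>M)"
proof -
  have [measurable]: "(\<lambda>z. norm (F z - s z)) \<in> borel_measurable M" "(\<lambda>z. norm (F z - t z)) \<in> borel_measurable M"
    using s t by (auto intro!: borel_measurable_norm_nonseparable borel_measurable_diff_simple F
      simple_bochner_integrable_simple_function)
  have "ennreal (dist (sb_integral M s) (sb_integral M t))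
     = ennreal (norm (sb_integral M (\<lambda>z. s z - t z)))"
    using s t by (simp add: simple_bochner_integral_diff dist_norm)
  also have "\<dots> \<le> (\<integral>\<^sup>+ z. ennreal (norm (s z - t z)) \<partial>M)"
    using simple_bochner_integrable_compose2[OF _ s t, of "(-)"]
    by (intro simple_bochner_integral_norm_nn_integral) simp
  also have "\<dots> \<le> (\<integral>\<^sup>+ z. ennreal (norm (F z - s z)) + ennreal (norm (F z - t z)) \<partial>M)"
  proof (rule nn_integral_mono)
    fix z
    have "norm (s z - t z) \<le> norm (F z - s z) + norm (F z - t z)"
      using norm_triangle_ineq4[of "F z - t z" "F z - s z"] by simp
    then show "ennreal (norm (s z - t z)) \<le> ennreal (norm (F z - s z)) + ennreal (norm (F z - t z))"
      by (simp flip: ennreal_plus)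
  qed
  also have "\<dots> = (\<integral>\<^sup>+ z. ennreal (norm (F z - s z)) \<partial>M) + (\<integral>\<^sup>+ z. ennreal (norm (F z - t z)) \<partial>M)"
    by (rule nn_integral_add) auto
  finally show ?thesis .
qed

lemma ennreal_tendsto_0_le:
  fixes f :: "'i \<Rightarrow> ennreal"
  assumes "\<And>i. f i \<le> g i" "(g \<longlongrightarrow> 0) F"
  shows "(f \<longlongrightarrow> 0) F"
  by (rule tendsto_sandwich[OF _ _ tendsto_const assms(2)]) (use assms(1) in auto)

lemma ennreal_tendsto_0I:
  fixes f :: "'i \<Rightarrow> ennreal"
  assumes "\<And>\<epsilon>. 0 < \<epsilon> \<Longrightarrow> \<forall>\<^sub>F x in F. f x < ennreal \<epsilon>"
  shows "(f \<longlongrightarrow> 0) F"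
proof (rule order_tendstoI)
  fix a :: ennreal assume "a > 0"
  then obtain \<epsilon> where \<epsilon>: "0 < \<epsilon>" "ennreal \<epsilon> < a"
    by (metis ennreal_zero_less_one dense ennreal_cases ennreal_less_zero_iff infinity_ennreal_def not_less_iff_gr_or_eq top_greatest order.strict_trans2 leI)
  show "\<forall>\<^sub>F x in F. f x < a"
    using assms[OF \<epsilon>(1)] by eventually_elim (rule less_trans[OF _ \<epsilon>(2)])
qed simp

lemma tendsto_0_ennreal_dist:
  fixes f g :: "nat \<Rightarrow> 'a::metric_space"
  assumes "\<And>i. ennreal (dist (f i) (g i)) \<le> a i" "a \<longlonglongrightarrow> 0"
  shows "(\<lambda>i. dist (f i) (g i)) \<longlonglongrightarrow> 0"
proof -
  have "(\<lambda>i. ennreal (dist (f i) (g i))) \<longlonglongrightarrow> 0"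
    by (rule tendsto_sandwich[OF _ _ tendsto_const assms(2)]) (use assms(1) in auto)
  then have "(\<lambda>i. enn2real (ennreal (dist (f i) (g i)))) \<longlonglongrightarrow> enn2real 0"
    by (intro tendsto_enn2real) auto
  then show ?thesis by simp
qed

lemma has_bochner_int_unique:
  assumes "has_bochner_int M F x" "has_bochner_int M F y"
  shows "x = y"
proof -
  obtain s where s: "\<And>i::nat. sb_integrable M (s i)"
      "(\<lambda>i. \<integral>\<^sup>+ z. ennreal (norm (F z - s i z)) \<partial>M) \<longlonglongrightarrow> 0"
      "(\<lambda>i. sb_integral M (s i)) \<longlonglongrightarrow> x"
    and F: "F \<in> borel_measurable M"
    using assms(1) unfolding has_bochner_int_def by blast
  obtain t where t: "\<And>i::nat. sb_integrable M (t i)"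
      "(\<lambda>i. \<integral>\<^sup>+ z. ennreal (norm (F z - t i z)) \<partial>M) \<longlonglongrightarrow> 0"
      "(\<lambda>i. sb_integral M (t i)) \<longlonglongrightarrow> y"
    using assms(2) unfolding has_bochner_int_def by blast
  have "(\<lambda>i. dist (sb_integral M (s i)) (sb_integral M (t i))) \<longlonglongrightarrow> 0"
    by (rule tendsto_0_ennreal_dist[OF simple_bochner_integral_dist[OF F s(1) t(1)]])
       (use tendsto_add[OF s(2) t(2)] in simp)
  moreover have "(\<lambda>i. dist (sb_integral M (s i)) (sb_integral M (t i))) \<longlonglongrightarrow> dist x y"
    by (intro tendsto_dist s t)
  ultimately have "dist x y = 0" using LIMSEQ_unique by blast
  then show ?thesis by simp
qed

lemma bochner_int_eqI: "has_bochner_int M F x \<Longrightarrow> bochner_int M F = x"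
  unfolding bochner_int_def using has_bochner_int_unique by (auto intro!: the_equality)

text \<open>The measurability of the sum is a separate hypothesis, as it does not follow from that of the
  summands.\<close>
lemma has_bochner_int_add:
  assumes "has_bochner_int M F x" "has_bochner_int M G y"
    and FG: "(\<lambda>z. F z + G z) \<in> borel_measurable M"
  shows "has_bochner_int M (\<lambda>z. F z + G z) (x + y)"
proof -
  obtain s where s: "\<And>i::nat. sb_integrable M (s i)"
      "(\<lambda>i. \<integral>\<^sup>+ z. ennreal (norm (F z - s i z)) \<partial>M) \<longlonglongrightarrow> 0"
      "(\<lambda>i. sb_integral M (s i)) \<longlonglongrightarrow> x"
    and F: "F \<in> borel_measurable M"
    using assms(1) unfolding has_bochner_int_def by blast
  obtain t where t: "\<And>i::nat. sb_integrable M (t i)"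
      "(\<lambda>i. \<integral>\<^sup>+ z. ennreal (norm (G z - t i z)) \<partial>M) \<longlonglongrightarrow> 0"
      "(\<lambda>i. sb_integral M (t i)) \<longlonglongrightarrow> y"
    and G: "G \<in> borel_measurable M"
    using assms(2) unfolding has_bochner_int_def by blast
  have [measurable]: "(\<lambda>z. norm (F z - s i z)) \<in> borel_measurable M"
    "(\<lambda>z. norm (G z - t i z)) \<in> borel_measurable M" for i
    using s t by (auto intro!: borel_measurable_norm_nonseparable borel_measurable_diff_simple F G
      simple_bochner_integrable_simple_function)
  have le: "(\<integral>\<^sup>+ z. ennreal (norm (F z + G z - (s i z + t i z))) \<partial>M)
     \<le> (\<integral>\<^sup>+ z. ennreal (norm (F z - s i z)) \<partial>M) + (\<integral>\<^sup>+ z. ennreal (norm (G z - t i z)) \<partial>M)" for i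
  proof -
    have "(\<integral>\<^sup>+ z. ennreal (norm (F z + G z - (s i z + t i z))) \<partial>M)
      \<le> (\<integral>\<^sup>+ z. ennreal (norm (F z - s i z)) + ennreal (norm (G z - t i z)) \<partial>M)"
      by (intro nn_integral_mono) (auto simp: norm_diff_triangle_ineq simp flip: ennreal_plus)
    also have "\<dots> = (\<integral>\<^sup>+ z. ennreal (norm (F z - s i z)) \<partial>M) + (\<integral>\<^sup>+ z. ennreal (norm (G z - t i z)) \<partial>M)"
      by (rule nn_integral_add) auto
    finally show ?thesis .
  qed
  have "(\<lambda>i. \<integral>\<^sup>+ z. ennreal (norm (F z + G z - (s i z + t i z))) \<partial>M) \<longlonglongrightarrow> 0"
    by (rule ennreal_tendsto_0_le[OF le]) (use tendsto_add[OF s(2) t(2)] in simp)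
  moreover have "sb_integrable M (\<lambda>z. s i z + t i z)" for i
    using s t by (simp add: simple_bochner_integrable_compose2)
  moreover have "(\<lambda>i. sb_integral M (\<lambda>z. s i z + t i z)) \<longlonglongrightarrow> x + y"
    using tendsto_add[OF s(3) t(3)] s t by (simp add: simple_bochner_integral_add)
  ultimately show ?thesis unfolding has_bochner_int_def using FG
    by (intro conjI exI[of _ "\<lambda>i z. s i z + t i z"]) auto
qed

lemma has_bochner_int_bounded_linear:
  fixes T :: "'a::banach \<Rightarrow> 'c::banach"
  assumes T: "bounded_linear T" and "has_bochner_int M F x"
  shows "has_bochner_int M (\<lambda>z. T (F z)) (T x)"
proof -
  interpret T: bounded_linear T by (rule T)
  obtain s where s: "\<And>i::nat. sb_integrable M (s i)"
      "(\<lambda>i. \<integral>\<^sup>+ z. ennreal (norm (F z - s i z)) \<partial>M) \<longlonglongrightarrow> 0"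
      "(\<lambda>i. sb_integral M (s i)) \<longlonglongrightarrow> x"
    and F: "F \<in> borel_measurable M"
    using assms(2) unfolding has_bochner_int_def by blast
  obtain K where K: "K > 0" "\<And>x. norm (T x) \<le> norm x * K" using T.pos_bounded by blast
  have [measurable]: "(\<lambda>z. norm (F z - s i z)) \<in> borel_measurable M" for i
    using s by (auto intro!: borel_measurable_norm_nonseparable borel_measurable_diff_simple F
      simple_bochner_integrable_simple_function)
  have le: "(\<integral>\<^sup>+ z. ennreal (norm (T (F z) - T (s i z))) \<partial>M)
      \<le> ennreal K * (\<integral>\<^sup>+ z. ennreal (norm (F z - s i z)) \<partial>M)" for i
  proof -
    have "(\<integral>\<^sup>+ z. ennreal (norm (T (F z) - T (s i z))) \<partial>M)
        \<le> (\<integral>\<^sup>+ z. ennreal K * ennreal (norm (F z - s i z)) \<partial>M)"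
      using K(2)[of "F _ - s i _"] K(1)
      by (intro nn_integral_mono) (auto simp: T.diff mult.commute simp flip: ennreal_mult)
    then show ?thesis by (simp add: nn_integral_cmult)
  qed
  have "(\<lambda>i. ennreal K * (\<integral>\<^sup>+ z. ennreal (norm (F z - s i z)) \<partial>M)) \<longlonglongrightarrow> ennreal K * 0"
    by (rule ennreal_tendsto_cmult[OF _ s(2)]) simp
  then have "(\<lambda>i. ennreal K * (\<integral>\<^sup>+ z. ennreal (norm (F z - s i z)) \<partial>M)) \<longlonglongrightarrow> 0" by simp
  then have "(\<lambda>i. \<integral>\<^sup>+ z. ennreal (norm (T (F z) - T (s i z))) \<partial>M) \<longlonglongrightarrow> 0"
    by (rule ennreal_tendsto_0_le[OF le])
  moreover have "sb_integrable M (\<lambda>z. T (s i z))" for i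
    using simple_bochner_integrable_compose2[OF _ s(1) s(1), of "\<lambda>x y. T x"] by (simp add: T.zero)
  moreover have "(\<lambda>i. sb_integral M (\<lambda>z. T (s i z))) \<longlonglongrightarrow> T x"
    using T.tendsto[OF s(3)] simple_bochner_integral_linear[OF T.linear_axioms s(1)] by simp
  moreover have "(\<lambda>z. T (F z)) \<in> borel_measurable M"
    by (rule borel_measurable_continuous_on[OF _ F]) (intro linear_continuous_on T)
  ultimately show ?thesis unfolding has_bochner_int_def
    by (intro conjI exI[of _ "\<lambda>i z. T (s i z)"]) auto
qed

lemma has_bochner_int_scaleC_const:
  fixes c :: "'a::complex_banach"
  assumes "integrable M \<phi>"
  shows "has_bochner_int M (\<lambda>z. \<phi> z *\<^sub>C c) ((\<integral>z. \<phi> z \<partial>M) *\<^sub>C c)"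
proof -
  have "has_bochner_integral M \<phi> (\<integral>z. \<phi> z \<partial>M)" using assms by (rule has_bochner_integral_integrable)
  then have "has_bochner_int M \<phi> (\<integral>z. \<phi> z \<partial>M)"
    unfolding has_bochner_integral.simps has_bochner_int_def by auto
  then show ?thesis by (rule has_bochner_int_bounded_linear[OF scaleC.bounded_linear_left])
qed

lemma has_bochner_int_norm_bound:
  assumes "has_bochner_int M F x"
  shows "ennreal (norm (x :: 'a::banach)) \<le> (\<integral>\<^sup>+ z. ennreal (norm (F z)) \<partial>M)"
proof -
  obtain s where s: "\<And>i::nat. sb_integrable M (s i)"
      "(\<lambda>i. \<integral>\<^sup>+ z. ennreal (norm (F z - s i z)) \<partial>M) \<longlonglongrightarrow> 0"
      "(\<lambda>i. sb_integral M (s i)) \<longlonglongrightarrow> x"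
    and F: "F \<in> borel_measurable M"
    using assms(1) unfolding has_bochner_int_def by blast
  have 0: "sb_integrable M (\<lambda>_. 0 :: 'a)"
    by (rule simple_bochner_integrable.intros) auto
  have "sb_integral M (\<lambda>_. 0 :: 'a) = 0"
    by (simp add: simple_bochner_integral_def image_constant_conv)
  then have "ennreal (norm (sb_integral M (s i))) \<le>
    (\<integral>\<^sup>+ z. ennreal (norm (F z - s i z)) \<partial>M) + (\<integral>\<^sup>+ z. ennreal (norm (F z)) \<partial>M)" for i
    using simple_bochner_integral_dist[OF F s(1) 0, of i] by simp
  moreover have "(\<lambda>i. ennreal (norm (sb_integral M (s i)))) \<longlonglongrightarrow> ennreal (norm x)"
    by (intro tendsto_ennrealI tendsto_norm s)
  moreover have "(\<lambda>i. (\<integral>\<^sup>+ z. ennreal (norm (F z - s i z)) \<partial>M) + (\<integral>\<^sup>+ z. ennreal (norm (F z)) \<partial>M))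
      \<longlonglongrightarrow> 0 + (\<integral>\<^sup>+ z. ennreal (norm (F z)) \<partial>M)"
    by (intro tendsto_add s tendsto_const)
  ultimately show ?thesis using LIMSEQ_le[of _ "ennreal (norm x)"] by (metis (no_types, lifting) add_0)
qed

text \<open>Simple functions that approximate F in \<open>L\<^sub>1\<close> have integrals forming a Cauchy sequence.\<close>
lemma has_bochner_int_bochner_int:
  fixes F :: "'b \<Rightarrow> 'a::banach"
  assumes M: "finite_measure M" and F: "strongly_measurable M F"
    and fin: "(\<integral>\<^sup>+ z. ennreal (norm (F z)) \<partial>M) < \<infinity>"
  shows "has_bochner_int M F (bochner_int M F)"
proof -
  have Fb: "F \<in> borel_measurable M" using F by (rule strongly_measurable_borel)
  have fin1: "LpN M 1 F < \<infinity>" using fin by (simp add: LpN_one)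
  obtain s where s1: "\<And>i::nat. simple_function M (s i)" "(\<lambda>i. LpN M 1 (\<lambda>z. F z - s i z)) \<longlonglongrightarrow> 0"
    by (rule LpN_simple_approx[OF F zero_less_one fin1]) (rule that)
  note s = s1(1) s1(2)[unfolded LpN_one]
  have sb: "sb_integrable M (s i)" for i
    by (rule simple_bochner_integrable_finite_measure[OF M s(1)])
  let ?I = "\<lambda>i. sb_integral M (s i)"
  have "Cauchy ?I"
  proof (rule metric_CauchyI)
    fix e :: real assume e: "e > 0"
    then have "\<forall>\<^sub>F i in sequentially. (\<integral>\<^sup>+ z. ennreal (norm (F z - s i z)) \<partial>M) < ennreal (e/2)"
      by (intro order_tendstoD(2)[OF s(2)]) simp
    then obtain N where N: "\<And>i. i \<ge> N \<Longrightarrow> (\<integral>\<^sup>+ z. ennreal (norm (F z - s i z)) \<partial>M) < ennreal (e/2)"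
      by (auto simp: eventually_sequentially)
    show "\<exists>N. \<forall>m\<ge>N. \<forall>n\<ge>N. dist (?I m) (?I n) < e"
    proof (intro exI allI impI)
      fix m n assume mn: "m \<ge> N" "n \<ge> N"
      have "ennreal (dist (?I m) (?I n))
          \<le> (\<integral>\<^sup>+ z. ennreal (norm (F z - s m z)) \<partial>M) + (\<integral>\<^sup>+ z. ennreal (norm (F z - s n z)) \<partial>M)"
        by (rule simple_bochner_integral_dist[OF Fb sb sb])
      also have "\<dots> < ennreal (e/2) + ennreal (e/2)"
        by (intro add_strict_mono N mn)
      also have "\<dots> = ennreal e" using e by (simp flip: ennreal_plus)
      finally show "dist (?I m) (?I n) < e" by (simp add: ennreal_less_iff)
    qed
  qed
  then obtain x where "?I \<longlonglongrightarrow> x" using Cauchy_convergent convergent_def by blast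
  then have "has_bochner_int M F x" unfolding has_bochner_int_def using Fb sb s by blast
  then show ?thesis using bochner_int_eqI by metis
qed

section \<open>The circle and the infinite torus\<close>

lemma space_circle [simp]: "space circle_measure = sphere 0 1"
  by (simp add: circle_measure_def space_restrict_space)

lemma sets_circle [measurable_cong]: "sets circle_measure = sets (restrict_space borel (sphere 0 1))"
  by (simp add: circle_measure_def)

lemma cis_measurable_circle:
  "cis \<in> lborel \<rightarrow>\<^sub>M restrict_space borel (sphere 0 1)"
  by (intro measurable_restrict_space2) (auto intro!: borel_measurable_continuous_onI continuous_intros)

lemma prob_space_circle: "prob_space circle_measure"
  unfolding circle_measure_def
proof (rule prob_space.prob_space_distr)
  show "prob_space (uniform_measure lborel {0..<2*pi})"
    by (rule prob_space_uniform_measure) auto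
  show "cis \<in> uniform_measure lborel {0..<2 * pi} \<rightarrow>\<^sub>M restrict_space borel (sphere 0 1)"
    using cis_measurable_circle by (subst measurable_cong_sets[OF sets_uniform_measure refl])
qed

abbreviation \<S> where "\<S> \<equiv> circle_measure"

interpretation circle: prob_space \<S> by (rule prob_space_circle)

lemma borel_measurable_circle:
  "f \<in> borel_measurable borel \<Longrightarrow> f \<in> borel_measurable \<S>"
  by (subst measurable_cong_sets[OF sets_circle refl]) (rule measurable_restrict_space1)

lemma nn_integral_circle:
  assumes "f \<in> borel_measurable \<S>"
  shows "(\<integral>\<^sup>+ \<xi>. f \<xi> \<partial>\<S>) = (\<integral>\<^sup>+ t. f (cis t) * indicator {0..<2*pi} t \<partial>lborel) / ennreal (2 * pi)"
proof -
  have f: "f \<in> borel_measurable (restrict_space borel (sphere 0 1))"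
    using assms by (subst (asm) measurable_cong_sets[OF sets_circle refl])
  have "(\<integral>\<^sup>+ \<xi>. f \<xi> \<partial>\<S>) = (\<integral>\<^sup>+ t. f (cis t) \<partial>uniform_measure lborel {0..<2*pi})"
    unfolding circle_measure_def using cis_measurable_circle
    using f
    by (intro nn_integral_distr) (simp_all add: measurable_cong_sets[OF sets_uniform_measure refl] measurable_distr_eq1)
  also have "\<dots> = (\<integral>\<^sup>+ t. f (cis t) * indicator {0..<2*pi} t \<partial>lborel) / emeasure lborel {0..<2*pi}"
    using measurable_compose[OF cis_measurable_circle f] by (intro nn_integral_uniform_measure) auto
  finally show ?thesis by simp
qed

text \<open>The part of the shifted interval beyond \<open>2 \<pi>\<close> is moved back by one period.\<close>
lemma nn_integral_period_shift:
  fixes g :: "real \<Rightarrow> ennreal"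
  assumes g [measurable]: "g \<in> borel_measurable borel" and per: "\<And>t. g (2 * pi + t) = g t"
    and a: "0 \<le> a" "a < 2 * pi"
  shows "(\<integral>\<^sup>+ t. g (a + t) * indicator {0..<2*pi} t \<partial>lborel) = (\<integral>\<^sup>+ t. g t * indicator {0..<2*pi} t \<partial>lborel)"
proof -
  have "(\<integral>\<^sup>+ t. g (a + t) * indicator {0..<2*pi} t \<partial>lborel)
      = (\<integral>\<^sup>+ t. g (a + 1 * t) * indicator {a..<2*pi + a} (a + 1 * t) \<partial>lborel)"
    by (intro nn_integral_cong) (auto split: split_indicator)
  also have "\<dots> = (\<integral>\<^sup>+ t. g t * indicator {a..<2*pi + a} t \<partial>lborel)"
    using nn_integral_real_affine[of "\<lambda>t. g t * indicator {a..<2*pi + a} t" 1 a] by simp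
  also have "\<dots> = (\<integral>\<^sup>+ t. g t * indicator {a..<2*pi} t + g t * indicator {2*pi..<2*pi + a} t \<partial>lborel)"
    using a by (intro nn_integral_cong) (auto split: split_indicator)
  also have "\<dots> = (\<integral>\<^sup>+ t. g t * indicator {a..<2*pi} t \<partial>lborel)
      + (\<integral>\<^sup>+ t. g t * indicator {2*pi..<2*pi + a} t \<partial>lborel)"
    by (rule nn_integral_add) auto
  also have "(\<integral>\<^sup>+ t. g t * indicator {2*pi..<2*pi + a} t \<partial>lborel)
      = (\<integral>\<^sup>+ t. g (2*pi + 1*t) * indicator {2*pi..<2*pi + a} (2*pi + 1*t) \<partial>lborel)"
    using nn_integral_real_affine[of "\<lambda>t. g t * indicator {2*pi..<2*pi + a} t" 1 "2*pi"] by simp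
  also have "\<dots> = (\<integral>\<^sup>+ t. g t * indicator {0..<a} t \<partial>lborel)"
    using per by (intro nn_integral_cong) (auto split: split_indicator)
  also have "(\<integral>\<^sup>+ t. g t * indicator {a..<2*pi} t \<partial>lborel) + (\<integral>\<^sup>+ t. g t * indicator {0..<a} t \<partial>lborel)
    = (\<integral>\<^sup>+ t. g t * indicator {a..<2*pi} t + g t * indicator {0..<a} t \<partial>lborel)"
    by (rule nn_integral_add[symmetric]) auto
  also have "\<dots> = (\<integral>\<^sup>+ t. g t * indicator {0..<2*pi} t \<partial>lborel)"
    using a by (intro nn_integral_cong) (auto split: split_indicator)
  finally show ?thesis .
qed

lemma mult_measurable_circle:
  assumes "cmod w = 1"
  shows "(\<lambda>\<xi>. w * \<xi>) \<in> \<S> \<rightarrow>\<^sub>M \<S>"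
  unfolding measurable_cong_sets[OF sets_circle sets_circle] using assms
  by (intro measurable_restrict_space3) (auto simp: norm_mult intro!: borel_measurable_continuous_onI continuous_intros)

lemma distr_circle_rotate:
  assumes w: "cmod w = 1"
  shows "distr \<S> \<S> (\<lambda>\<xi>. w * \<xi>) = \<S>"
proof (rule measure_eqI)
  fix A assume "A \<in> sets (distr \<S> \<S> (\<lambda>\<xi>. w * \<xi>))"
  then have A: "A \<in> sets \<S>" by simp
  \<comment> \<open>the angle of w in \<open>[0, 2 \<pi>)\<close>\<close>
  define a where "a = (if Arg w < 0 then Arg w + 2 * pi else Arg w)"
  have a: "0 \<le> a" "a < 2 * pi" using Arg_bounded[of w] by (auto simp: a_def)
  have wcis: "w = cis a"
  proof -
    have "w \<noteq> 0" using w by auto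
    then have "cis (Arg w) = w" using cis_Arg[of w] w by (simp add: sgn_eq)
    then show ?thesis by (auto simp: a_def simp flip: cis_mult)
  qed
  have f: "(indicator A :: complex \<Rightarrow> ennreal) \<in> borel_measurable \<S>" using A by simp
  then have f': "(indicator A :: complex \<Rightarrow> ennreal) \<in> borel_measurable (restrict_space borel (sphere 0 1))"
    by (subst (asm) measurable_cong_sets[OF sets_circle refl])
  have g: "(\<lambda>t. indicator A (cis t) :: ennreal) \<in> borel_measurable borel"
    using measurable_compose[OF cis_measurable_circle f'] by simp
  have "emeasure (distr \<S> \<S> (\<lambda>\<xi>. w * \<xi>)) A
     = (\<integral>\<^sup>+ \<xi>. indicator A \<xi> \<partial>distr \<S> \<S> (\<lambda>\<xi>. w * \<xi>))"
    using A by simp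
  also have "\<dots> = (\<integral>\<^sup>+ \<xi>. indicator A (w * \<xi>) \<partial>\<S>)"
    using f by (intro nn_integral_distr mult_measurable_circle w) simp
  also have "\<dots> = (\<integral>\<^sup>+ t. indicator A (w * cis t) * indicator {0..<2*pi} t \<partial>lborel) / ennreal (2 * pi)"
    by (rule nn_integral_circle) (rule measurable_compose[OF mult_measurable_circle[OF w] f])
  also have "(\<integral>\<^sup>+ t. indicator A (w * cis t) * indicator {0..<2*pi} t \<partial>lborel)
    = (\<integral>\<^sup>+ t. indicator A (cis (a + t)) * indicator {0..<2*pi} t \<partial>lborel)"
    by (simp add: wcis cis_mult)
  also have "\<dots> = (\<integral>\<^sup>+ t. indicator A (cis t) * indicator {0..<2*pi} t \<partial>lborel)"
    by (rule nn_integral_period_shift[OF g _ a]) (simp flip: cis_mult)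
  also have "\<dots> / ennreal (2 * pi) = (\<integral>\<^sup>+ \<xi>. indicator A \<xi> \<partial>\<S>)"
    by (rule nn_integral_circle[OF f, symmetric])
  also have "\<dots> = emeasure \<S> A" using A by simp
  finally show "emeasure (distr \<S> \<S> (\<lambda>\<xi>. w * \<xi>)) A = emeasure \<S> A" .
qed simp

lemma integrable_circle_bounded:
  fixes f :: "complex \<Rightarrow> complex"
  assumes "f \<in> borel_measurable borel" "\<And>\<xi>. cmod \<xi> = 1 \<Longrightarrow> cmod (f \<xi>) \<le> B"
  shows "integrable \<S> f"
  by (rule circle.integrable_const_bound[of _ B])
     (use assms in \<open>auto intro!: AE_I2 borel_measurable_circle\<close>)

text \<open>The rotation by \<open>\<pi> / k\<close> preserves the measure and changes the sign of \<open>\<xi> ^ k\<close>.\<close>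
lemma integral_circle_power:
  assumes "k > 0"
  shows "(\<integral>\<xi>. \<xi> ^ k \<partial>\<S>) = 0"
proof -
  define w where "w = cis (pi / real k)"
  have w: "cmod w = 1" "w ^ k = -1" using assms Complex.DeMoivre[of "pi / real k" k] by (auto simp: w_def)
  have meas: "(\<lambda>\<xi>::complex. \<xi> ^ k) \<in> borel_measurable \<S>"
    by (intro borel_measurable_circle) auto
  have "(\<integral>\<xi>. \<xi> ^ k \<partial>\<S>) = (\<integral>\<xi>. \<xi> ^ k \<partial>distr \<S> \<S> (\<lambda>\<xi>. w * \<xi>))"
    by (simp add: distr_circle_rotate w)
  also have "\<dots> = (\<integral>\<xi>. (w * \<xi>) ^ k \<partial>\<S>)"
    by (rule integral_distr[OF mult_measurable_circle[OF w(1)] meas])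
  also have "\<dots> = - (\<integral>\<xi>. \<xi> ^ k \<partial>\<S>)"
    by (simp add: power_mult_distrib w)
  finally show ?thesis by simp
qed

abbreviation \<T> where "\<T> \<equiv> torus_measure"

lemma space_torus: "space \<T> = {z. \<forall>j. cmod (z j) = 1}"
  by (auto simp: torus_measure_def space_PiM PiE_def Pi_def extensional_def)

lemma product_prob_space_circle: "product_prob_space (\<lambda>_::nat. \<S>)"
  by unfold_locales

interpretation T: product_prob_space "\<lambda>_::nat. \<S>" UNIV by (rule product_prob_space_circle)

lemma prob_space_torus: "prob_space \<T>"
  unfolding torus_measure_def by (rule T.prob_space_axioms)

interpretation torus: prob_space \<T> by (rule prob_space_torus)

lemma component_measurable_torus_circle [measurable]: "(\<lambda>z. z j) \<in> \<T> \<rightarrow>\<^sub>M \<S>"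
  unfolding torus_measure_def by simp

lemma component_measurable_torus [measurable]: "(\<lambda>z. z j) \<in> borel_measurable \<T>"
  using measurable_compose[OF component_measurable_torus_circle borel_measurable_circle[of "\<lambda>x. x"]] by simp

definition torus_rotate :: "(nat \<Rightarrow> complex) \<Rightarrow> (nat \<Rightarrow> complex) \<Rightarrow> nat \<Rightarrow> complex" where
  "torus_rotate w z = (\<lambda>j. w j * z j)"

lemma torus_rotate_measurable:
  assumes "\<And>j. cmod (w j) = 1"
  shows "torus_rotate w \<in> \<T> \<rightarrow>\<^sub>M \<T>"
proof -
  have "(\<lambda>z. \<lambda>j\<in>UNIV. w j * z j) \<in> \<T> \<rightarrow>\<^sub>M (\<Pi>\<^sub>M j\<in>UNIV. \<S>)"
    using mult_measurable_circle[OF assms]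
    by (intro measurable_restrict measurable_compose[OF component_measurable_torus_circle]) auto
  moreover have "torus_rotate w = (\<lambda>z. \<lambda>j\<in>UNIV. w j * z j)" by (auto simp: torus_rotate_def fun_eq_iff)
  ultimately show ?thesis by (simp only: torus_measure_def)
qed

text \<open>On a cylinder set only finitely many coordinates matter, and each of them is rotated on its own
  circle.\<close>
lemma distr_torus_rotate:
  assumes w: "\<And>j. cmod (w j) = 1"
  shows "distr \<T> \<T> (torus_rotate w) = \<T>"
proof -
  have "distr \<T> \<T> (torus_rotate w) = PiM UNIV (\<lambda>_::nat. \<S>)"
  proof (rule T.PiM_eq)
    show "sets (distr \<T> \<T> (torus_rotate w)) = sets (PiM UNIV (\<lambda>_. \<S>))"
      by (simp add: torus_measure_def)
    fix J :: "nat set" and F assume J: "finite J" and F: "\<And>j. j \<in> J \<Longrightarrow> F j \<in> sets \<S>"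
    let ?G = "\<lambda>j. (\<lambda>\<xi>. w j * \<xi>) -` F j \<inter> space \<S>"
    have G: "?G j \<in> sets \<S>" if "j \<in> J" for j
      by (rule measurable_sets[OF mult_measurable_circle[OF w] F[OF that]])
    let ?emb = "\<lambda>F. prod_emb UNIV (\<lambda>_::nat. \<S>) J (Pi\<^sub>E J F)"
    have emb: "?emb F \<in> sets \<T>"
      unfolding torus_measure_def by (rule sets_PiM_I) (use J F in auto)
    have "emeasure (distr \<T> \<T> (torus_rotate w)) (?emb F)
      = emeasure \<T> (torus_rotate w -` ?emb F \<inter> space \<T>)"
      by (rule emeasure_distr[OF torus_rotate_measurable[OF w] emb])
    also have "torus_rotate w -` ?emb F \<inter> space \<T> = ?emb ?G"
      using w by (auto simp: prod_emb_def space_PiM torus_measure_def torus_rotate_def PiE_iff norm_mult)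
    also have "emeasure \<T> (?emb ?G) = (\<Prod>j\<in>J. emeasure \<S> (?G j))"
      unfolding torus_measure_def by (rule T.emeasure_PiM_emb) (use J G in auto)
    also have "\<dots> = (\<Prod>j\<in>J. emeasure \<S> (F j))"
    proof (rule prod.cong[OF refl])
      fix j assume j: "j \<in> J"
      show "emeasure \<S> (?G j) = emeasure \<S> (F j)"
        using emeasure_distr[OF mult_measurable_circle[OF w] F[OF j], of j] distr_circle_rotate[OF w] by simp
    qed
    finally show "emeasure (distr \<T> \<T> (torus_rotate w)) (?emb F) = (\<Prod>j\<in>J. emeasure \<S> (F j))" .
  qed
  then show ?thesis by (simp add: torus_measure_def)
qed

lemma monomial_measurable [measurable]: "monomial \<nu> \<in> borel_measurable \<T>"
  unfolding monomial_def[abs_def] power_int_def by measurable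

lemma norm_monomial: "z \<in> space \<T> \<Longrightarrow> cmod (monomial \<nu> z) = 1"
  by (auto simp: monomial_def space_torus prod_norm[symmetric] norm_power_int intro!: prod.neutral)

lemma monomial_superset:
  assumes "finite J" "{j. \<nu> j \<noteq> 0} \<subseteq> J"
  shows "monomial \<nu> z = (\<Prod>j\<in>J. z j powi \<nu> j)"
  unfolding monomial_def using assms by (intro prod.mono_neutral_left) auto

lemma monomial_add:
  assumes "\<nu> \<in> eventually_null" "\<mu> \<in> eventually_null" "z \<in> space \<T>"
  shows "monomial (\<lambda>j. \<nu> j + \<mu> j) z = monomial \<nu> z * monomial \<mu> z"
proof -
  let ?J = "{j. \<nu> j \<noteq> 0} \<union> {j. \<mu> j \<noteq> 0}"
  have J: "finite ?J" using assms by (auto simp: eventually_null_def)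
  have "z j \<noteq> 0" for j using assms(3) by (auto simp: space_torus dest: spec[of _ j])
  then show ?thesis
    by (subst (1 2 3) monomial_superset[OF J]) (auto simp: power_int_add prod.distrib)
qed

lemma monomial_minus:
  assumes "z \<in> space \<T>"
  shows "monomial (\<lambda>j. - \<nu> j) z = cnj (monomial \<nu> z)"
proof -
  have "cnj (z j) = inverse (z j)" for j
  proof -
    have "z j * cnj (z j) = 1" using assms complex_norm_square[of "z j"] by (simp add: space_torus)
    then show ?thesis by (rule inverse_unique[symmetric])
  qed
  then show ?thesis
    by (simp add: monomial_def power_int_minus cnj_prod complex_cnj_power_int flip: power_int_inverse)
qed

lemma monomial_zero [simp]: "monomial (\<lambda>_. 0) z = 1"
  by (simp add: monomial_def)

lemma monomial_rotate: "monomial \<nu> (torus_rotate w z) = monomial \<nu> w * monomial \<nu> z"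
  by (simp add: monomial_def torus_rotate_def power_int_mult_distrib prod.distrib)

lemma integrable_torus_bounded:
  fixes f :: "(nat \<Rightarrow> complex) \<Rightarrow> 'a::{banach, second_countable_topology}"
  assumes "f \<in> borel_measurable \<T>" "\<And>z. z \<in> space \<T> \<Longrightarrow> norm (f z) \<le> B"
  shows "integrable \<T> f"
  by (rule torus.integrable_const_bound[of _ B]) (use assms in \<open>auto intro!: AE_I2\<close>)

lemma integrable_monomial: "integrable \<T> (monomial \<nu>)"
  by (rule integrable_torus_bounded[of _ 1]) (auto simp: norm_monomial)

text \<open>If \<open>\<nu> j \<noteq> 0\<close>, rotating the coordinate j by \<open>\<pi> / \<nu> j\<close> changes the sign of the monomial.\<close>
lemma integral_monomial:
  assumes "\<nu> \<in> eventually_null"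
  shows "(\<integral>z. monomial \<nu> z \<partial>\<T>) = (if \<nu> = (\<lambda>_. 0) then 1 else 0)"
proof (cases "\<nu> = (\<lambda>_. 0)")
  case True
  then show ?thesis by (simp add: torus.prob_space)
next
  case False
  then obtain j where j: "\<nu> j \<noteq> 0" by auto
  define w where "w = (\<lambda>_. 1)(j := cis (pi / of_int (\<nu> j)))"
  have w: "cmod (w i) = 1" for i by (auto simp: w_def)
  have "monomial \<nu> w = (\<Prod>i\<in>{i. \<nu> i \<noteq> 0}. if i = j then w j powi \<nu> j else 1)"
    unfolding monomial_def by (rule prod.cong) (auto simp: w_def)
  also have "\<dots> = w j powi \<nu> j"
    using assms j by (subst prod.delta) (auto simp: eventually_null_def)
  also have "\<dots> = -1" using j by (simp add: w_def cis_power_int)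
  finally have m: "monomial \<nu> w = -1" .
  have "(\<integral>z. monomial \<nu> z \<partial>\<T>) = (\<integral>z. monomial \<nu> z \<partial>distr \<T> \<T> (torus_rotate w))"
    by (simp add: distr_torus_rotate w)
  also have "\<dots> = (\<integral>z. monomial \<nu> (torus_rotate w z) \<partial>\<T>)"
    by (rule integral_distr[OF torus_rotate_measurable[OF w]]) simp
  also have "\<dots> = - (\<integral>z. monomial \<nu> z \<partial>\<T>)" by (simp add: monomial_rotate m)
  finally show ?thesis using False by simp
qed

section \<open>Integrals of powers of norms\<close>

text \<open>The graph of the convex function \<open>t powr p\<close> lies above its tangent at m.\<close>
lemma powr_tangent:
  fixes a m p :: real
  assumes "0 \<le> a" "0 < m" "1 \<le> p"
  shows "p * m powr (p - 1) * a \<le> a powr p + (p - 1) * m powr p"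
proof (cases "a = 0")
  case True
  then show ?thesis using assms by simp
next
  case False
  have mm: "m powr (p - 1) * m = m powr p" using assms by (simp add: powr_mult_base mult.commute)
  have "a powr p - m powr p \<ge> p * m powr (p - 1) * (a - m)"
    using assms False
    by (intro convex_on_imp_above_tangent[OF powr_convex[OF assms(3)]])
       (auto simp: interior_open has_field_derivative_at_within intro!: derivative_eq_intros)
  moreover have "p * m powr (p - 1) * (a - m) = p * m powr (p - 1) * a - p * m powr p"
    using mm by (simp add: right_diff_distrib mult.assoc)
  ultimately show ?thesis by (simp add: left_diff_distrib)
qed

text \<open>Convexity, applied to \<open>a / (1 - t)\<close> and \<open>b / t\<close> with weights \<open>1 - t\<close> and t. The factor of the
  first term tends to 1 with t, so this takes over the role of Minkowski's inequality in limits.\<close>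
lemma powr_add_le_convex:
  fixes a b p t :: real
  assumes "0 \<le> a" "0 \<le> b" "1 \<le> p" "0 < t" "t < 1"
  shows "(a + b) powr p \<le> (1 - t) powr (1 - p) * a powr p + t powr (1 - p) * b powr p"
proof -
  have ge1: "1 \<le> t powr (1 - p)" "1 \<le> (1 - t) powr (1 - p)"
    using powr_mono'[of "1 - p" 0 t] powr_mono'[of "1 - p" 0 "1 - t"] assms by auto
  show ?thesis
  proof (cases "a = 0 \<or> b = 0")
    case True
    then show ?thesis using ge1 mult_right_mono[OF ge1(1), of "b powr p"] mult_right_mono[OF ge1(2), of "a powr p"]
      by auto
  next
    case False
    have *: "s * (x / s) powr p = s powr (1 - p) * x powr p" if "s > 0" "x > 0" for s x
      using that by (simp add: powr_divide powr_diff)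
    have "((1 - t) *\<^sub>R (a / (1 - t)) + t *\<^sub>R (b / t)) powr p
      \<le> (1 - t) * (a / (1 - t)) powr p + t * (b / t) powr p"
      using assms False by (intro convex_onD[OF powr_convex[OF assms(3)]]) auto
    then show ?thesis using assms False by (simp add: *)
  qed
qed

lemma LpN_add_le_convex:
  assumes F: "(\<lambda>z. norm (F z)) \<in> borel_measurable M" and G: "(\<lambda>z. norm (G z)) \<in> borel_measurable M"
    and p: "1 \<le> p" and t: "0 < t" "t < 1"
    and H: "\<And>z. z \<in> space M \<Longrightarrow> norm (H z) \<le> norm (F z) + norm (G z)"
  shows "LpN M p H \<le> ennreal ((1 - t) powr (1 - p)) * LpN M p F + ennreal (t powr (1 - p)) * LpN M p G"
proof -
  note [measurable] = F G
  have "LpN M p H \<le> (\<integral>\<^sup>+ z. ennreal ((1 - t) powr (1 - p)) * ennreal (norm (F z) powr p) +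
      ennreal (t powr (1 - p)) * ennreal (norm (G z) powr p) \<partial>M)"
    unfolding LpN_def
  proof (rule nn_integral_mono)
    fix z assume "z \<in> space M"
    then have "norm (H z) powr p \<le> (norm (F z) + norm (G z)) powr p"
      using H p by (intro powr_mono2) auto
    also have "\<dots> \<le> (1 - t) powr (1 - p) * norm (F z) powr p + t powr (1 - p) * norm (G z) powr p"
      using p t by (intro powr_add_le_convex) auto
    finally show "ennreal (norm (H z) powr p) \<le> ennreal ((1 - t) powr (1 - p)) * ennreal (norm (F z) powr p) +
      ennreal (t powr (1 - p)) * ennreal (norm (G z) powr p)"
      by (simp flip: ennreal_mult ennreal_plus)
  qed
  also have "\<dots> = ennreal ((1 - t) powr (1 - p)) * LpN M p F + ennreal (t powr (1 - p)) * LpN M p G"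
    unfolding LpN_def by (subst nn_integral_add) (auto simp: nn_integral_cmult)
  finally show ?thesis .
qed

lemma LpN_add_le:
  assumes F: "(\<lambda>z. norm (F z)) \<in> borel_measurable M" and G: "(\<lambda>z. norm (G z)) \<in> borel_measurable M"
    and p: "1 \<le> p" and H: "\<And>z. z \<in> space M \<Longrightarrow> norm (H z) \<le> norm (F z) + norm (G z)"
  shows "LpN M p H \<le> ennreal (2 powr p) * (LpN M p F + LpN M p G)"
proof -
  have "(1 / 2) powr (1 - p) = 2 powr (p - 1)" by (simp add: powr_def ln_div algebra_simps)
  also have "\<dots> \<le> 2 powr p" by (intro powr_mono) auto
  finally have half: "ennreal ((1 / 2) powr (1 - p)) \<le> ennreal (2 powr p)" by (rule ennreal_leI)
  have "LpN M p H \<le> ennreal ((1 / 2) powr (1 - p)) * LpN M p F + ennreal ((1 / 2) powr (1 - p)) * LpN M p G"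
    using LpN_add_le_convex[OF F G p, of "1 / 2" H] H by simp
  also have "\<dots> \<le> ennreal (2 powr p) * LpN M p F + ennreal (2 powr p) * LpN M p G"
    using half by (intro add_mono mult_right_mono) auto
  finally show ?thesis by (simp add: distrib_left)
qed

text \<open>Jensen's inequality for the probability density K. Integrating the tangent inequality at m against
  K gives \<open>p m\<^sup>p \<le> \<integral> g\<^sup>p K + (p - 1) m\<^sup>p\<close>, where \<open>(p - 1) m\<^sup>p\<close> can be cancelled. The mean of g
  enters only through a finite lower bound m, so it may be infinite.\<close>
lemma jensen_powr:
  assumes g: "g \<in> borel_measurable M" "\<And>z. z \<in> space M \<Longrightarrow> 0 \<le> g z"
    and K: "K \<in> borel_measurable M" "(\<integral>\<^sup>+ z. K z \<partial>M) = 1"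
    and m: "0 \<le> m" "ennreal m \<le> (\<integral>\<^sup>+ z. K z * ennreal (g z) \<partial>M)" and p: "1 \<le> p"
  shows "ennreal (m powr p) \<le> (\<integral>\<^sup>+ z. K z * ennreal (g z powr p) \<partial>M)"
proof (cases "m = 0")
  case True
  then show ?thesis by simp
next
  case False
  then have m0: "m > 0" using m by simp
  note [measurable] = g(1) K(1)
  have "ennreal (p * m powr (p - 1)) * ennreal m
      \<le> ennreal (p * m powr (p - 1)) * (\<integral>\<^sup>+ z. K z * ennreal (g z) \<partial>M)"
    by (intro mult_left_mono m) auto
  also have "\<dots> = (\<integral>\<^sup>+ z. ennreal (p * m powr (p - 1)) * (K z * ennreal (g z)) \<partial>M)"
    by (rule nn_integral_cmult[symmetric]) simp
  also have "\<dots> \<le> (\<integral>\<^sup>+ z. K z * ennreal (g z powr p) + ennreal ((p - 1) * m powr p) * K z \<partial>M)"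
  proof (rule nn_integral_mono)
    fix z assume z: "z \<in> space M"
    have "ennreal (p * m powr (p - 1)) * (K z * ennreal (g z)) = K z * ennreal (p * m powr (p - 1) * g z)"
      using p g(2)[OF z] by (subst ennreal_mult) (auto simp: mult_ac)
    also have "\<dots> \<le> K z * ennreal (g z powr p + (p - 1) * m powr p)"
      using powr_tangent[OF g(2)[OF z] m0 p] by (intro mult_left_mono ennreal_leI) auto
    also have "\<dots> = K z * ennreal (g z powr p) + ennreal ((p - 1) * m powr p) * K z"
      using p by (subst ennreal_plus) (auto simp: distrib_left mult_ac)
    finally show "ennreal (p * m powr (p - 1)) * (K z * ennreal (g z))
        \<le> K z * ennreal (g z powr p) + ennreal ((p - 1) * m powr p) * K z" .
  qed
  also have "\<dots> = (\<integral>\<^sup>+ z. K z * ennreal (g z powr p) \<partial>M) + ennreal ((p - 1) * m powr p)"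
    using K(2) by (subst nn_integral_add) (auto simp: nn_integral_cmult)
  also have "ennreal (p * m powr (p - 1)) * ennreal m = ennreal (m powr p) + ennreal ((p - 1) * m powr p)"
  proof -
    have "m powr (p - 1) * m = m powr p" using m0 by (simp add: powr_mult_base mult.commute)
    then have "p * m powr (p - 1) * m = m powr p + (p - 1) * m powr p"
      by (simp add: algebra_simps)
    then show ?thesis using m0 p by (simp flip: ennreal_mult ennreal_plus)
  qed
  finally show ?thesis by (simp add: ennreal_add_left_cancel_le add.commute)
qed

lemma (in prob_space) nn_integral_norm_le_LpN:
  fixes F :: "'a \<Rightarrow> 'b::real_normed_vector"
  assumes F: "(\<lambda>z. norm (F z)) \<in> borel_measurable M" and p: "1 \<le> p" and m: "0 \<le> m"
    and le: "ennreal m \<le> (\<integral>\<^sup>+ z. ennreal (norm (F z)) \<partial>M)"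
  shows "ennreal (m powr p) \<le> LpN M p F"
  using jensen_powr[OF F _ _ _ m _ p, of "\<lambda>_. 1"] le by (simp add: LpN_def emeasure_space_1)

lemma (in prob_space) nn_integral_norm_finite:
  fixes F :: "'a \<Rightarrow> 'b::real_normed_vector"
  assumes F: "(\<lambda>z. norm (F z)) \<in> borel_measurable M" and p: "1 \<le> p" and fin: "LpN M p F < \<infinity>"
  shows "(\<integral>\<^sup>+ z. ennreal (norm (F z)) \<partial>M) < \<infinity>"
proof -
  note [measurable] = F
  have "(\<integral>\<^sup>+ z. ennreal (norm (F z)) \<partial>M) \<le> (\<integral>\<^sup>+ z. 1 + ennreal (norm (F z) powr p) \<partial>M)"
  proof (rule nn_integral_mono)
    fix z
    have "norm (F z) \<le> 1 + norm (F z) powr p"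
    proof (cases "norm (F z) \<le> 1")
      case False
      then have "norm (F z) powr 1 \<le> norm (F z) powr p" using p by (intro powr_mono) auto
      then show ?thesis by simp
    qed (simp add: add_increasing2)
    then show "ennreal (norm (F z)) \<le> 1 + ennreal (norm (F z) powr p)"
      by (simp flip: ennreal_plus ennreal_1)
  qed
  also have "\<dots> = 1 + LpN M p F"
    by (subst nn_integral_add) (auto simp: LpN_def emeasure_space_1)
  also have "\<dots> < \<infinity>" using fin by simp
  finally show ?thesis .
qed

section \<open>Averages of Dirichlet polynomials over circles\<close>

lemma has_bochner_int_sum:
  assumes "finite I" and "\<And>i. i \<in> I \<Longrightarrow> has_bochner_int M (F i) (x i)"
    and "\<And>J. J \<subseteq> I \<Longrightarrow> (\<lambda>z. \<Sum>i\<in>J. F i z) \<in> borel_measurable M"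
  shows "has_bochner_int M (\<lambda>z. \<Sum>i\<in>I. F i z) (\<Sum>i\<in>I. x i)"
  using assms
proof (induction I rule: finite_induct)
  case empty
  show ?case using has_bochner_int_bounded_linear[OF bounded_linear_zero has_bochner_int_scaleC_const[of M "\<lambda>_. 0"
    "0::complex"]] by simp
next
  case (insert i I)
  have "has_bochner_int M (\<lambda>z. F i z + (\<Sum>i\<in>I. F i z)) (x i + (\<Sum>i\<in>I. x i))"
  proof (rule has_bochner_int_add)
    show "has_bochner_int M (\<lambda>z. \<Sum>i\<in>I. F i z) (\<Sum>i\<in>I. x i)"
      using insert.IH insert.prems by (meson insertI2 subset_insertI2)
    show "(\<lambda>z. F i z + (\<Sum>i\<in>I. F i z)) \<in> borel_measurable M"
      using insert.prems(2)[OF order_refl] insert.hyps by simp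
  qed (use insert.prems(1) in simp)
  then show ?case using insert.hyps by simp
qed

lemma has_bochner_int_sum_scaleC_const:
  fixes c :: "'i \<Rightarrow> 'a::complex_banach"
  assumes "finite I" "\<And>i. i \<in> I \<Longrightarrow> integrable M (\<phi> i)"
  shows "has_bochner_int M (\<lambda>z. \<Sum>i\<in>I. \<phi> i z *\<^sub>C c i) (\<Sum>i\<in>I. (\<integral>z. \<phi> i z \<partial>M) *\<^sub>C c i)"
proof (rule has_bochner_int_sum[OF assms(1)])
  fix J assume "J \<subseteq> I"
  then show "(\<lambda>z. \<Sum>i\<in>J. \<phi> i z *\<^sub>C c i) \<in> borel_measurable M"
    using assms finite_subset[of J I]
    by (intro strongly_measurable_borel[OF strongly_measurable_sum_scaleC]) auto
qed (use assms(2) in \<open>intro has_bochner_int_scaleC_const\<close>)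

text \<open>A nonnegative kernel of mean 1 whose Fourier coefficients at 1 and -1 have modulus 1/2 and vanish
  beyond. Averaging an analytic function against it leaves the first two Taylor terms.\<close>
definition half_kernel :: "complex \<Rightarrow> complex \<Rightarrow> real" where
  "half_kernel \<eta> \<xi> = 1 + Re (\<xi> * cnj \<eta>)"

lemma half_kernel_nonneg: "cmod \<xi> = 1 \<Longrightarrow> cmod \<eta> = 1 \<Longrightarrow> 0 \<le> half_kernel \<eta> \<xi>"
  using abs_Re_le_cmod[of "\<xi> * cnj \<eta>"] by (simp add: half_kernel_def norm_mult)

lemma half_kernel_le: "cmod \<xi> = 1 \<Longrightarrow> cmod \<eta> = 1 \<Longrightarrow> \<bar>half_kernel \<eta> \<xi>\<bar> \<le> 2"
  using abs_Re_le_cmod[of "\<xi> * cnj \<eta>"] by (simp add: half_kernel_def norm_mult)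

lemma half_kernel_complex: "complex_of_real (half_kernel \<eta> \<xi>) = 1 + (\<xi> * cnj \<eta> + cnj \<xi> * \<eta>) / 2"
  by (simp add: half_kernel_def complex_eq_iff)

lemma half_kernel_sym: "half_kernel \<eta> \<xi> = half_kernel \<xi> \<eta>"
  by (simp add: half_kernel_def)

lemma integral_half_kernel_power:
  assumes "cmod \<eta> = 1"
  shows "(\<integral>\<xi>. complex_of_real (half_kernel \<eta> \<xi>) * \<xi> ^ k \<partial>\<S>) =
    (if k = 0 then 1 else if k = 1 then \<eta> / 2 else 0)"
proof -
  have eq: "complex_of_real (half_kernel \<eta> \<xi>) * \<xi> ^ k = \<xi> ^ k + cnj \<eta> / 2 * \<xi> ^ (k + 1) +
     \<eta> / 2 * (if k = 0 then cnj \<xi> else \<xi> ^ (k - 1))" if "\<xi> \<in> space \<S>" for \<xi>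
  proof -
    have 1: "\<xi> * cnj \<xi> = 1" using that complex_norm_square[of \<xi>] by simp
    show ?thesis
    proof (cases k)
      case (Suc m)
      have "\<xi> ^ k * cnj \<xi> = \<xi> ^ m * (\<xi> * cnj \<xi>)" by (simp add: Suc)
      then have "\<xi> ^ k * cnj \<xi> = \<xi> ^ m" by (simp add: 1)
      then show ?thesis by (simp add: half_kernel_complex Suc algebra_simps)
    qed (simp add: half_kernel_complex algebra_simps add_divide_distrib)
  qed
  have int: "integrable \<S> (\<lambda>\<xi>::complex. \<xi> ^ k)" for k
    by (rule integrable_circle_bounded[of _ 1]) (auto simp: norm_power)
  have intc: "integrable \<S> (\<lambda>\<xi>::complex. cnj \<xi>)"
    by (rule integrable_circle_bounded[of _ 1]) (auto intro!: borel_measurable_continuous_onI continuous_intros)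
  have I: "(\<integral>\<xi>. \<xi> ^ k \<partial>\<S>) = (if k = 0 then 1 else 0)" for k :: nat
    using integral_circle_power[of k] circle.prob_space by (cases "k = 0") (auto simp del: space_circle)
  have Ic: "(\<integral>\<xi>. cnj \<xi> \<partial>\<S>) = 0"
    using I[of 1] by (simp add: integral_cnj)
  have int2: "integrable \<S> (\<lambda>\<xi>::complex. if k = 0 then cnj \<xi> else \<xi> ^ (k - 1))"
    using int intc by (cases "k = 0") auto
  have "(\<integral>\<xi>. complex_of_real (half_kernel \<eta> \<xi>) * \<xi> ^ k \<partial>\<S>) =
     (\<integral>\<xi>. \<xi> ^ k + cnj \<eta> / 2 * \<xi> ^ (k + 1) + \<eta> / 2 * (if k = 0 then cnj \<xi> else \<xi> ^ (k - 1)) \<partial>\<S>)"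
    by (rule Bochner_Integration.integral_cong[OF refl eq])
  also have "\<dots> = (\<integral>\<xi>. \<xi> ^ k \<partial>\<S>) + cnj \<eta> / 2 * (\<integral>\<xi>. \<xi> ^ (k + 1) \<partial>\<S>) +
     \<eta> / 2 * (\<integral>\<xi>. (if k = 0 then cnj \<xi> else \<xi> ^ (k - 1)) \<partial>\<S>)"
    using int[of k] integrable_mult_right[OF int[of "k
        + 1"], of "cnj \<eta> / 2"] integrable_mult_right[OF int2, of "\<eta> / 2"]
    by (simp only: Bochner_Integration.integral_add Bochner_Integration.integrable_add integral_mult_right_zero)
  also have "(\<integral>\<xi>. (if k = 0 then cnj \<xi> else \<xi> ^ (k - 1)) \<partial>\<S>) = (if k = 1 then 1 else 0)"
    using I[of "k - 1"] Ic by (cases "k = 0") auto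
  finally show ?thesis using I[of k] I[of "k + 1"] by auto
qed

text \<open>The exponential series is integrated termwise, and only the terms 0 and 1 survive.\<close>
lemma integral_half_kernel_exp:
  assumes \<eta>: "cmod \<eta> = 1"
  shows "(\<integral>\<xi>. complex_of_real (half_kernel \<eta> \<xi>) * exp (b * \<xi>) \<partial>\<S>) = 1 + b * \<eta> / 2"
proof -
  let ?f = "\<lambda>k \<xi>. complex_of_real (half_kernel \<eta> \<xi>) * ((b * \<xi>) ^ k /\<^sub>R fact k)"
  have meas: "(\<lambda>\<xi>. ?f k \<xi>) \<in> borel_measurable borel" for k
    unfolding half_kernel_def by (intro borel_measurable_continuous_onI continuous_intros)
  have bd: "cmod (?f k \<xi>) \<le> 2 * (cmod b ^ k /\<^sub>R fact k)" if "cmod \<xi> = 1" for k \<xi>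
    using half_kernel_le[OF that \<eta>] that
    by (simp add: norm_mult norm_power power_mult_distrib norm_divide) (intro mult_right_mono divide_right_mono, auto)
  have int: "integrable \<S> (?f k)" for k
    by (rule integrable_circle_bounded[OF meas bd])
  have norm_int: "(\<integral>\<xi>. cmod (?f k \<xi>) \<partial>\<S>) \<le> 2 * (cmod b ^ k /\<^sub>R fact k)" for k
    by (rule circle.integral_le_const[OF integrable_norm[OF int]]) (rule AE_I2, rule bd, simp)
  have expsum: "summable (\<lambda>k. 2 * (cmod b ^ k /\<^sub>R fact k))"
    using summable_exp_generic[of "cmod b"] by (intro summable_mult) simp
  have S: "(\<lambda>k. \<integral>\<xi>. ?f k \<xi> \<partial>\<S>) sums (\<integral>\<xi>. (\<Sum>k. ?f k \<xi>) \<partial>\<S>)"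
  proof (rule sums_integral[OF int])
    show "AE \<xi> in \<S>. summable (\<lambda>k. norm (?f k \<xi>))"
      by (rule AE_I2) (rule summable_comparison_test'[OF expsum, of 0], use bd in auto)
    show "summable (\<lambda>k. \<integral>\<xi>. cmod (?f k \<xi>) \<partial>\<S>)"
      by (rule summable_comparison_test'[OF expsum, of 0]) (use norm_int in auto)
  qed
  have "(\<Sum>k. ?f k \<xi>) = complex_of_real (half_kernel \<eta> \<xi>) * exp (b * \<xi>)" for \<xi>
    using sums_mult[OF exp_converges[of "b * \<xi>"], of "complex_of_real (half_kernel \<eta> \<xi>)"]
      by (simp add: sums_iff)
  moreover have "(\<integral>\<xi>. ?f k \<xi> \<partial>\<S>) = (b ^ k /\<^sub>R fact k) * (if k = 0 then 1 else if k = 1 then \<eta> / 2 else 0)" for k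
  proof -
    have "(\<integral>\<xi>. ?f k \<xi> \<partial>\<S>) = (\<integral>\<xi>. (b ^ k /\<^sub>R fact k) * (complex_of_real (half_kernel \<eta> \<xi>) * \<xi> ^ k) \<partial>\<S>)"
      by (rule Bochner_Integration.integral_cong) (auto simp: power_mult_distrib scaleR_conv_of_real)
    also have "\<dots> = (b ^ k /\<^sub>R fact k) * (\<integral>\<xi>. complex_of_real (half_kernel \<eta> \<xi>) * \<xi> ^ k \<partial>\<S>)"
      by (rule integral_mult_right_zero)
    finally show ?thesis by (simp only: integral_half_kernel_power[OF \<eta>])
  qed
  ultimately have "(\<lambda>k. (b ^ k /\<^sub>R fact k) * (if k = 0 then 1 else if k = 1 then \<eta> / 2 else 0))
     sums (\<integral>\<xi>. complex_of_real (half_kernel \<eta> \<xi>) * exp (b * \<xi>) \<partial>\<S>)"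
    using S by simp
  moreover have "(\<lambda>k. (b ^ k /\<^sub>R fact k) * (if k = 0 then 1 else if k = 1 then \<eta> / 2 else 0)) sums
     (\<Sum>k\<in>{0, 1}. (b ^ k /\<^sub>R fact k) * (if k = 0 then 1 else if k = 1 then \<eta> / 2 else 0))"
    by (rule sums_finite) auto
  ultimately show ?thesis using sums_unique2 by force
qed

text \<open>The function on the torus whose Bohr transform is the Dirichlet polynomial with the coefficients c
  on A.\<close>
definition dpoly :: "nat set \<Rightarrow> (nat \<Rightarrow> 'a::complex_banach) \<Rightarrow> (nat \<Rightarrow> complex) \<Rightarrow> 'a" where
  "dpoly A c z = (\<Sum>n\<in>A. monomial (prime_index n) z *\<^sub>C c n)"

lemma borel_measurable_of_nat_powr:
  assumes [measurable]: "s \<in> borel_measurable M"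
  shows "(\<lambda>x. (of_nat n :: complex) powr (- s x)) \<in> borel_measurable M"
proof (cases "n = 0")
  case False
  then have "(\<lambda>x. (of_nat n :: complex) powr (- s x)) = (\<lambda>x. exp (- s x * ln (of_nat n)))"
    by (simp add: powr_def)
  then show ?thesis by simp
qed simp

lemma strongly_measurable_dpoly_translate:
  assumes "finite A" and s: "s \<in> borel_measurable M" and \<zeta>: "\<zeta> \<in> M \<rightarrow>\<^sub>M \<T>"
  shows "strongly_measurable M (\<lambda>x. dpoly A (ds_translate (s x) c) (\<zeta> x))"
proof -
  have "strongly_measurable M (\<lambda>x. \<Sum>n\<in>A. (monomial (prime_index n) (\<zeta> x) * of_nat n powr (- s x)) *\<^sub>C c n)"
    using borel_measurable_of_nat_powr[OF s] measurable_compose[OF \<zeta> monomial_measurable]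
    by (intro strongly_measurable_sum_scaleC assms(1) borel_measurable_times) auto
  then show ?thesis by (simp add: dpoly_def ds_translate_def scaleC_scaleC)
qed

lemma strongly_measurable_dpoly:
  "finite A \<Longrightarrow> strongly_measurable \<T> (dpoly A c)"
  unfolding dpoly_def by (rule strongly_measurable_sum_scaleC) auto

lemma norm_dpoly_translate_measurable:
  assumes "finite A" "s \<in> borel_measurable M" "\<zeta> \<in> M \<rightarrow>\<^sub>M \<T>"
  shows "(\<lambda>x. norm (dpoly A (ds_translate (s x) c) (\<zeta> x))) \<in> borel_measurable M"
  by (rule strongly_measurable_norm[OF strongly_measurable_dpoly_translate[OF assms]])

lemma of_nat_powr_shift:
  assumes "n > 0"
  shows "(of_nat n :: complex) powr (- (\<sigma> + r * \<xi>))
      = of_nat n powr (- \<sigma>) * exp (- r * of_real (ln (real n)) * \<xi>)"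
  using assms by (simp add: powr_def Ln_of_nat exp_add[symmetric] algebra_simps)

lemma ds_deriv_eq: "n > 0 \<Longrightarrow> ds_deriv c n = - of_real (ln (real n)) *\<^sub>C c n"
  by (auto simp: ds_deriv_def scaleC.minus_left scaleC_of_real scaleC.zero_left not_le less_Suc_eq numeral_2_eq_2)

text \<open>As \<open>n powr - (\<sigma> + r \<xi>)\<close> is \<open>n powr - \<sigma>\<close> times an exponential in \<open>\<xi>\<close>, the average over the circle
  of radius r about \<open>\<sigma>\<close> is the linear function \<open>x + \<eta> y\<close> of \<open>\<eta>\<close> to which PL-convexity applies, with
  y a multiple of the derivative at \<open>\<sigma>\<close>.\<close>
lemma dpoly_average:
  fixes c :: "nat \<Rightarrow> 'a::complex_banach"
  assumes A: "finite A" "0 \<notin> A" and \<eta>: "cmod \<eta> = 1"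
  shows "has_bochner_int \<S>
    (\<lambda>\<xi>. complex_of_real (half_kernel \<eta> \<xi>) *\<^sub>C dpoly A (ds_translate (\<sigma> + r * \<xi>) c) z)
    (dpoly A (ds_translate \<sigma> c) z + \<eta> *\<^sub>C ((r / 2) *\<^sub>C dpoly A (ds_translate \<sigma> (ds_deriv c)) z))"
proof -
  define c' where "c' n = (monomial (prime_index n) z * of_nat n powr (- \<sigma>)) *\<^sub>C c n" for n
  define b where "b n = - r * of_real (ln (real n))" for n
  have meas: "(\<lambda>\<xi>. complex_of_real (half_kernel \<eta> \<xi>) * exp (b n * \<xi>)) \<in> borel_measurable borel" for n
    unfolding half_kernel_def by (intro borel_measurable_continuous_onI continuous_intros)
  have int: "integrable \<S> (\<lambda>\<xi>. complex_of_real (half_kernel \<eta> \<xi>) * exp (b n * \<xi>))" for n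
  proof (rule integrable_circle_bounded[OF meas])
    fix \<xi> assume \<xi>: "cmod \<xi> = 1"
    have "cmod (exp (b n * \<xi>)) \<le> exp (cmod (b n))"
      using norm_exp[of "b n * \<xi>"] \<xi> by (simp add: norm_mult)
    then show "cmod (complex_of_real (half_kernel \<eta> \<xi>) * exp (b n * \<xi>)) \<le> 2 * exp (cmod (b n))"
      using half_kernel_le[OF \<xi> \<eta>] by (auto simp: norm_mult intro!: mult_mono)
  qed
  have "has_bochner_int \<S>
     (\<lambda>\<xi>. \<Sum>n\<in>A. (complex_of_real (half_kernel \<eta> \<xi>) * exp (b n * \<xi>)) *\<^sub>C c' n)
     (\<Sum>n\<in>A. (\<integral>\<xi>. complex_of_real (half_kernel \<eta> \<xi>) * exp (b n * \<xi>) \<partial>\<S>) *\<^sub>C c' n)"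
    by (rule has_bochner_int_sum_scaleC_const[OF A(1) int])
  moreover have "(\<Sum>n\<in>A. (complex_of_real (half_kernel \<eta> \<xi>) * exp (b n * \<xi>)) *\<^sub>C c' n)
     = complex_of_real (half_kernel \<eta> \<xi>) *\<^sub>C dpoly A (ds_translate (\<sigma> + r * \<xi>) c) z" for \<xi>
    unfolding dpoly_def scaleC.sum_right
  proof (rule sum.cong[OF refl])
    fix n assume "n \<in> A"
    then have "n > 0" using A(2) by (cases n) auto
    then show "(complex_of_real (half_kernel \<eta> \<xi>) * exp (b n * \<xi>)) *\<^sub>C c' n =
       complex_of_real (half_kernel \<eta> \<xi>) *\<^sub>C monomial (prime_index n) z *\<^sub>C ds_translate (\<sigma> + r * \<xi>) c n"
      by (simp add: ds_translate_def c'_def b_def of_nat_powr_shift scaleC_scaleC mult_ac del: minus_add_distrib)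
  qed
  moreover have "(\<Sum>n\<in>A. (\<integral>\<xi>. complex_of_real (half_kernel \<eta> \<xi>) * exp (b n * \<xi>) \<partial>\<S>) *\<^sub>C c' n)
    = dpoly A (ds_translate \<sigma> c) z + \<eta> *\<^sub>C ((r / 2) *\<^sub>C dpoly A (ds_translate \<sigma> (ds_deriv c)) z)"
    unfolding dpoly_def scaleC.sum_right sum.distrib[symmetric]
  proof (rule sum.cong[OF refl])
    fix n assume "n \<in> A"
    then have "n > 0" using A(2) by (cases n) auto
    then show "(\<integral>\<xi>. complex_of_real (half_kernel \<eta> \<xi>) * exp (b n * \<xi>) \<partial>\<S>) *\<^sub>C c' n =
      monomial (prime_index n) z *\<^sub>C ds_translate \<sigma> c n + \<eta> *\<^sub>C (r / 2) *\<^sub>C monomial (prime_index n) z *\<^sub>C ds_translate \<sigma> (ds_deriv c) n"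
      unfolding integral_half_kernel_exp[OF \<eta>] scaleC_add_left
      by (simp add: ds_translate_def c'_def b_def ds_deriv_eq scaleC_scaleC mult_ac)
  qed
  ultimately show ?thesis by simp
qed

lemma nn_integral_half_kernel:
  assumes "cmod \<xi> = 1"
  shows "(\<integral>\<^sup>+ \<eta>. ennreal (half_kernel \<eta> \<xi>) \<partial>\<S>) = 1"
    "(\<integral>\<^sup>+ \<eta>. ennreal (half_kernel \<xi> \<eta>) \<partial>\<S>) = 1"
proof -
  have "integrable \<S> (\<lambda>\<eta>. complex_of_real (half_kernel \<xi> \<eta>))"
  proof (rule integrable_circle_bounded[of _ 2])
    show "(\<lambda>\<eta>. complex_of_real (half_kernel \<xi> \<eta>)) \<in> borel_measurable borel"
      unfolding half_kernel_def by (intro borel_measurable_continuous_onI continuous_intros)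
    show "cmod (complex_of_real (half_kernel \<xi> \<eta>)) \<le> 2" if "cmod \<eta> = 1" for \<eta>
      using half_kernel_le[OF that assms] by (simp only: norm_of_real)
  qed
  then have int: "integrable \<S> (\<lambda>\<eta>. half_kernel \<xi> \<eta>)"
    by (simp only: complex_of_real_integrable_eq)
  have "(\<integral>\<eta>. complex_of_real (half_kernel \<xi> \<eta>) \<partial>\<S>) = 1"
    using integral_half_kernel_power[OF assms, of 0] by simp
  then have "(\<integral>\<eta>. half_kernel \<xi> \<eta> \<partial>\<S>) = 1"
    by (metis integral_complex_of_real of_real_eq_1_iff)
  then show "(\<integral>\<^sup>+ \<eta>. ennreal (half_kernel \<xi> \<eta>) \<partial>\<S>) = 1"
    using half_kernel_nonneg[OF _ assms] by (subst nn_integral_eq_integral[OF int]) (auto intro!: AE_I2)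
  then show "(\<integral>\<^sup>+ \<eta>. ennreal (half_kernel \<eta> \<xi>) \<partial>\<S>) = 1"
    by (simp add: half_kernel_sym[of _ \<xi>])
qed

lemma uniformly_PL_convex_nn_integral:
  assumes "uniformly_PL_convex p TYPE('a::complex_banach)" "0 \<le> p"
  obtains C where "C > 0" "\<And>x y :: 'a. ennreal (norm x powr p) + ennreal C * ennreal (norm y powr p)
      \<le> (\<integral>\<^sup>+ \<xi>. ennreal (norm (x + \<xi> *\<^sub>C y) powr p) \<partial>\<S>)"
proof -
  obtain C where C: "C > 0" "\<And>x y :: 'a. (\<integral>\<xi>. norm (x + \<xi> *\<^sub>C y) powr p \<partial>\<S>) \<ge> norm x powr p + C * norm y powr p"
    using assms unfolding uniformly_PL_convex_def by blast
  show ?thesis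
  proof (rule that[OF C(1)])
    fix x y :: 'a
    have [measurable]: "(\<lambda>\<xi>. norm (x + \<xi> *\<^sub>C y)) \<in> borel_measurable \<S>"
      by (intro borel_measurable_circle borel_measurable_continuous_onI continuous_intros scaleC.continuous_on)
    have meas: "(\<lambda>\<xi>. norm (x + \<xi> *\<^sub>C y) powr p) \<in> borel_measurable \<S>"
      by measurable
    have bd: "norm (norm (x + \<xi> *\<^sub>C y) powr p) \<le> (norm x + norm y) powr p" if "\<xi> \<in> space \<S>" for \<xi>
      using that assms(2) norm_triangle_ineq[of x "\<xi> *\<^sub>C y"] by (auto simp: norm_scaleC intro!: powr_mono2)
    have "integrable \<S> (\<lambda>\<xi>. norm (x + \<xi> *\<^sub>C y) powr p)"
      by (rule circle.integrable_const_bound[OF AE_I2[OF bd] meas])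
    then have "(\<integral>\<^sup>+ \<xi>. ennreal (norm (x + \<xi> *\<^sub>C y) powr p) \<partial>\<S>) = ennreal (\<integral>\<xi>. norm (x + \<xi> *\<^sub>C y) powr p \<partial>\<S>)"
      by (intro nn_integral_eq_integral) auto
    moreover have "ennreal (norm x powr p) + ennreal C * ennreal (norm y powr p)
        = ennreal (norm x powr p + C * norm y powr p)"
      using C(1) by (simp add: ennreal_mult)
    ultimately show "ennreal (norm x powr p) + ennreal C * ennreal (norm y powr p)
      \<le> (\<integral>\<^sup>+ \<xi>. ennreal (norm (x + \<xi> *\<^sub>C y) powr p) \<partial>\<S>)"
      using C(2)[of x y] by (simp add: ennreal_leI)
  qed
qed

section \<open>The PL-inequality for Dirichlet polynomials\<close>

text \<open>The map n to \<open>n powr - \<i> t\<close> is completely multiplicative, hence a vertical translation of a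
  Dirichlet series is a rotation of the torus.\<close>
lemma monomial_prime_index_rotation:
  assumes n: "n > 0"
  shows "monomial (prime_index n) (\<lambda>j. cis (- t * ln (real (nth_prime j)))) = of_nat n powr (- (\<i> * of_real t))"
proof -
  let ?P = "{j. prime_index n j \<noteq> 0}"
  have fin: "finite ?P" using prime_index_correct(1)[OF n] by (simp add: eventually_null_def)
  have pos: "nth_prime j > 0" for j
  proof -
    have "nth_prime j \<in> {p. prime p}"
      unfolding nth_prime_def using primes_infinite by (rule enumerate_in_set)
    then show ?thesis by (simp add: prime_gt_0_nat)
  qed
  have "real n = (\<Prod>j\<in>?P. real (nth_prime j) ^ nat (prime_index n j))"
    using arg_cong[OF prime_index_correct(3)[OF n], of real] by simp
  then have "ln (real n) = (\<Sum>j\<in>?P. ln (real (nth_prime j) ^ nat (prime_index n j)))"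
    using fin pos by (simp add: ln_prod)
  also have "\<dots> = (\<Sum>j\<in>?P. of_int (prime_index n j) * ln (real (nth_prime j)))"
    using prime_index_correct(2)[OF n] pos by (intro sum.cong) (auto simp: ln_realpow)
  finally have ln: "ln (real n) = (\<Sum>j\<in>?P. of_int (prime_index n j) * ln (real (nth_prime j)))" .
  have "monomial (prime_index n) (\<lambda>j. cis (- t * ln (real (nth_prime j))))
      = (\<Prod>j\<in>?P. cis (of_int (prime_index n j) * (- t * ln (real (nth_prime j)))))"
    by (simp add: monomial_def cis_power_int)
  also have "\<dots> = cis (\<Sum>j\<in>?P. of_int (prime_index n j) * (- t * ln (real (nth_prime j))))"
    using fin by (induction rule: finite_induct) (auto simp: cis_mult)
  also have "(\<Sum>j\<in>?P. of_int (prime_index n j) * (- t * ln (real (nth_prime j)))) = - t * ln (real n)"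
    unfolding ln sum_distrib_left by (intro sum.cong) auto
  finally show ?thesis using n by (simp add: powr_def Ln_of_nat cis_conv_exp mult_ac)
qed

lemma LpN_dpoly_translate_vertical:
  assumes A: "finite A" "0 \<notin> A"
  shows "LpN \<T> p (dpoly A (ds_translate (of_real \<sigma> + \<i> * of_real t) c)) =
    LpN \<T> p (dpoly A (ds_translate (of_real \<sigma>) c))"
proof -
  define w where "w j = cis (- t * ln (real (nth_prime j)))" for j
  have w: "cmod (w j) = 1" for j by (simp add: w_def)
  have eq: "dpoly A (ds_translate (of_real \<sigma> + \<i> * of_real t) c) z
      = dpoly A (ds_translate (of_real \<sigma>) c) (torus_rotate w z)" for z
    unfolding dpoly_def
  proof (rule sum.cong[OF refl])
    fix n assume "n \<in> A"
    then have n: "n > 0" using A(2) by (cases n) auto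
    have "(of_nat n :: complex) powr (- (of_real \<sigma> + \<i> * of_real t))
        = of_nat n powr (- of_real \<sigma>) * of_nat n powr (- (\<i> * of_real t))"
      using n by (simp add: powr_def exp_add[symmetric] algebra_simps)
    then show "monomial (prime_index n) z *\<^sub>C ds_translate (of_real \<sigma> + \<i> * of_real t) c n =
         monomial (prime_index n) (torus_rotate w z) *\<^sub>C ds_translate (of_real \<sigma>) c n"
      using monomial_prime_index_rotation[OF n, of t]
      by (simp add: ds_translate_def scaleC_scaleC monomial_rotate w_def[abs_def] mult_ac)
  qed
  have [measurable]: "(\<lambda>z. norm (dpoly A (ds_translate (of_real \<sigma>) c) z)) \<in> borel_measurable \<T>"
    by (rule strongly_measurable_norm[OF strongly_measurable_dpoly[OF A(1)]])
  have "LpN \<T> p (dpoly A (ds_translate (of_real \<sigma>) c)) =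
     (\<integral>\<^sup>+ z. ennreal (norm (dpoly A (ds_translate (of_real \<sigma>) c) z) powr p) \<partial>distr \<T> \<T> (torus_rotate w))"
    by (simp add: LpN_def distr_torus_rotate[OF w])
  also have "\<dots> = (\<integral>\<^sup>+ z. ennreal (norm (dpoly A (ds_translate (of_real \<sigma>) c) (torus_rotate w z)) powr p) \<partial>\<T>)"
    by (rule nn_integral_distr[OF torus_rotate_measurable[OF w]]) measurable
  finally show ?thesis by (simp add: LpN_def eq)
qed

interpretation ct: pair_sigma_finite \<S> \<T>
  by unfold_locales

interpretation cc: pair_sigma_finite \<S> \<S>
  by unfold_locales

lemma borel_measurable_LpN_dpoly_translate:
  assumes A: "finite A" and s: "s \<in> borel_measurable M"
  shows "(\<lambda>x. LpN \<T> p (dpoly A (ds_translate (s x) c))) \<in> borel_measurable M"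
proof -
  have [measurable]: "(\<lambda>x. norm (dpoly A (ds_translate (s (fst x)) c) (snd x))) \<in> borel_measurable (M \<Otimes>\<^sub>M \<T>)"
    by (rule norm_dpoly_translate_measurable[OF A measurable_compose[OF measurable_fst s] measurable_snd])
  show ?thesis
    unfolding LpN_def
    by (rule torus.borel_measurable_nn_integral[of "\<lambda>x z. ennreal (norm (dpoly A (ds_translate (s x) c) z) powr p)"])
      (simp add: case_prod_unfold)
qed

text \<open>PL-convexity compares \<open>\<parallel>x\<parallel>\<^sup>p + C \<parallel>y\<parallel>\<^sup>p\<close> with the mean of \<open>\<parallel>x + \<eta> y\<parallel>\<^sup>p\<close>. Here \<open>x + \<eta> y\<close> is an
  average of translates against the half kernel, so by Jensen's inequality its p-th power is at most
  the average of the p-th powers. The mean over \<open>\<eta>\<close> removes the kernel, which is symmetric.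
  Integrating over the torus, rotation invariance leaves only the real part of the translation.\<close>
theorem dpoly_PL_inequality:
  fixes c :: "nat \<Rightarrow> 'a::complex_banach"
  assumes A: "finite A" "0 \<notin> A" and p: "1 \<le> p" and r: "0 \<le> r"
    and PL: "\<And>x y :: 'a. ennreal (norm x powr p) + ennreal C * ennreal (norm y powr p)
      \<le> (\<integral>\<^sup>+ \<xi>. ennreal (norm (x + \<xi> *\<^sub>C y) powr p) \<partial>\<S>)"
  shows "LpN \<T> p (dpoly A (ds_translate (of_real \<sigma>) c)) +
      ennreal C * ennreal ((r / 2) powr p) * LpN \<T> p (dpoly A (ds_translate (of_real \<sigma>) (ds_deriv c)))
    \<le> (\<integral>\<^sup>+ \<xi>. LpN \<T> p (dpoly A (ds_translate (of_real (\<sigma> + r * Re \<xi>)) c)) \<partial>\<S>)"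
proof -
  let ?P = "dpoly A (ds_translate (of_real \<sigma>) c)" and ?P' = "dpoly A (ds_translate (of_real \<sigma>) (ds_deriv c))"
  define G where "G \<xi> z = norm (dpoly A (ds_translate (of_real \<sigma> + of_real r * \<xi>) c) z)" for \<xi> z
  have id_circle: "(\<lambda>\<xi>. \<xi>) \<in> borel_measurable \<S>" by (rule borel_measurable_circle) simp
  have sm: "(\<lambda>\<xi>. of_real \<sigma> + of_real r * \<xi>) \<in> borel_measurable \<S>"
    using id_circle by measurable
  have Gpair [measurable]: "(\<lambda>x. G (fst x) (snd x)) \<in> borel_measurable (\<S> \<Otimes>\<^sub>M \<T>)"
    unfolding G_def by (rule norm_dpoly_translate_measurable[OF A(1) measurable_compose[OF measurable_fst sm] measurable_snd])
  have G\<xi> [measurable]: "(\<lambda>\<xi>. G \<xi> z) \<in> borel_measurable \<S>" if "z \<in> space \<T>" for z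
    unfolding G_def by (rule norm_dpoly_translate_measurable[OF A(1) sm]) (use that in simp)
  have [measurable]: "(\<lambda>z. norm (?P z)) \<in> borel_measurable \<T>" "(\<lambda>z. norm (?P' z)) \<in> borel_measurable \<T>"
    by (rule strongly_measurable_norm[OF strongly_measurable_dpoly[OF A(1)]])+
  have hk: "(\<lambda>\<xi>. half_kernel \<eta> \<xi>) \<in> borel_measurable \<S>" for \<eta>
    unfolding half_kernel_def by (intro borel_measurable_circle borel_measurable_continuous_onI continuous_intros)
  have hkpair [measurable]: "(\<lambda>x. half_kernel (fst x) (snd x)) \<in> borel_measurable (\<S> \<Otimes>\<^sub>M \<S>)"
  proof -
    have [measurable]: "Re \<in> borel_measurable \<S>" "Im \<in> borel_measurable \<S>"
      by (auto intro!: borel_measurable_circle borel_measurable_continuous_onI continuous_intros)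
    have "(\<lambda>x. half_kernel (fst x) (snd x)) = (\<lambda>x. 1 + (Re (snd x) * Re (fst x) + Im (snd x) * Im (fst x)))"
      by (simp add: half_kernel_def)
    then show ?thesis by simp
  qed
  have pointwise: "ennreal (norm (?P z) powr p)
      + ennreal C * ennreal ((r / 2) powr p) * ennreal (norm (?P' z) powr p)
     \<le> (\<integral>\<^sup>+ \<xi>. ennreal (G \<xi> z powr p) \<partial>\<S>)" if z: "z \<in> space \<T>" for z
  proof -
    note [measurable] = G\<xi>[OF z]
    let ?y = "complex_of_real (r / 2) *\<^sub>C ?P' z"
    have "norm ?y = (r / 2) * norm (?P' z)"
      using r by (simp add: norm_scaleC)
    then have "norm ?y powr p = ((r / 2) * norm (?P' z)) powr p" by (simp only:)
    also have "\<dots> = (r / 2) powr p * norm (?P' z) powr p"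
      by (rule powr_mult)
    finally have "norm ?y powr p = (r / 2) powr p * norm (?P' z) powr p" .
    then have "ennreal (norm (?P z) powr p)
        + ennreal C * ennreal ((r / 2) powr p) * ennreal (norm (?P' z) powr p)
      = ennreal (norm (?P z) powr p) + ennreal C * ennreal (norm ?y powr p)"
      by (simp add: ennreal_mult mult.assoc)
    also have "\<dots> \<le> (\<integral>\<^sup>+ \<eta>. ennreal (norm (?P z + \<eta> *\<^sub>C ?y) powr p) \<partial>\<S>)" by (rule PL)
    also have "\<dots> \<le> (\<integral>\<^sup>+ \<eta>. (\<integral>\<^sup>+ \<xi>. ennreal (half_kernel \<eta> \<xi>) * ennreal (G \<xi> z powr p) \<partial>\<S>) \<partial>\<S>)"
    proof (rule nn_integral_mono)
      fix \<eta> assume "\<eta> \<in> space \<S>"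
      then have \<eta>: "cmod \<eta> = 1" by simp
      show "ennreal (norm (?P z + \<eta> *\<^sub>C ?y) powr p)
          \<le> (\<integral>\<^sup>+ \<xi>. ennreal (half_kernel \<eta> \<xi>) * ennreal (G \<xi> z powr p) \<partial>\<S>)"
      proof (rule jensen_powr)
        show "(\<integral>\<^sup>+ \<xi>. ennreal (half_kernel \<eta> \<xi>) \<partial>\<S>) = 1" by (rule nn_integral_half_kernel(2)[OF \<eta>])
        have "ennreal (norm (?P z + \<eta> *\<^sub>C ?y))
            \<le> (\<integral>\<^sup>+ \<xi>. ennreal (norm (complex_of_real (half_kernel \<eta> \<xi>) *\<^sub>C dpoly A (ds_translate (of_real \<sigma> + of_real r * \<xi>) c) z)) \<partial>\<S>)"
          using has_bochner_int_norm_bound[OF dpoly_average[OF A \<eta>, of "of_real \<sigma>" "of_real r" c z]] by simp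
        also have "\<dots> = (\<integral>\<^sup>+ \<xi>. ennreal (half_kernel \<eta> \<xi>) * ennreal (G \<xi> z) \<partial>\<S>)"
          using half_kernel_nonneg[OF _ \<eta>]
          by (intro nn_integral_cong) (auto simp: norm_scaleC G_def ennreal_mult[symmetric])
        finally show "ennreal (norm (?P z + \<eta> *\<^sub>C ?y))
            \<le> (\<integral>\<^sup>+ \<xi>. ennreal (half_kernel \<eta> \<xi>) * ennreal (G \<xi> z) \<partial>\<S>)" .
      qed (use hk G\<xi>[OF z] p in \<open>auto simp: G_def\<close>)
    qed
    also have "\<dots> = (\<integral>\<^sup>+ \<xi>. (\<integral>\<^sup>+ \<eta>. ennreal (half_kernel \<eta> \<xi>) * ennreal (G \<xi> z powr p) \<partial>\<S>) \<partial>\<S>)"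
      by (rule cc.Fubini'[symmetric]) (simp add: case_prod_unfold)
    also have "\<dots> = (\<integral>\<^sup>+ \<xi>. ennreal (G \<xi> z powr p) \<partial>\<S>)"
    proof (rule nn_integral_cong)
      fix \<xi> assume "\<xi> \<in> space \<S>"
      then have \<xi>: "cmod \<xi> = 1" by simp
      have m: "(\<lambda>\<eta>. ennreal (half_kernel \<eta> \<xi>)) \<in> borel_measurable \<S>"
        using hk[of \<xi>] by (simp add: half_kernel_sym[of _ \<xi>])
      show "(\<integral>\<^sup>+ \<eta>. ennreal (half_kernel \<eta> \<xi>) * ennreal (G \<xi> z powr p) \<partial>\<S>) = ennreal (G \<xi> z powr p)"
        by (subst nn_integral_multc[OF m]) (simp add: nn_integral_half_kernel(1)[OF \<xi>])
    qed
    finally show ?thesis .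
  qed
  have "LpN \<T> p ?P + ennreal C * ennreal ((r / 2) powr p) * LpN \<T> p ?P' =
     (\<integral>\<^sup>+ z. ennreal (norm (?P z) powr p) + ennreal C * ennreal ((r / 2) powr p) * ennreal (norm (?P' z) powr p) \<partial>\<T>)"
    unfolding LpN_def by (subst nn_integral_add) (auto simp: nn_integral_cmult)
  also have "\<dots> \<le> (\<integral>\<^sup>+ z. (\<integral>\<^sup>+ \<xi>. ennreal (G \<xi> z powr p) \<partial>\<S>) \<partial>\<T>)"
    by (rule nn_integral_mono) (rule pointwise)
  also have "\<dots> = (\<integral>\<^sup>+ \<xi>. (\<integral>\<^sup>+ z. ennreal (G \<xi> z powr p) \<partial>\<T>) \<partial>\<S>)"
    by (rule ct.Fubini') (simp add: case_prod_unfold)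
  also have "\<dots> = (\<integral>\<^sup>+ \<xi>. LpN \<T> p (dpoly A (ds_translate (of_real (\<sigma> + r * Re \<xi>)) c)) \<partial>\<S>)"
  proof (rule nn_integral_cong)
    fix \<xi>
    have eq: "of_real \<sigma> + of_real r * \<xi> = of_real (\<sigma> + r * Re \<xi>) + \<i> * of_real (r * Im \<xi>)"
      by (simp add: complex_eq_iff)
    have "(\<integral>\<^sup>+ z. ennreal (G \<xi> z powr p) \<partial>\<T>) = LpN \<T> p (dpoly A (ds_translate (of_real \<sigma> + of_real r * \<xi>) c))"
      by (simp only: G_def LpN_def)
    also have "\<dots> = LpN \<T> p (dpoly A (ds_translate (of_real (\<sigma> + r * Re \<xi>)) c))"
      by (simp only: eq LpN_dpoly_translate_vertical[OF A])
    finally show "(\<integral>\<^sup>+ z. ennreal (G \<xi> z powr p) \<partial>\<T>)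
        = LpN \<T> p (dpoly A (ds_translate (of_real (\<sigma> + r * Re \<xi>)) c))" .
  qed
  finally show ?thesis .
qed

section \<open>Averages over dilations of the half-line\<close>

text \<open>The measure \<open>ds / s\<close> is invariant under dilations.\<close>
lemma nn_integral_scale:
  fixes f :: "real \<Rightarrow> ennreal"
  assumes f [measurable]: "f \<in> borel_measurable borel" and a: "a > 0"
  shows "(\<integral>\<^sup>+ s. f s * ennreal (inverse s) * indicator {a * \<epsilon>..a * R} s \<partial>lborel) =
    (\<integral>\<^sup>+ s. f (a * s) * ennreal (inverse s) * indicator {\<epsilon>..R} s \<partial>lborel)"
proof -
  have "(\<integral>\<^sup>+ s. f s * ennreal (inverse s) * indicator {a * \<epsilon>..a * R} s \<partial>lborel) =
    ennreal a * (\<integral>\<^sup>+ s. f (0 + a * s) * ennreal (inverse (0 + a * s)) * indicator {a * \<epsilon>..a * R} (0 + a * s) \<partial>lborel)"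
    using nn_integral_real_affine[of "\<lambda>s. f s * ennreal (inverse s) * indicator {a * \<epsilon>..a * R} s" a 0] a by simp
  also have "\<dots> = (\<integral>\<^sup>+ s. ennreal a * (f (a * s) * ennreal (inverse (a * s)) * indicator {a * \<epsilon>..a * R} (a * s)) \<partial>lborel)"
    by (subst nn_integral_cmult) auto
  also have "\<dots> = (\<integral>\<^sup>+ s. f (a * s) * ennreal (inverse s) * indicator {\<epsilon>..R} s \<partial>lborel)"
  proof (rule nn_integral_cong)
    fix s
    have "ennreal a * ennreal (inverse (a * s)) = ennreal (inverse s)"
      using a by (simp flip: ennreal_mult' add: field_simps)
    moreover have "indicator {a * \<epsilon>..a * R} (a * s) = (indicator {\<epsilon>..R} s :: ennreal)"
      using a by (auto split: split_indicator)
    ultimately show "ennreal a * (f (a * s) * ennreal (inverse (a * s)) * indicator {a * \<epsilon>..a * R} (a * s))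
        = f (a * s) * ennreal (inverse s) * indicator {\<epsilon>..R} s"
      by (metis (no_types, lifting) mult.assoc mult.left_commute)
  qed
  finally show ?thesis .
qed

lemma nn_integral_inverse_le:
  assumes "0 < x" "x \<le> y" and u: "\<And>s. s > 0 \<Longrightarrow> u s \<le> ennreal B"
  shows "(\<integral>\<^sup>+ s. u s * ennreal (inverse s) * indicator {x..y} s \<partial>lborel) \<le> ennreal B * ennreal ((y - x) / x)"
proof -
  have "(\<integral>\<^sup>+ s. u s * ennreal (inverse s) * indicator {x..y} s \<partial>lborel)
      \<le> (\<integral>\<^sup>+ s. (ennreal B * ennreal (inverse x)) * indicator {x..y} s \<partial>lborel)"
  proof (rule nn_integral_mono)
    fix s
    show "u s * ennreal (inverse s) * indicator {x..y} s
        \<le> (ennreal B * ennreal (inverse x)) * indicator {x..y} s"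
    proof (cases "s \<in> {x..y}")
      case True
      then have "inverse s \<le> inverse x" using assms by (auto intro: le_imp_inverse_le)
      then show ?thesis using True u[of s] assms by (auto intro!: mult_mono ennreal_leI)
    qed simp
  qed
  also have "\<dots> = ennreal B * ennreal (inverse x) * ennreal (y - x)"
    using assms by (subst nn_integral_cmult_indicator) auto
  also have "\<dots> = ennreal B * ennreal ((y - x) / x)"
    using assms by (simp add: mult.assoc ennreal_mult[symmetric] field_simps)
  finally show ?thesis .
qed

text \<open>Divide the hypothesis by s and integrate over \<open>[\<epsilon>, R]\<close>. By invariance of \<open>ds / s\<close>, the right side
  integrates u over intervals contained in \<open>[\<epsilon> / 2, 3 R / 2]\<close>. What remains after subtracting the
  integral of u over \<open>[\<epsilon>, R]\<close> are two end pieces of mass at most 1 and 1/2 for \<open>ds / s\<close>, whatever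
  \<open>\<epsilon>\<close> and R are.\<close>
lemma nn_integral_mean_dilation_bound:
  fixes u v :: "real \<Rightarrow> ennreal" and a :: "'b \<Rightarrow> real"
  assumes M: "prob_space M" and a [measurable]: "a \<in> borel_measurable M"
    and a2: "\<And>x. x \<in> space M \<Longrightarrow> 1 / 2 \<le> a x \<and> a x \<le> 3 / 2"
    and u [measurable]: "u \<in> borel_measurable borel" and v [measurable]: "v \<in> borel_measurable borel"
    and uB: "\<And>s. s > 0 \<Longrightarrow> u s \<le> ennreal B"
    and uv: "\<And>s. s > 0 \<Longrightarrow> u s + v s \<le> (\<integral>\<^sup>+ x. u (a x * s) \<partial>M)"
  shows "(\<integral>\<^sup>+ s. v s * ennreal (inverse s) * indicator {0<..} s \<partial>lborel) \<le> ennreal B * ennreal (3 / 2)"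
proof -
  interpret M: prob_space M by (rule M)
  interpret MR: pair_sigma_finite M lborel by unfold_locales
  \<comment> \<open>the mass of u on \<open>[x, y]\<close> with respect to \<open>ds / s\<close>\<close>
  define U where "U x y = (\<integral>\<^sup>+ s. u s * ennreal (inverse s) * indicator {x..y} s \<partial>lborel)" for x y
  have main: "(\<integral>\<^sup>+ s. v s * ennreal (inverse s) * indicator {\<epsilon>..R} s \<partial>lborel) \<le> ennreal B * ennreal (3 / 2)"
    if e: "0 < \<epsilon>" "\<epsilon> \<le> R" for \<epsilon> R
  proof -
    have "U \<epsilon> R + (\<integral>\<^sup>+ s. v s * ennreal (inverse s) * indicator {\<epsilon>..R} s \<partial>lborel)
      = (\<integral>\<^sup>+ s. u s * ennreal (inverse s) * indicator {\<epsilon>..R} s + v s * ennreal (inverse s) * indicator {\<epsilon>..R} s \<partial>lborel)"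
      unfolding U_def by (rule nn_integral_add[symmetric]) auto
    also have "\<dots> \<le> (\<integral>\<^sup>+ s. (\<integral>\<^sup>+ x. u (a x * s) * ennreal (inverse s) * indicator {\<epsilon>..R} s \<partial>M) \<partial>lborel)"
    proof (rule nn_integral_mono)
      fix s
      show "u s * ennreal (inverse s) * indicator {\<epsilon>..R} s + v s * ennreal (inverse s) * indicator {\<epsilon>..R} s
        \<le> (\<integral>\<^sup>+ x. u (a x * s) * ennreal (inverse s) * indicator {\<epsilon>..R} s \<partial>M)"
      proof (cases "s \<in> {\<epsilon>..R}")
        case True
        then have "s > 0" using e by auto
        then have "(u s + v s) * ennreal (inverse s) \<le> (\<integral>\<^sup>+ x. u (a x * s) \<partial>M) * ennreal (inverse s)"
          using uv by (intro mult_right_mono) auto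
        also have "\<dots> = (\<integral>\<^sup>+ x. u (a x * s) * ennreal (inverse s) \<partial>M)"
          by (rule nn_integral_multc[symmetric]) auto
        finally show ?thesis using True by (simp add: distrib_right)
      qed simp
    qed
    also have "\<dots> = (\<integral>\<^sup>+ x. (\<integral>\<^sup>+ s. u (a x * s) * ennreal (inverse s) * indicator {\<epsilon>..R} s \<partial>lborel) \<partial>M)"
      by (rule MR.Fubini') (simp add: case_prod_unfold)
    also have "\<dots> \<le> (\<integral>\<^sup>+ x. U (\<epsilon> / 2) (3 / 2 * R) \<partial>M)"
    proof (rule nn_integral_mono)
      fix x assume "x \<in> space M"
      then have ax: "1 / 2 \<le> a x" "a x \<le> 3 / 2" using a2 by auto
      have "(\<integral>\<^sup>+ s. u (a x * s) * ennreal (inverse s) * indicator {\<epsilon>..R} s \<partial>lborel) = U (a x * \<epsilon>) (a x * R)"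
        unfolding U_def using ax by (subst nn_integral_scale[OF u]) auto
      also have "\<dots> \<le> U (\<epsilon> / 2) (3 / 2 * R)"
        unfolding U_def
      proof (intro nn_integral_mono mult_left_mono)
        fix s
        have "\<epsilon> / 2 \<le> a x * \<epsilon>" "a x * R \<le> 3 / 2 * R"
          using mult_right_mono[OF ax(1), of \<epsilon>] mult_right_mono[OF ax(2), of R] e by auto
        then show "(indicator {a x * \<epsilon>..a x * R} s :: ennreal) \<le> indicator {\<epsilon> / 2..3 / 2 * R} s"
          by (auto split: split_indicator)
      qed auto
      finally show "(\<integral>\<^sup>+ s. u (a x * s) * ennreal (inverse s) * indicator {\<epsilon>..R} s \<partial>lborel)
          \<le> U (\<epsilon> / 2) (3 / 2 * R)" .
    qed
    also have "\<dots> = U (\<epsilon> / 2) (3 / 2 * R)" by (simp add: M.emeasure_space_1)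
    also have "\<dots> \<le> (\<integral>\<^sup>+ s. (u s * ennreal (inverse s) * indicator {\<epsilon>..R} s + u s * ennreal (inverse s) * indicator {\<epsilon> / 2..\<epsilon>} s)
         + u s * ennreal (inverse s) * indicator {R..3 / 2 * R} s \<partial>lborel)"
      unfolding U_def using e by (intro nn_integral_mono) (auto split: split_indicator)
    also have "\<dots> = U \<epsilon> R + U (\<epsilon> / 2) \<epsilon> + U R (3 / 2 * R)"
      unfolding U_def by (subst nn_integral_add; measurable?) (subst nn_integral_add; measurable?; simp)+
    also have "\<dots> \<le> U \<epsilon> R + ennreal B * ennreal 1 + ennreal B * ennreal (1 / 2)"
    proof (intro add_mono order_refl)
      show "U (\<epsilon> / 2) \<epsilon> \<le> ennreal B * ennreal 1"
        using nn_integral_inverse_le[of "\<epsilon> / 2" \<epsilon> u B, OF _ _ uB] e by (simp add: U_def)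
      show "U R (3 / 2 * R) \<le> ennreal B * ennreal (1 / 2)"
        using nn_integral_inverse_le[of R "3 / 2 * R" u B, OF _ _ uB] e by (simp add: U_def)
    qed
    also have "\<dots> = U \<epsilon> R + ennreal B * ennreal (3 / 2)"
    proof -
      have "ennreal 1 + ennreal (1 / 2) = ennreal (3 / 2)" by (subst ennreal_plus[symmetric]) auto
      then show ?thesis by (metis add.assoc distrib_left)
    qed
    finally have "U \<epsilon> R + (\<integral>\<^sup>+ s. v s * ennreal (inverse s) * indicator {\<epsilon>..R} s \<partial>lborel)
        \<le> U \<epsilon> R + ennreal B * ennreal (3 / 2)" .
    moreover have "U \<epsilon> R \<noteq> top"
    proof -
      have "U \<epsilon> R \<le> ennreal B * ennreal ((R - \<epsilon>) / \<epsilon>)"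
        unfolding U_def using e by (intro nn_integral_inverse_le uB) auto
      also have "\<dots> < top" by (simp add: ennreal_mult_less_top)
      finally show ?thesis by simp
    qed
    ultimately show ?thesis by (simp add: ennreal_add_left_cancel_le)
  qed
  define I where "I i = {1 / real (Suc i)..real (Suc i)}" for i
  have "(\<integral>\<^sup>+ s. v s * ennreal (inverse s) * indicator {0<..} s \<partial>lborel) =
     (\<integral>\<^sup>+ s. (SUP i. v s * ennreal (inverse s) * indicator (I i) s) \<partial>lborel)"
  proof (rule nn_integral_cong)
    fix s :: real
    have "indicator {0<..} s = (SUP i. indicator (I i) s :: ennreal)"
    proof (cases "s > 0")
      case True
      obtain i where i: "max s (1 / s) < real i" using reals_Archimedean2 by blast
      then have "s \<in> I i" using True by (auto simp: I_def field_simps)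
      then have "(SUP i. indicator (I i) s :: ennreal) \<ge> 1"
        by (intro SUP_upper2[of i]) auto
      moreover have "(SUP i. indicator (I i) s :: ennreal) \<le> 1"
        by (intro SUP_least) (auto split: split_indicator)
      ultimately have "(SUP i. indicator (I i) s :: ennreal) = 1" by (rule order_antisym[rotated])
      then show ?thesis using True by (simp only: indicator_simps(1) greaterThan_iff)
    next
      case False
      have "s \<notin> I i" for i
      proof
        assume "s \<in> I i"
        then have "1 / real (Suc i) \<le> s" by (simp add: I_def)
        moreover have "0 < 1 / real (Suc i)" by simp
        ultimately show False using False by linarith
      qed
      then have "(\<lambda>i. indicator (I i) s :: ennreal) = (\<lambda>i. 0)" by (simp add: fun_eq_iff)
      then show ?thesis using False by (simp only: indicator_simps(2) greaterThan_iff SUP_const) simp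
    qed
    then show "v s * ennreal (inverse s) * indicator {0<..} s
        = (SUP i. v s * ennreal (inverse s) * indicator (I i) s)"
      by (simp only: SUP_mult_left_ennreal)
  qed
  also have "\<dots> = (SUP i. \<integral>\<^sup>+ s. v s * ennreal (inverse s) * indicator (I i) s \<partial>lborel)"
  proof (rule nn_integral_monotone_convergence_SUP)
    show "incseq (\<lambda>i s. v s * ennreal (inverse s) * indicator (I i) s)"
    proof (rule incseq_SucI, rule le_funI)
      fix i and s :: real
      have "1 / real (Suc (Suc i)) \<le> 1 / real (Suc i)" "real (Suc i) \<le> real (Suc (Suc i))"
        by (auto simp: frac_le)
      then have "I i \<subseteq> I (Suc i)" unfolding I_def by auto
      then show "v s * ennreal (inverse s) * indicator (I i) s
          \<le> v s * ennreal (inverse s) * indicator (I (Suc i)) s"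
        by (intro mult_left_mono) (auto split: split_indicator)
    qed
    show "(\<lambda>s. v s * ennreal (inverse s) * indicator (I i) s) \<in> borel_measurable lborel" for i
      unfolding I_def by measurable
  qed
  also have "\<dots> \<le> ennreal B * ennreal (3 / 2)"
  proof (rule SUP_least)
    fix i
    have "1 / real (Suc i) \<le> 1" "1 \<le> real (Suc i)" by simp_all
    then have "1 / real (Suc i) \<le> real (Suc i)" by linarith
    then show "(\<integral>\<^sup>+ s. v s * ennreal (inverse s) * indicator (I i) s \<partial>lborel) \<le> ennreal B * ennreal (3 / 2)"
      unfolding I_def by (intro main) auto
  qed
  finally show ?thesis .
qed

section \<open>Fejer means on the infinite torus\<close>

lemma card_functions_zero_outside:
  fixes B :: "nat \<Rightarrow> int set"
  shows "card {\<nu>. (\<forall>j<N. \<nu> j \<in> B j) \<and> (\<forall>j\<ge>N. \<nu> j = 0)} = (\<Prod>j<N. card (B j))" (is "card ?A = _")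
proof -
  have inj: "inj_on (\<lambda>f. restrict f {..<N}) ?A"
  proof (rule inj_onI, rule ext)
    fix f g j assume fg: "f \<in> ?A" "g \<in> ?A" "restrict f {..<N} = restrict g {..<N}"
    show "f j = g j"
    proof (cases "j < N")
      case True
      then show ?thesis using fun_cong[OF fg(3), of j] by simp
    qed (use fg in simp)
  qed
  have "(\<lambda>f. restrict f {..<N}) ` ?A = Pi\<^sub>E {..<N} B"
  proof (intro equalityI subsetI)
    fix h assume h: "h \<in> Pi\<^sub>E {..<N} B"
    then have "h = restrict (\<lambda>j. if j < N then h j else 0) {..<N}"
      by (auto simp: fun_eq_iff PiE_def extensional_def)
    then show "h \<in> (\<lambda>f. restrict f {..<N}) ` ?A"
      by (intro image_eqI[where x = "\<lambda>j. if j < N then h j else 0"]) (use h in auto)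
  qed (auto simp: PiE_iff extensional_def restrict_def)
  then have "card ?A = card (Pi\<^sub>E {..<N} B)" using card_image[OF inj] by simp
  then show ?thesis by (simp add: card_PiE)
qed

text \<open>The side length and the number of free coordinates grow together, so that every fixed frequency is
  small compared to the box eventually.\<close>
definition index_box :: "nat \<Rightarrow> (nat \<Rightarrow> int) set" where
  "index_box N = {\<nu>. (\<forall>j<N. \<nu> j \<in> {0..<int N}) \<and> (\<forall>j\<ge>N. \<nu> j = 0)}"

lemma card_index_box: "card (index_box N) = N ^ N"
  unfolding index_box_def by (subst card_functions_zero_outside) simp

lemma card_index_box_pos: "card (index_box N) > 0"
  by (cases N) (auto simp: card_index_box)

lemma finite_index_box [simp]: "finite (index_box N)"
  using card_index_box_pos by (metis card.infinite less_irrefl)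

lemma index_box_eventually_null: "\<nu> \<in> index_box N \<Longrightarrow> \<nu> \<in> eventually_null"
  unfolding index_box_def eventually_null_def
    by (auto intro!: finite_subset[of _ "{..<N}"] simp: not_less[symmetric])

lemma eventually_null_diff:
  "\<nu> \<in> eventually_null \<Longrightarrow> \<mu> \<in> eventually_null \<Longrightarrow> (\<lambda>j. \<nu> j - \<mu> j) \<in> eventually_null"
  unfolding eventually_null_def by (auto intro!: finite_subset[of _ "{j. \<nu> j \<noteq> 0} \<union> {j. \<mu> j \<noteq> 0}"])

lemma eventually_null_add:
  "\<nu> \<in> eventually_null \<Longrightarrow> \<mu> \<in> eventually_null \<Longrightarrow> (\<lambda>j. \<nu> j + \<mu> j) \<in> eventually_null"
  unfolding eventually_null_def by (auto intro!: finite_subset[of _ "{j. \<nu> j \<noteq> 0} \<union> {j. \<mu> j \<noteq> 0}"])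

lemma eventually_null_minus: "\<nu> \<in> eventually_null \<Longrightarrow> (\<lambda>j. - \<nu> j) \<in> eventually_null"
  by (simp add: eventually_null_def)

text \<open>The Fourier coefficient of the Fejer kernel at \<open>\<alpha>\<close>: the proportion of the box that stays in the
  box when translated by \<open>\<alpha>\<close>. It is a product of the one-dimensional coefficients \<open>1 - \<bar>\<alpha> j\<bar> / N\<close>.\<close>
definition fejer_coeff :: "nat \<Rightarrow> (nat \<Rightarrow> int) \<Rightarrow> real" where
  "fejer_coeff N \<alpha> = real (card {\<mu> \<in> index_box N. (\<lambda>j. \<mu> j + \<alpha> j) \<in> index_box N}) / real (card (index_box N))"

lemma fejer_coeff_bounds: "0 \<le> fejer_coeff N \<alpha>" "fejer_coeff N \<alpha> \<le> 1"
proof -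
  have "card {\<mu> \<in> index_box N. (\<lambda>j. \<mu> j + \<alpha> j) \<in> index_box N} \<le> card (index_box N)" by (rule card_mono) auto
  then show "0 \<le> fejer_coeff N \<alpha>" "fejer_coeff N \<alpha> \<le> 1"
    using card_index_box_pos[of N] by (auto simp: fejer_coeff_def)
qed

lemma fejer_coeff_eq:
  assumes fin: "finite J" and J: "{j. \<alpha> j \<noteq> 0} \<subseteq> J" and JN: "J \<subseteq> {..<N}" and N: "N > 0"
  shows "fejer_coeff N \<alpha> = (\<Prod>j\<in>J. real (nat (int N - \<bar>\<alpha> j\<bar>)) / real N)"
proof -
  let ?B = "\<lambda>j. {max 0 (- \<alpha> j)..<min (int N) (int N - \<alpha> j)}"
  have out: "\<alpha> j = 0" if "j \<ge> N" for j using J JN that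
    by (metis (mono_tags) lessThan_iff mem_Collect_eq not_le subsetD)
  have "{\<mu> \<in> index_box N. (\<lambda>j. \<mu> j + \<alpha> j) \<in> index_box N} = {\<mu>. (\<forall>j<N. \<mu> j \<in> ?B j) \<and> (\<forall>j\<ge>N. \<mu> j = 0)}"
  proof (rule set_eqI)
    fix \<mu>
    have key: "m \<in> {max 0 (- a)..<min n (n - a)} \<longleftrightarrow> m \<in> {0..<n} \<and> m + a \<in> {0..<n}" for m a n :: int
      by auto
    show "\<mu> \<in> {\<mu> \<in> index_box N. (\<lambda>j. \<mu> j + \<alpha> j) \<in> index_box N} \<longleftrightarrow> \<mu> \<in> {\<mu>. (\<forall>j<N. \<mu> j \<in> ?B j) \<and> (\<forall>j\<ge>N. \<mu> j = 0)}"
      using out by (auto simp: index_box_def key simp del: atLeastLessThan_iff)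
  qed
  then have "card {\<mu> \<in> index_box N. (\<lambda>j. \<mu> j + \<alpha> j) \<in> index_box N} = (\<Prod>j<N. card (?B j))"
    by (simp only: card_functions_zero_outside)
  also have "\<dots> = (\<Prod>j<N. nat (int N - \<bar>\<alpha> j\<bar>))"
    by (rule prod.cong) (auto simp: max_def min_def)
  finally have "fejer_coeff N \<alpha> = (\<Prod>j<N. real (nat (int N - \<bar>\<alpha> j\<bar>))) / (\<Prod>j<N. real N)"
    by (simp add: fejer_coeff_def card_index_box)
  also have "\<dots> = (\<Prod>j<N. real (nat (int N - \<bar>\<alpha> j\<bar>)) / real N)"
    by (rule prod_dividef[symmetric])
  also have "\<dots> = (\<Prod>j\<in>J. real (nat (int N - \<bar>\<alpha> j\<bar>)) / real N)"
  proof (rule prod.mono_neutral_right)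
    show "\<forall>i\<in>{..<N} - J. real (nat (int N - \<bar>\<alpha> i\<bar>)) / real N = 1"
    proof
      fix i assume "i \<in> {..<N} - J"
      then have "\<alpha> i = 0" using J by auto
      then show "real (nat (int N - \<bar>\<alpha> i\<bar>)) / real N = 1" using N by simp
    qed
  qed (use JN in auto)
  finally show ?thesis .
qed

lemma fejer_coeff_tendsto:
  assumes "\<alpha> \<in> eventually_null"
  shows "(\<lambda>N. fejer_coeff N \<alpha>) \<longlonglongrightarrow> 1"
proof -
  let ?J = "{j. \<alpha> j \<noteq> 0}"
  have fin: "finite ?J" using assms by (simp add: eventually_null_def)
  then obtain N0 where N0: "\<And>j. j \<in> ?J \<Longrightarrow> j < N0" by (metis bounded_nat_set_is_finite finite_nat_set_iff_bounded)
  have lim: "(\<lambda>N. real (nat (int N - \<bar>a\<bar>)) / real N) \<longlonglongrightarrow> 1" for a :: int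
  proof -
    have "(\<lambda>N. 1 - real_of_int \<bar>a\<bar> / real N) \<longlonglongrightarrow> 1 - 0"
      by (intro tendsto_intros lim_const_over_n)
    moreover have "\<forall>\<^sub>F N in sequentially. 1 - real_of_int \<bar>a\<bar> / real N = real (nat (int N - \<bar>a\<bar>)) / real N"
      using eventually_gt_at_top[of "nat \<bar>a\<bar>"]
    proof eventually_elim
      case (elim N)
      then have "real (nat (int N - \<bar>a\<bar>)) = real N - real_of_int \<bar>a\<bar>" by simp
      then show ?case using elim by (simp add: diff_divide_distrib)
    qed
    ultimately show ?thesis by (simp add: Lim_transform_eventually)
  qed
  have "(\<lambda>N. \<Prod>j\<in>?J. real (nat (int N - \<bar>\<alpha> j\<bar>)) / real N) \<longlonglongrightarrow> (\<Prod>j\<in>?J. 1)"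
    by (intro tendsto_prod lim)
  moreover have "\<forall>\<^sub>F N in sequentially. (\<Prod>j\<in>?J. real (nat (int N - \<bar>\<alpha> j\<bar>)) / real N) = fejer_coeff N \<alpha>"
    using eventually_gt_at_top[of N0]
  proof eventually_elim
    case (elim N)
    have "?J \<subseteq> {..<N}"
    proof
      fix j assume "j \<in> ?J"
      then show "j \<in> {..<N}" using N0[of j] elim by simp
    qed
    then show ?case using fejer_coeff_eq[OF fin order_refl] elim by simp
  qed
  ultimately show ?thesis by (simp add: Lim_transform_eventually)
qed

definition index_diff :: "(nat \<Rightarrow> int) \<times> (nat \<Rightarrow> int) \<Rightarrow> nat \<Rightarrow> int" where
  "index_diff x = (\<lambda>j. fst x j - snd x j)"

lemma fejer_coeff_eq_0:
  assumes "\<alpha> \<notin> index_diff ` (index_box N \<times> index_box N)"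
  shows "fejer_coeff N \<alpha> = 0"
proof -
  have "\<alpha> \<in> index_diff ` (index_box N \<times> index_box N)" if "\<mu> \<in> index_box N" "(\<lambda>j. \<mu> j + \<alpha> j) \<in> index_box N" for \<mu>
    using that by (intro image_eqI[of _ _ "(\<lambda>j. \<mu> j + \<alpha> j, \<mu>)"]) (auto simp: index_diff_def)
  then have "{\<mu> \<in> index_box N. (\<lambda>j. \<mu> j + \<alpha> j) \<in> index_box N} = {}" using assms by blast
  then show ?thesis unfolding fejer_coeff_def by (simp only: card.empty)
qed

text \<open>The Fejer mean in terms of the Fourier coefficients. In this form, with one term for each pair of
  points of the box, it is visibly the convolution with a square; \<open>fejer_regroup\<close> collects equal
  frequencies.\<close>
definition fejer :: "nat \<Rightarrow> ((nat \<Rightarrow> int) \<Rightarrow> 'a::complex_banach) \<Rightarrow> (nat \<Rightarrow> complex) \<Rightarrow> 'a" where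
  "fejer N c z = (\<Sum>x\<in>index_box N \<times> index_box N. (monomial (index_diff x) z / of_nat (card (index_box N))) *\<^sub>C c (index_diff x))"

lemma fejer_regroup:
  assumes D: "finite D" "\<And>\<alpha>. \<alpha> \<in> index_diff ` (index_box N \<times> index_box N) \<Longrightarrow> c \<alpha> \<noteq> 0 \<Longrightarrow> \<alpha> \<in> D"
  shows "fejer N c z = (\<Sum>\<alpha>\<in>D. (of_real (fejer_coeff N \<alpha>) * monomial \<alpha> z) *\<^sub>C c \<alpha>)"
proof -
  let ?S = "index_box N \<times> index_box N"
  let ?t = "\<lambda>\<alpha>. (of_real (fejer_coeff N \<alpha>) * monomial \<alpha> z) *\<^sub>C c \<alpha>"
  have cnt: "card {x \<in> ?S. index_diff x = \<alpha>} = card {\<mu> \<in> index_box N. (\<lambda>j. \<mu> j + \<alpha> j) \<in> index_box N}" for \<alpha>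
  proof (rule bij_betw_same_card[of snd])
    show "bij_betw snd {x \<in> ?S. index_diff x = \<alpha>} {\<mu> \<in> index_box N. (\<lambda>j. \<mu> j + \<alpha> j) \<in> index_box N}"
      by (rule bij_betw_byWitness[where f' = "\<lambda>\<mu>. (\<lambda>j. \<mu> j + \<alpha> j, \<mu>)"]) (auto simp: index_diff_def)
  qed
  have "fejer N c z = (\<Sum>\<alpha>\<in>index_diff ` ?S. \<Sum>x\<in>{x \<in> ?S. index_diff x = \<alpha>}. (monomial (index_diff x) z / of_nat (card (index_box N))) *\<^sub>C c (index_diff x))"
    unfolding fejer_def by (rule sum.image_gen) simp
  also have "\<dots> = (\<Sum>\<alpha>\<in>index_diff ` ?S. ?t \<alpha>)"
  proof (rule sum.cong[OF refl])
    fix \<alpha>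
    have "(\<Sum>x\<in>{x \<in> ?S. index_diff x = \<alpha>}. (monomial (index_diff x) z / of_nat (card (index_box N))) *\<^sub>C c (index_diff x))
      = (\<Sum>x\<in>{x \<in> ?S. index_diff x = \<alpha>}. (monomial \<alpha> z / of_nat (card (index_box N))) *\<^sub>C c \<alpha>)"
      by (rule sum.cong) auto
    also have "\<dots> = of_nat (card {x \<in> ?S. index_diff x = \<alpha>}) *\<^sub>C ((monomial \<alpha> z / of_nat (card (index_box N))) *\<^sub>C c \<alpha>)"
    proof -
      have "real k *\<^sub>R y = of_nat k *\<^sub>C y" for k and y :: 'a
        using scaleC_of_real[of "real k" y] by simp
      then show ?thesis by (simp only: sum_constant_scaleR)
    qed
    also have "\<dots> = ?t \<alpha>"
      by (simp add: scaleC_scaleC fejer_coeff_def cnt)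
    finally show "(\<Sum>x\<in>{x \<in> ?S. index_diff x = \<alpha>}. (monomial (index_diff x) z / of_nat (card (index_box N))) *\<^sub>C c (index_diff x))
        = ?t \<alpha>" .
  qed
  also have "\<dots> = (\<Sum>\<alpha>\<in>D \<inter> index_diff ` ?S. ?t \<alpha>)"
  proof (intro sum.mono_neutral_right ballI)
    fix \<alpha> assume "\<alpha> \<in> index_diff ` ?S - D \<inter> index_diff ` ?S"
    then have "c \<alpha> = 0" using D(2)[of \<alpha>] by auto
    then show "?t \<alpha> = 0" by (simp add: scaleC.zero_right)
  qed auto
  also have "\<dots> = (\<Sum>\<alpha>\<in>D. ?t \<alpha>)"
  proof (intro sum.mono_neutral_left D(1) ballI)
    fix \<alpha> assume "\<alpha> \<in> D - D \<inter> index_diff ` ?S"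
    then have "fejer_coeff N \<alpha> = 0" by (intro fejer_coeff_eq_0) auto
    then show "?t \<alpha> = 0" by (simp add: scaleC.zero_left)
  qed auto
  finally show ?thesis .
qed

text \<open>The squared modulus of the sum of characters over the box, which makes the kernel nonnegative.\<close>
definition fejer_kernel :: "nat \<Rightarrow> (nat \<Rightarrow> complex) \<Rightarrow> (nat \<Rightarrow> complex) \<Rightarrow> real" where
  "fejer_kernel N z w = (cmod (\<Sum>\<nu>\<in>index_box N. monomial \<nu> z * cnj (monomial \<nu> w)))\<^sup>2 / real (card (index_box N))"

lemma fejer_kernel_sym: "fejer_kernel N z w = fejer_kernel N w z"
proof -
  have "(\<Sum>\<nu>\<in>index_box N. monomial \<nu> z * cnj (monomial \<nu> w))
      = cnj (\<Sum>\<nu>\<in>index_box N. monomial \<nu> w * cnj (monomial \<nu> z))"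
    by (simp add: cnj_sum mult.commute)
  then show ?thesis unfolding fejer_kernel_def by (simp only: complex_mod_cnj)
qed

lemma fejer_kernel_nonneg: "0 \<le> fejer_kernel N z w"
  by (simp add: fejer_kernel_def)

lemma monomial_index_diff:
  assumes "x \<in> index_box N \<times> index_box N" "z \<in> space \<T>"
  shows "monomial (index_diff x) z = monomial (fst x) z * cnj (monomial (snd x) z)"
  using monomial_add[of "fst x" "\<lambda>j. - snd x j" z] assms monomial_minus[OF assms(2), of "snd x"]
  by (auto simp: index_diff_def index_box_eventually_null eventually_null_minus)

lemma fejer_kernel_expand:
  assumes "z \<in> space \<T>" "w \<in> space \<T>"
  shows "complex_of_real (fejer_kernel N z w) =
    (\<Sum>x\<in>index_box N \<times> index_box N. (monomial (index_diff x) z / of_nat (card (index_box N))) * monomial (\<lambda>j. - index_diff x j) w)"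
proof -
  let ?s = "\<Sum>\<nu>\<in>index_box N. monomial \<nu> z * cnj (monomial \<nu> w)"
  have "complex_of_real (fejer_kernel N z w) = ?s * cnj ?s / of_nat (card (index_box N))"
    unfolding complex_norm_square[symmetric] by (simp add: fejer_kernel_def)
  also have "?s * cnj ?s = (\<Sum>x\<in>index_box N \<times> index_box N. (monomial (fst x) z * cnj (monomial (fst x) w)) * cnj (monomial (snd x) z * cnj (monomial (snd x) w)))"
    unfolding cnj_sum sum_product sum.cartesian_product by (simp add: case_prod_unfold)
  also have "\<dots> / of_nat (card (index_box N))
      = (\<Sum>x\<in>index_box N \<times> index_box N. (monomial (index_diff x) z / of_nat (card (index_box N))) * monomial (\<lambda>j. - index_diff x j) w)"
    unfolding sum_divide_distrib
  proof (rule sum.cong[OF refl])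
    fix x assume x: "x \<in> index_box N \<times> index_box N"
    show "(monomial (fst x) z * cnj (monomial (fst x) w)) * cnj (monomial (snd x) z * cnj (monomial (snd x) w)) / of_nat (card (index_box N))
      = (monomial (index_diff x) z / of_nat (card (index_box N))) * monomial (\<lambda>j. - index_diff x j) w"
      unfolding monomial_minus[OF assms(2)] monomial_index_diff[OF x assms(1)] monomial_index_diff[OF x assms(2)]
      by simp
  qed
  finally show ?thesis .
qed

lemma index_diff_eventually_null: "x \<in> index_box N \<times> index_box N \<Longrightarrow> index_diff x \<in> eventually_null"
  by (auto simp: index_diff_def intro!: eventually_null_diff intro: index_box_eventually_null[of _ N])

lemma fejer_kernel_measurable: "(\<lambda>w. fejer_kernel N z w) \<in> borel_measurable \<T>"
proof -
  have "(\<lambda>w. cmod (\<Sum>\<nu>\<in>index_box N. cnj (monomial \<nu> z) * monomial \<nu> w)) \<in> borel_measurable \<T>" by measurable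
  moreover have "cmod (\<Sum>\<nu>\<in>index_box N. cnj (monomial \<nu> z) * monomial \<nu> w)
      = cmod (\<Sum>\<nu>\<in>index_box N. monomial \<nu> w * cnj (monomial \<nu> z))" for w
    by (simp add: mult.commute)
  ultimately show ?thesis by (subst fejer_kernel_sym) (simp add: fejer_kernel_def)
qed

lemma fejer_kernel_measurable_pair:
  "(\<lambda>x. fejer_kernel N (fst x) (snd x)) \<in> borel_measurable (\<T> \<Otimes>\<^sub>M \<T>)"
proof -
  have [measurable]: "(\<lambda>x. cnj (monomial \<nu> (snd x))) \<in> borel_measurable (\<T> \<Otimes>\<^sub>M \<T>)" for \<nu>
    by (rule borel_measurable_continuous_on[where f = cnj]) (auto intro!: continuous_intros)
  show ?thesis unfolding fejer_kernel_def by measurable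
qed

lemma nn_integral_fejer_kernel:
  assumes z: "z \<in> space \<T>"
  shows "(\<integral>\<^sup>+ w. ennreal (fejer_kernel N z w) \<partial>\<T>) = 1"
proof -
  let ?e = "\<lambda>x w. (monomial (index_diff x) z / of_nat (card (index_box N))) * monomial (\<lambda>j. - index_diff x j) w"
  have int: "integrable \<T> (?e x)" for x
    by (intro integrable_mult_right integrable_monomial)
  have "(\<integral>w. complex_of_real (fejer_kernel N z w) \<partial>\<T>) = (\<integral>w. (\<Sum>x\<in>index_box N \<times> index_box N. ?e x w) \<partial>\<T>)"
    by (rule Bochner_Integration.integral_cong) (use fejer_kernel_expand[OF z] in auto)
  also have "\<dots> = (\<Sum>x\<in>index_box N \<times> index_box N. \<integral>w. ?e x w \<partial>\<T>)"
    by (rule Bochner_Integration.integral_sum) (rule int)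
  also have "\<dots> = (\<Sum>x\<in>index_box N \<times> index_box N. if fst x = snd x then 1 / of_nat (card (index_box N)) else 0)"
  proof (rule sum.cong[OF refl])
    fix x assume x: "x \<in> index_box N \<times> index_box N"
    have "(\<lambda>j. - index_diff x j) = (\<lambda>_. 0) \<longleftrightarrow> fst x = snd x" by (auto simp: index_diff_def fun_eq_iff)
    moreover have "fst x = snd x \<Longrightarrow> monomial (index_diff x) z = 1" by (simp add: index_diff_def)
    ultimately show "(\<integral>w. ?e x w \<partial>\<T>) = (if fst x = snd x then 1 / of_nat (card (index_box N)) else 0)"
      using integral_monomial[OF eventually_null_minus[OF index_diff_eventually_null[OF x]]]
        by (simp only: integral_mult_right_zero) simp
  qed
  also have "\<dots> = (\<Sum>\<nu>\<in>index_box N. \<Sum>\<mu>\<in>index_box N. if \<nu> = \<mu> then 1 / of_nat (card (index_box N)) else 0)"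
    by (simp only: sum.cartesian_product case_prod_unfold)
  also have "\<dots> = 1" using card_index_box_pos[of N] by (simp add: card_gt_0_iff)
  finally have one: "(\<integral>w. complex_of_real (fejer_kernel N z w) \<partial>\<T>) = 1" .
  have "integrable \<T> (\<lambda>w. \<Sum>x\<in>index_box N \<times> index_box N. ?e x w)"
    by (rule Bochner_Integration.integrable_sum) (rule int)
  moreover have "integrable \<T> (\<lambda>w. complex_of_real (fejer_kernel N z w))
      \<longleftrightarrow> integrable \<T> (\<lambda>w. \<Sum>x\<in>index_box N \<times> index_box N. ?e x w)"
    by (rule Bochner_Integration.integrable_cong) (use fejer_kernel_expand[OF z] in auto)
  ultimately have intK: "integrable \<T> (\<lambda>w. fejer_kernel N z w)"
    by (simp only: complex_of_real_integrable_eq)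
  have "(\<integral>w. fejer_kernel N z w \<partial>\<T>) = 1"
    using one by (metis integral_complex_of_real of_real_eq_1_iff)
  then show ?thesis
    by (subst nn_integral_eq_integral[OF intK]) (auto intro!: AE_I2 fejer_kernel_nonneg)
qed

lemma has_bochner_int_weighted_sum:
  fixes F :: "'b \<Rightarrow> 'a::complex_banach"
  assumes "finite I" and F: "F \<in> borel_measurable M" and \<phi>: "\<And>i. i \<in> I \<Longrightarrow> \<phi> i \<in> borel_measurable M"
    and x: "\<And>i. i \<in> I \<Longrightarrow> has_bochner_int M (\<lambda>w. \<phi> i w *\<^sub>C F w) (x i)"
  shows "has_bochner_int M (\<lambda>w. (\<Sum>i\<in>I. a i * \<phi> i w) *\<^sub>C F w) (\<Sum>i\<in>I. a i *\<^sub>C x i)"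
proof -
  have "has_bochner_int M (\<lambda>w. \<Sum>i\<in>I. a i *\<^sub>C \<phi> i w *\<^sub>C F w) (\<Sum>i\<in>I. a i *\<^sub>C x i)"
  proof (rule has_bochner_int_sum[OF assms(1)])
    show "has_bochner_int M (\<lambda>w. a i *\<^sub>C \<phi> i w *\<^sub>C F w) (a i *\<^sub>C x i)" if "i \<in> I" for i
      by (rule has_bochner_int_bounded_linear[OF scaleC.bounded_linear_right x[OF that]])
    fix J assume "J \<subseteq> I"
    then have "(\<lambda>w. \<Sum>i\<in>J. a i * \<phi> i w) \<in> borel_measurable M"
      using \<phi> by (intro borel_measurable_sum borel_measurable_times) auto
    from borel_measurable_scaleC[OF F this]
    show "(\<lambda>w. \<Sum>i\<in>J. a i *\<^sub>C \<phi> i w *\<^sub>C F w) \<in> borel_measurable M"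
      by (simp add: scaleC.sum_left scaleC_scaleC)
  qed
  then show ?thesis by (simp add: scaleC.sum_left scaleC_scaleC)
qed

lemma has_bochner_int_fourier_coeff:
  fixes F :: "(nat \<Rightarrow> complex) \<Rightarrow> 'a::complex_banach"
  assumes F: "strongly_measurable \<T> F"
    and fin: "(\<integral>\<^sup>+ z. ennreal (norm (F z)) \<partial>\<T>) < \<infinity>"
  shows "has_bochner_int \<T> (\<lambda>z. monomial (\<lambda>j. - \<nu> j) z *\<^sub>C F z) (fourier_coeff F \<nu>)"
  unfolding fourier_coeff_def
proof (rule has_bochner_int_bochner_int)
  show "finite_measure \<T>" by unfold_locales
  show "strongly_measurable \<T> (\<lambda>z. monomial (\<lambda>j. - \<nu> j) z *\<^sub>C F z)"
    by (rule strongly_measurable_scaleC[OF F monomial_measurable])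
  have "(\<integral>\<^sup>+ z. ennreal (norm (monomial (\<lambda>j. - \<nu> j) z *\<^sub>C F z)) \<partial>\<T>) = (\<integral>\<^sup>+ z. ennreal (norm (F z)) \<partial>\<T>)"
    by (rule nn_integral_cong) (simp add: norm_scaleC norm_monomial)
  then show "(\<integral>\<^sup>+ z. ennreal (norm (monomial (\<lambda>j. - \<nu> j) z *\<^sub>C F z)) \<partial>\<T>) < \<infinity>"
    using fin by simp
qed

lemma norm_fejer_le:
  fixes F :: "(nat \<Rightarrow> complex) \<Rightarrow> 'a::complex_banach"
  assumes F: "strongly_measurable \<T> F"
    and fin: "(\<integral>\<^sup>+ z. ennreal (norm (F z)) \<partial>\<T>) < \<infinity>" and z: "z \<in> space \<T>"
  shows "ennreal (norm (fejer N (fourier_coeff F) z))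
      \<le> (\<integral>\<^sup>+ w. ennreal (fejer_kernel N z w) * ennreal (norm (F w)) \<partial>\<T>)"
proof -
  let ?a = "\<lambda>x. monomial (index_diff x) z / of_nat (card (index_box N))"
  have "has_bochner_int \<T> (\<lambda>w. (\<Sum>x\<in>index_box N \<times> index_box N. ?a x * monomial (\<lambda>j. - index_diff x j) w) *\<^sub>C F w)
     (\<Sum>x\<in>index_box N \<times> index_box N. ?a x *\<^sub>C fourier_coeff F (index_diff x))"
    by (rule has_bochner_int_weighted_sum)
       (auto intro: strongly_measurable_borel[OF F] has_bochner_int_fourier_coeff[OF F fin])
  then have "has_bochner_int \<T> (\<lambda>w. (\<Sum>x\<in>index_box N \<times> index_box N. ?a x * monomial (\<lambda>j. - index_diff x j) w) *\<^sub>C F w)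
     (fejer N (fourier_coeff F) z)" by (simp only: fejer_def)
  from has_bochner_int_norm_bound[OF this]
  have "ennreal (norm (fejer N (fourier_coeff F) z))
      \<le> (\<integral>\<^sup>+ w. ennreal (norm ((\<Sum>x\<in>index_box N \<times> index_box N. ?a x * monomial (\<lambda>j. - index_diff x j) w) *\<^sub>C F w)) \<partial>\<T>)" .
  also have "\<dots> = (\<integral>\<^sup>+ w. ennreal (fejer_kernel N z w) * ennreal (norm (F w)) \<partial>\<T>)"
  proof (rule nn_integral_cong)
    fix w assume w: "w \<in> space \<T>"
    show "ennreal (norm ((\<Sum>x\<in>index_box N \<times> index_box N. ?a x * monomial (\<lambda>j. - index_diff x j) w) *\<^sub>C F w))
        = ennreal (fejer_kernel N z w) * ennreal (norm (F w))"
      unfolding fejer_kernel_expand[OF z w, symmetric] norm_scaleC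
      by (simp add: fejer_kernel_nonneg ennreal_mult)
  qed
  finally show ?thesis .
qed

interpretation tt: pair_sigma_finite \<T> \<T>
  by unfold_locales

text \<open>The Fejer mean at z is the average of F against the probability density \<open>fejer_kernel N z\<close>. After
  Jensen's inequality, integration over z removes the kernel, since it is symmetric.\<close>
theorem fejer_contraction:
  fixes F :: "(nat \<Rightarrow> complex) \<Rightarrow> 'a::complex_banach"
  assumes F: "strongly_measurable \<T> F" and p: "1 \<le> p"
    and fin: "(\<integral>\<^sup>+ z. ennreal (norm (F z)) \<partial>\<T>) < \<infinity>"
  shows "LpN \<T> p (fejer N (fourier_coeff F)) \<le> LpN \<T> p F"
proof -
  have nF [measurable]: "(\<lambda>w. norm (F w)) \<in> borel_measurable \<T>" by (rule strongly_measurable_norm[OF F])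
  note [measurable] = fejer_kernel_measurable fejer_kernel_measurable_pair
  have "LpN \<T> p (fejer N (fourier_coeff F))
      \<le> (\<integral>\<^sup>+ z. (\<integral>\<^sup>+ w. ennreal (fejer_kernel N z w) * ennreal (norm (F w) powr p) \<partial>\<T>) \<partial>\<T>)"
    unfolding LpN_def
  proof (rule nn_integral_mono)
    fix z assume z: "z \<in> space \<T>"
    show "ennreal (norm (fejer N (fourier_coeff F) z) powr p)
        \<le> (\<integral>\<^sup>+ w. ennreal (fejer_kernel N z w) * ennreal (norm (F w) powr p) \<partial>\<T>)"
      by (rule jensen_powr) (use norm_fejer_le[OF F fin z] nn_integral_fejer_kernel[OF z] p in auto)
  qed
  also have "\<dots> = (\<integral>\<^sup>+ w. (\<integral>\<^sup>+ z. ennreal (fejer_kernel N z w) * ennreal (norm (F w) powr p) \<partial>\<T>) \<partial>\<T>)"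
    by (rule tt.Fubini'[symmetric]) (simp add: case_prod_unfold)
  also have "\<dots> = LpN \<T> p F"
    unfolding LpN_def
  proof (rule nn_integral_cong)
    fix w assume w: "w \<in> space \<T>"
    show "(\<integral>\<^sup>+ z. ennreal (fejer_kernel N z w) * ennreal (norm (F w) powr p) \<partial>\<T>) = ennreal (norm (F w) powr p)"
      unfolding fejer_kernel_sym[of N _ w]
      by (subst nn_integral_multc) (simp_all add: nn_integral_fejer_kernel[OF w])
  qed
  finally show ?thesis .
qed

section \<open>Density of trigonometric polynomials\<close>

definition trig_poly :: "((nat \<Rightarrow> complex) \<Rightarrow> 'a::complex_banach) \<Rightarrow> bool" where
  "trig_poly Q \<longleftrightarrow> (\<exists>B c. finite B \<and> B \<subseteq> eventually_null \<and>
     (\<forall>z\<in>space \<T>. Q z = (\<Sum>\<alpha>\<in>B. monomial \<alpha> z *\<^sub>C c \<alpha>)))"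

lemma trig_poly_monomial: "\<alpha> \<in> eventually_null \<Longrightarrow> trig_poly (\<lambda>z. monomial \<alpha> z *\<^sub>C c)"
  unfolding trig_poly_def by (rule exI[of _ "{\<alpha>}"], rule exI[of _ "\<lambda>_. c"]) simp

lemma trig_poly_zero: "trig_poly (\<lambda>z. 0)"
  unfolding trig_poly_def by (rule exI[of _ "{}"]) simp

lemma trig_poly_add:
  assumes "trig_poly P" "trig_poly Q"
  shows "trig_poly (\<lambda>z. P z + Q z)"
proof -
  obtain B c where P: "finite B" "B \<subseteq> eventually_null" "\<And>z. z \<in> space \<T> \<Longrightarrow> P z = (\<Sum>\<alpha>\<in>B. monomial \<alpha> z *\<^sub>C c \<alpha>)"
    using assms(1) unfolding trig_poly_def by blast
  obtain D d where Q: "finite D" "D \<subseteq> eventually_null" "\<And>z. z \<in> space \<T> \<Longrightarrow> Q z = (\<Sum>\<alpha>\<in>D. monomial \<alpha> z *\<^sub>C d \<alpha>)"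
    using assms(2) unfolding trig_poly_def by blast
  let ?e = "\<lambda>\<alpha>. (if \<alpha> \<in> B then c \<alpha> else 0) + (if \<alpha> \<in> D then d \<alpha> else 0)"
  have "P z + Q z = (\<Sum>\<alpha>\<in>B \<union> D. monomial \<alpha> z *\<^sub>C ?e \<alpha>)" if z: "z \<in> space \<T>" for z
  proof -
    have "(\<Sum>\<alpha>\<in>B. monomial \<alpha> z *\<^sub>C c \<alpha>) = (\<Sum>\<alpha>\<in>B \<union> D. monomial \<alpha> z *\<^sub>C (if \<alpha> \<in> B then c \<alpha> else 0))"
      by (rule sum.mono_neutral_cong_left) (use P(1) Q(1) in \<open>auto simp: scaleC.zero_right\<close>)
    moreover have "(\<Sum>\<alpha>\<in>D. monomial \<alpha> z *\<^sub>C d \<alpha>) = (\<Sum>\<alpha>\<in>B \<union> D. monomial \<alpha> z *\<^sub>C (if \<alpha> \<in> D then d \<alpha> else 0))"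
      by (rule sum.mono_neutral_cong_left) (use P(1) Q(1) in \<open>auto simp: scaleC.zero_right\<close>)
    ultimately show ?thesis using P(3)[OF z] Q(3)[OF z]
      by (simp only: scaleC_add_right sum.distrib)
  qed
  then show ?thesis unfolding trig_poly_def using P Q by (intro exI[of _ "B \<union> D"] exI[of _ ?e]) auto
qed

lemma trig_poly_sum: "(\<And>i. i \<in> I \<Longrightarrow> trig_poly (P i)) \<Longrightarrow> trig_poly (\<lambda>z. \<Sum>i\<in>I. P i z)"
  by (induction I rule: infinite_finite_induct) (auto intro: trig_poly_zero trig_poly_add)

lemma trig_poly_cong: "trig_poly P \<Longrightarrow> (\<And>z. z \<in> space \<T> \<Longrightarrow> P z = Q z) \<Longrightarrow> trig_poly Q"
  unfolding trig_poly_def by metis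

lemma trig_poly_scaleC:
  fixes q :: "(nat \<Rightarrow> complex) \<Rightarrow> complex" and Q :: "(nat \<Rightarrow> complex) \<Rightarrow> 'a::complex_banach"
  assumes "trig_poly q" "trig_poly Q"
  shows "trig_poly (\<lambda>z. q z *\<^sub>C Q z)"
proof -
  obtain B c where q: "finite B" "B \<subseteq> eventually_null" "\<And>z. z \<in> space \<T> \<Longrightarrow> q z = (\<Sum>\<alpha>\<in>B. monomial \<alpha> z *\<^sub>C c \<alpha>)"
    using assms(1) unfolding trig_poly_def by blast
  obtain D d where Q: "finite D" "D \<subseteq> eventually_null" "\<And>z. z \<in> space \<T> \<Longrightarrow> Q z = (\<Sum>\<alpha>\<in>D. monomial \<alpha> z *\<^sub>C d \<alpha>)"
    using assms(2) unfolding trig_poly_def by blast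
  have "trig_poly (\<lambda>z. \<Sum>\<alpha>\<in>B. \<Sum>\<beta>\<in>D. monomial (\<lambda>j. \<alpha> j + \<beta> j) z *\<^sub>C (c \<alpha> *\<^sub>C d \<beta>))"
    using q Q by (intro trig_poly_sum trig_poly_monomial eventually_null_add) auto
  then show ?thesis
  proof (rule trig_poly_cong)
    fix z assume z: "z \<in> space \<T>"
    have "q z *\<^sub>C Q z = (\<Sum>\<alpha>\<in>B. \<Sum>\<beta>\<in>D. (monomial \<alpha> z *\<^sub>C c \<alpha>) *\<^sub>C monomial \<beta> z *\<^sub>C d \<beta>)"
      unfolding q(3)[OF z] Q(3)[OF z] scaleC.sum_left scaleC.sum_right by (rule sum.swap)
    also have "\<dots> = (\<Sum>\<alpha>\<in>B. \<Sum>\<beta>\<in>D. monomial (\<lambda>j. \<alpha> j + \<beta> j) z *\<^sub>C (c \<alpha> *\<^sub>C d \<beta>))"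
    proof (intro sum.cong refl)
      fix \<alpha> \<beta> assume "\<alpha> \<in> B" "\<beta> \<in> D"
      then have "monomial (\<lambda>j. \<alpha> j + \<beta> j) z = monomial \<alpha> z * monomial \<beta> z"
        using q(2) Q(2) z by (intro monomial_add) auto
      then show "(monomial \<alpha> z *\<^sub>C c \<alpha>) *\<^sub>C monomial \<beta> z *\<^sub>C d \<beta> = monomial (\<lambda>j. \<alpha> j + \<beta> j) z *\<^sub>C (c \<alpha> *\<^sub>C d \<beta>)"
        by (simp add: scaleC_scaleC scaleC_complex_def mult_ac)
    qed
    finally show "(\<Sum>\<alpha>\<in>B. \<Sum>\<beta>\<in>D. monomial (\<lambda>j. \<alpha> j + \<beta> j) z *\<^sub>C (c \<alpha> *\<^sub>C d \<beta>)) = q z *\<^sub>C Q z" ..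
  qed
qed

lemma trig_poly_mult:
  fixes q :: "(nat \<Rightarrow> complex) \<Rightarrow> complex"
  assumes "trig_poly q" "trig_poly r"
  shows "trig_poly (\<lambda>z. q z * r z)"
  using trig_poly_scaleC[OF assms] by (simp add: scaleC_complex_def)

lemma trig_poly_const: "trig_poly (\<lambda>z. c)"
  using trig_poly_monomial[of "\<lambda>_. 0" c] by (simp add: eventually_null_def)

lemma trig_poly_bounded:
  assumes "trig_poly Q"
  obtains K where "0 \<le> K" "\<And>z. z \<in> space \<T> \<Longrightarrow> norm (Q z) \<le> K"
proof -
  obtain B c where Q: "finite B" "B \<subseteq> eventually_null" "\<And>z. z \<in> space \<T> \<Longrightarrow> Q z = (\<Sum>\<alpha>\<in>B. monomial \<alpha> z *\<^sub>C c \<alpha>)"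
    using assms(1) unfolding trig_poly_def by blast
  show ?thesis
  proof (rule that[of "\<Sum>\<alpha>\<in>B. norm (c \<alpha>)"])
    show "norm (Q z) \<le> (\<Sum>\<alpha>\<in>B. norm (c \<alpha>))" if "z \<in> space \<T>" for z
      unfolding Q(3)[OF that] using that by (intro sum_norm_le) (simp add: norm_scaleC norm_monomial)
  qed (auto intro: sum_nonneg)
qed

lemma trig_poly_add_measurable:
  assumes F: "strongly_measurable \<T> F" and "trig_poly Q"
  shows "strongly_measurable \<T> (\<lambda>z. F z + Q z)"
proof -
  obtain B c where Q: "finite B" "B \<subseteq> eventually_null" "\<And>z. z \<in> space \<T> \<Longrightarrow> Q z = (\<Sum>\<alpha>\<in>B. monomial \<alpha> z *\<^sub>C c \<alpha>)"
    using assms(2) unfolding trig_poly_def by blast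
  have S: "strongly_measurable \<T> (\<lambda>z. F z + (\<Sum>\<alpha>\<in>B. monomial \<alpha> z *\<^sub>C c \<alpha>))"
    by (rule strongly_measurable_add_sum_scaleC[OF Q(1) F]) simp
  have eq: "F z + (\<Sum>\<alpha>\<in>B. monomial \<alpha> z *\<^sub>C c \<alpha>) = F z + Q z" if "z \<in> space \<T>" for z
    using Q(3)[OF that] by simp
  have m: "(\<lambda>z. F z + Q z) \<in> borel_measurable \<T>"
    using strongly_measurable_borel[OF S] eq by (simp cong: measurable_cong)
  obtain s where s: "\<forall>i::nat. simple_function \<T> (s i)"
    "AE z in \<T>. (\<lambda>i. s i z) \<longlonglongrightarrow> F z + (\<Sum>\<alpha>\<in>B. monomial \<alpha> z *\<^sub>C c \<alpha>)"
    using S unfolding strongly_measurable_def by blast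
  have "AE z in \<T>. (\<lambda>i. s i z) \<longlonglongrightarrow> F z + Q z"
    using s(2) AE_space by eventually_elim (use eq in auto)
  then show ?thesis unfolding strongly_measurable_def using m s(1) by blast
qed

lemma trig_poly_uminus: "trig_poly Q \<Longrightarrow> trig_poly (\<lambda>z. - Q z)"
  using trig_poly_scaleC[OF trig_poly_const[of "-1"], of Q] by (simp add: scaleC.minus_left)

lemma trig_poly_strongly_measurable: "trig_poly Q \<Longrightarrow> strongly_measurable \<T> Q"
  using trig_poly_add_measurable[OF strongly_measurable_zero, of Q] by simp

lemma trig_poly_diff_measurable:
  assumes "strongly_measurable \<T> F" "trig_poly Q"
  shows "strongly_measurable \<T> (\<lambda>z. F z - Q z)"
  using trig_poly_add_measurable[OF assms(1) trig_poly_uminus[OF assms(2)]] by simp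

text \<open>The bounded functions that are \<open>L\<^sub>p\<close> limits of trigonometric polynomials. Boundedness makes this
  class an algebra: in \<open>g h - q r = (g - q) h + q (h - r)\<close> the polynomial q is chosen first, close
  enough to g for the bound on h, and then r close enough to h for the bound on q.\<close>
definition trig_closure :: "real \<Rightarrow> ((nat \<Rightarrow> complex) \<Rightarrow> complex) set" where
  "trig_closure p = {g. g \<in> borel_measurable \<T> \<and> (\<exists>K. \<forall>z\<in>space \<T>. cmod (g z) \<le> K) \<and>
     (\<forall>\<epsilon>>0. \<exists>q. trig_poly q \<and> LpN \<T> p (\<lambda>z. g z - q z) < ennreal \<epsilon>)}"

context
  fixes p :: real
  assumes p: "1 \<le> p"
begin

lemma trig_closureD:
  assumes "g \<in> trig_closure p"
  shows "g \<in> borel_measurable \<T>"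
    and "\<exists>K>0. \<forall>z\<in>space \<T>. cmod (g z) \<le> K"
    and "\<epsilon> > 0 \<Longrightarrow> \<exists>q. trig_poly q \<and> LpN \<T> p (\<lambda>z. g z - q z) < ennreal \<epsilon>"
proof -
  show "g \<in> borel_measurable \<T>" using assms by (simp add: trig_closure_def)
  obtain K where "\<forall>z\<in>space \<T>. cmod (g z) \<le> K" using assms by (auto simp: trig_closure_def)
  then have "\<forall>z\<in>space \<T>. cmod (g z) \<le> max K 1" by (auto intro: max.coboundedI1)
  then show "\<exists>K>0. \<forall>z\<in>space \<T>. cmod (g z) \<le> K" by (intro exI[of _ "max K 1"]) auto
  show "\<epsilon> > 0 \<Longrightarrow> \<exists>q. trig_poly q \<and> LpN \<T> p (\<lambda>z. g z - q z) < ennreal \<epsilon>"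
    using assms by (simp add: trig_closure_def)
qed

text \<open>The bound \<open>\<epsilon> / 2 / 2 powr p\<close> makes up for the two terms and for the constant \<open>2 powr p\<close> of the
  triangle inequality.\<close>
lemma LpN_two_term_less:
  fixes F :: "(nat \<Rightarrow> complex) \<Rightarrow> 'a::real_normed_vector" and G :: "(nat \<Rightarrow> complex) \<Rightarrow> 'b::real_normed_vector"
  assumes "(\<lambda>z. norm (F z)) \<in> borel_measurable M" "(\<lambda>z. norm (G z)) \<in> borel_measurable M"
    and \<epsilon>: "\<epsilon> > 0" "LpN M p F < ennreal (\<epsilon> / 2 / 2 powr p)" "LpN M p G < ennreal (\<epsilon> / 2 / 2 powr p)"
    and H: "\<And>z. z \<in> space M \<Longrightarrow> norm (H z) \<le> norm (F z) + norm (G z)"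
  shows "LpN M p H < ennreal \<epsilon>"
proof -
  have "LpN M p H \<le> ennreal (2 powr p) * (LpN M p F + LpN M p G)"
    using p by (intro LpN_add_le assms) auto
  also have "\<dots> < ennreal (2 powr p) * (ennreal (\<epsilon> / 2 / 2 powr p) + ennreal (\<epsilon> / 2 / 2 powr p))"
    using add_strict_mono[OF \<epsilon>(2,3)] by (intro ennreal_mult_strict_left_mono) auto
  also have "\<dots> = ennreal \<epsilon>"
    using \<epsilon>(1) by (subst ennreal_plus[symmetric]) (auto simp flip: ennreal_mult)
  finally show ?thesis .
qed

lemma LpN_cmult_less:
  assumes "(\<lambda>z. norm (F z)) \<in> borel_measurable M" and K: "K > 0" and \<epsilon>: "LpN M p F < ennreal (\<epsilon> / K powr p)"
    and H: "\<And>z. z \<in> space M \<Longrightarrow> norm (H z) \<le> K * norm (F z)"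
  shows "LpN M p H < ennreal \<epsilon>"
proof -
  have "LpN M p H \<le> (\<integral>\<^sup>+ z. ennreal (K powr p) * ennreal (norm (F z) powr p) \<partial>M)"
    unfolding LpN_def
  proof (rule nn_integral_mono)
    fix z assume "z \<in> space M"
    then have "norm (H z) powr p \<le> (K * norm (F z)) powr p" using H p by (intro powr_mono2) auto
    then show "ennreal (norm (H z) powr p) \<le> ennreal (K powr p) * ennreal (norm (F z) powr p)"
      by (simp add: powr_mult ennreal_leI flip: ennreal_mult)
  qed
  also have "\<dots> = ennreal (K powr p) * LpN M p F"
    unfolding LpN_def using assms(1) by (intro nn_integral_cmult) auto
  also have "\<dots> < ennreal (K powr p) * ennreal (\<epsilon> / K powr p)"
    using K \<epsilon> by (intro ennreal_mult_strict_left_mono) auto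
  also have "\<dots> = ennreal \<epsilon>" using K by (simp flip: ennreal_mult')
  finally show ?thesis .
qed

lemma trig_poly_closure:
  assumes "trig_poly q"
  shows "q \<in> trig_closure p"
proof -
  have "LpN \<T> p (\<lambda>z. q z - q z) = 0" using p by (simp add: LpN_def)
  then have "\<exists>r. trig_poly r \<and> LpN \<T> p (\<lambda>z. q z - r z) < ennreal \<epsilon>" if "\<epsilon> > 0" for \<epsilon>
    using that assms by (intro exI[of _ q]) auto
  moreover have "\<exists>K. \<forall>z\<in>space \<T>. cmod (q z) \<le> K" by (rule trig_poly_bounded[OF assms]) auto
  ultimately show ?thesis
    using strongly_measurable_borel[OF trig_poly_strongly_measurable[OF assms]] by (auto simp: trig_closure_def)
qed

lemma trig_closure_norm_diff:
  assumes "g \<in> trig_closure p" "trig_poly q"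
  shows "(\<lambda>z. cmod (g z - q z)) \<in> borel_measurable \<T>"
  using trig_closureD(1)[OF assms(1)] strongly_measurable_borel[OF trig_poly_strongly_measurable[OF assms(2)]]
  by measurable

lemma trig_closure_add:
  assumes g: "g \<in> trig_closure p" and h: "h \<in> trig_closure p"
  shows "(\<lambda>z. g z + h z) \<in> trig_closure p"
  unfolding trig_closure_def mem_Collect_eq
proof (intro conjI allI impI)
  show "(\<lambda>z. g z + h z) \<in> borel_measurable \<T>"
    using trig_closureD(1)[OF g] trig_closureD(1)[OF h] by measurable
  obtain K L where "\<forall>z\<in>space \<T>. cmod (g z) \<le> K" "\<forall>z\<in>space \<T>. cmod (h z) \<le> L"
    using trig_closureD(2)[OF g] trig_closureD(2)[OF h] by blast
  then show "\<exists>K. \<forall>z\<in>space \<T>. cmod (g z + h z) \<le> K"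
    by (intro exI[of _ "K + L"]) (auto intro: norm_triangle_mono)
  fix \<epsilon> :: real assume \<epsilon>: "\<epsilon> > 0"
  then have e': "\<epsilon> / 2 / 2 powr p > 0" by simp
  obtain q r where q: "trig_poly q" "LpN \<T> p (\<lambda>z. g z - q z) < ennreal (\<epsilon> / 2 / 2 powr p)"
    and r: "trig_poly r" "LpN \<T> p (\<lambda>z. h z - r z) < ennreal (\<epsilon> / 2 / 2 powr p)"
    using trig_closureD(3)[OF g e'] trig_closureD(3)[OF h e'] by blast
  have "LpN \<T> p (\<lambda>z. (g z + h z) - (q z + r z)) < ennreal \<epsilon>"
    by (rule LpN_two_term_less[OF trig_closure_norm_diff[OF g q(1)] trig_closure_norm_diff[OF h r(1)] \<epsilon> q(2) r(2)])
       (rule norm_diff_triangle_ineq)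
  then show "\<exists>q. trig_poly q \<and> LpN \<T> p (\<lambda>z. g z + h z - q z) < ennreal \<epsilon>"
    using trig_poly_add[OF q(1) r(1)] by blast
qed

lemma trig_closure_mult:
  assumes g: "g \<in> trig_closure p" and h: "h \<in> trig_closure p"
  shows "(\<lambda>z. g z * h z) \<in> trig_closure p"
  unfolding trig_closure_def mem_Collect_eq
proof (intro conjI allI impI)
  show "(\<lambda>z. g z * h z) \<in> borel_measurable \<T>"
    using trig_closureD(1)[OF g] trig_closureD(1)[OF h] by measurable
  obtain K L where K: "K > 0" "\<forall>z\<in>space \<T>. cmod (g z) \<le> K" and L: "L > 0" "\<forall>z\<in>space \<T>. cmod (h z) \<le> L"
    using trig_closureD(2)[OF g] trig_closureD(2)[OF h] by blast
  then show "\<exists>K. \<forall>z\<in>space \<T>. cmod (g z * h z) \<le> K"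
    by (intro exI[of _ "K * L"]) (auto simp: norm_mult intro!: mult_mono)
  fix \<epsilon> :: real assume \<epsilon>: "\<epsilon> > 0"
  define e where "e = \<epsilon> / 2 / 2 powr p"
  have e: "e > 0" using \<epsilon> by (simp add: e_def)
  have "e / L powr p > 0" using e L by simp
  from trig_closureD(3)[OF g this] obtain q where q: "trig_poly q"
    "LpN \<T> p (\<lambda>z. g z - q z) < ennreal (e / L powr p)"
    by blast
  obtain Q where Q0: "0 \<le> Q" "\<And>z. z \<in> space \<T> \<Longrightarrow> cmod (q z) \<le> Q"
    by (rule trig_poly_bounded[OF q(1)]) (rule that)
  \<comment> \<open>a positive bound, to be divided by\<close>
  define Q' where "Q' = Q + 1"
  have Q: "Q' > 0" "\<And>z. z \<in> space \<T> \<Longrightarrow> cmod (q z) \<le> Q'" using Q0 by (force simp: Q'_def)+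
  have "e / Q' powr p > 0" using e Q by simp
  from trig_closureD(3)[OF h this] obtain r where r: "trig_poly r"
    "LpN \<T> p (\<lambda>z. h z - r z) < ennreal (e / Q' powr p)"
    by blast
  note m1 = trig_closure_norm_diff[OF g q(1)] and m2 = trig_closure_norm_diff[OF h r(1)]
  have 1: "LpN \<T> p (\<lambda>z. (g z - q z) * h z) < ennreal e"
    using L(2) by (intro LpN_cmult_less[OF m1 L(1) q(2)]) (auto simp: norm_mult mult.commute intro!: mult_right_mono)
  have 2: "LpN \<T> p (\<lambda>z. q z * (h z - r z)) < ennreal e"
    using Q(2) by (intro LpN_cmult_less[OF m2 Q(1) r(2)]) (auto simp: norm_mult intro!: mult_right_mono)
  have "LpN \<T> p (\<lambda>z. g z * h z - q z * r z) < ennreal \<epsilon>"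
  proof (rule LpN_two_term_less[OF _ _ \<epsilon> 1[unfolded e_def] 2[unfolded e_def]])
    show "cmod (g z * h z - q z * r z) \<le> cmod ((g z - q z) * h z) + cmod (q z * (h z - r z))" for z
      using norm_triangle_ineq[of "(g z - q z) * h z" "q z * (h z - r z)"] by (simp add: algebra_simps)
    show "(\<lambda>z. cmod ((g z - q z) * h z)) \<in> borel_measurable \<T>"
      unfolding norm_mult using m1 trig_closureD(1)[OF h] by measurable
    show "(\<lambda>z. cmod (q z * (h z - r z))) \<in> borel_measurable \<T>"
      unfolding norm_mult using m2 trig_closureD(1)[OF trig_poly_closure[OF q(1)]] by measurable
  qed
  then show "\<exists>q. trig_poly q \<and> LpN \<T> p (\<lambda>z. g z * h z - q z) < ennreal \<epsilon>"
    using trig_poly_mult[OF q(1) r(1)] by blast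
qed

lemma trig_closure_limit:
  assumes g: "\<And>n. g n \<in> trig_closure p" and K: "\<And>n z. z \<in> space \<T> \<Longrightarrow> cmod (g n z) \<le> K"
    and lim: "\<And>z. z \<in> space \<T> \<Longrightarrow> (\<lambda>n. g n z) \<longlonglongrightarrow> f z"
  shows "f \<in> trig_closure p"
  unfolding trig_closure_def mem_Collect_eq
proof (intro conjI allI impI)
  note [measurable] = trig_closureD(1)[OF g]
  show fm [measurable]: "f \<in> borel_measurable \<T>"
    by (rule borel_measurable_LIMSEQ_metric[OF trig_closureD(1)[OF g] lim])
  have fK: "cmod (f z) \<le> K" if "z \<in> space \<T>" for z
    using that by (intro LIMSEQ_le_const2[OF tendsto_norm[OF lim[OF that]]]) (auto intro: K)
  then show "\<exists>K. \<forall>z\<in>space \<T>. cmod (f z) \<le> K" by blast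
  fix \<epsilon> :: real assume \<epsilon>: "\<epsilon> > 0"
  then have e': "\<epsilon> / 2 / 2 powr p > 0" by simp
  have "(\<lambda>n. LpN \<T> p (\<lambda>z. f z - g n z)) \<longlonglongrightarrow> 0"
  proof (rule LpN_dominated_convergence[where w = "\<lambda>_. 2 * K"])
    show "cmod (f z - g n z) \<le> 2 * K" if "z \<in> space \<T>" for n z
      using norm_triangle_ineq4[of "f z" "g n z"] fK[OF that] K[OF that, of n] by linarith
    show "AE z in \<T>. (\<lambda>n. f z - g n z) \<longlonglongrightarrow> 0"
    proof (rule AE_I2)
      fix z assume "z \<in> space \<T>"
      from tendsto_diff[OF tendsto_const lim[OF this], of "f z"]
      show "(\<lambda>n. f z - g n z) \<longlonglongrightarrow> 0" by simp
    qed
  qed (use p in \<open>auto simp: torus.emeasure_space_1\<close>)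
  then have "\<forall>\<^sub>F n in sequentially. LpN \<T> p (\<lambda>z. f z - g n z) < ennreal (\<epsilon> / 2 / 2 powr p)"
    using e' by (intro order_tendstoD) auto
  then obtain n where n: "LpN \<T> p (\<lambda>z. f z - g n z) < ennreal (\<epsilon> / 2 / 2 powr p)"
    by (auto simp: eventually_sequentially)
  obtain q where q: "trig_poly q" "LpN \<T> p (\<lambda>z. g n z - q z) < ennreal (\<epsilon> / 2 / 2 powr p)"
    using trig_closureD(3)[OF g e'] by blast
  have "LpN \<T> p (\<lambda>z. f z - q z) < ennreal \<epsilon>"
  proof (rule LpN_two_term_less[OF _ trig_closure_norm_diff[OF g q(1)] \<epsilon> n q(2)])
    show "cmod (f z - q z) \<le> cmod (f z - g n z) + cmod (g n z - q z)" for z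
      using norm_triangle_ineq[of "f z - g n z" "g n z - q z"] by simp
  qed measurable
  then show "\<exists>q. trig_poly q \<and> LpN \<T> p (\<lambda>z. f z - q z) < ennreal \<epsilon>" using q(1) by blast
qed

end

context
  fixes p :: real
  assumes p: "1 \<le> p"
begin

text \<open>By the Weierstrass theorem, as the class is an algebra that is closed under bounded limits.\<close>
lemma trig_closure_cont_compose:
  fixes x :: "(nat \<Rightarrow> complex) \<Rightarrow> real" and f :: "real \<Rightarrow> real"
  assumes x: "(\<lambda>z. complex_of_real (x z)) \<in> trig_closure p"
    and x1: "\<And>z. z \<in> space \<T> \<Longrightarrow> x z \<in> {-1..1}"
    and f: "continuous_on {-1..1} f"
  shows "(\<lambda>z. complex_of_real (f (x z))) \<in> trig_closure p"
proof -
  have poly: "(\<lambda>z. complex_of_real (g (x z))) \<in> trig_closure p" if "real_polynomial_function g" for g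
    using that
  proof (induction rule: real_polynomial_function.induct)
    case (linear g)
    have "g t = t * g 1" for t
      using linear_scale[OF bounded_linear.linear[OF linear], of t 1] by simp
    then have eq: "complex_of_real (g (x z)) = complex_of_real (x z) * complex_of_real (g 1)" for z
      by (metis of_real_mult)
    show ?case unfolding eq
      by (rule trig_closure_mult[OF p x trig_poly_closure[OF p trig_poly_const]])
  next
    case (const c)
    show ?case by (rule trig_poly_closure[OF p trig_poly_const])
  next
    case (add f g)
    show ?case using trig_closure_add[OF p add.IH] by simp
  next
    case (mult f g)
    show ?case using trig_closure_mult[OF p mult.IH] by simp
  qed
  have "\<exists>g. real_polynomial_function g \<and> (\<forall>t\<in>{-1..1}. \<bar>f t - g t\<bar> < 1 / real (Suc n))" for n
    by (rule Stone_Weierstrass_real_polynomial_function[OF compact_Icc f, of "1 / real (Suc n)"]) auto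
  then obtain g where g: "\<And>n. real_polynomial_function (g n)"
    "\<And>n t. t \<in> {-1..1} \<Longrightarrow> \<bar>f t - g n t\<bar> < 1 / real (Suc n)"
    by metis
  have "bounded (f ` {-1..1})" by (rule compact_imp_bounded[OF compact_continuous_image[OF f compact_Icc]])
  then have "\<exists>K. \<forall>t\<in>{-1..1}. \<bar>f t\<bar> \<le> K" by (auto simp: bounded_iff)
  then obtain K where K: "\<And>t. t \<in> {-1..1} \<Longrightarrow> \<bar>f t\<bar> \<le> K" by blast
  show ?thesis
  proof (rule trig_closure_limit[OF p poly[OF g(1)]])
    fix n z assume z: "z \<in> space \<T>"
    have "1 / real (Suc n) \<le> 1" by simp
    then have "\<bar>g n (x z)\<bar> \<le> K + 1"
      using g(2)[OF x1[OF z], of n] K[OF x1[OF z]] by linarith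
    then show "cmod (complex_of_real (g n (x z))) \<le> K + 1" by simp
  next
    fix z assume z: "z \<in> space \<T>"
    have "(\<lambda>n. g n (x z)) \<longlonglongrightarrow> f (x z)"
    proof (rule LIMSEQ_I)
      fix r :: real assume "0 < r"
      then obtain N where N: "1 / real (Suc N) < r" using nat_approx_posE by blast
      show "\<exists>N. \<forall>n\<ge>N. norm (g n (x z) - f (x z)) < r"
      proof (intro exI allI impI)
        fix n assume "n \<ge> N"
        then have "1 / real (Suc n) \<le> 1 / real (Suc N)" by (intro frac_le) auto
        then show "norm (g n (x z) - f (x z)) < r" using g(2)[OF x1[OF z], of n] N by simp
      qed
    qed
    then show "(\<lambda>n. complex_of_real (g n (x z))) \<longlonglongrightarrow> complex_of_real (f (x z))" by (rule tendsto_of_real)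
  qed
qed

text \<open>The indicator is the pointwise limit of continuous functions of x that fall linearly from 1 to 0
  on \<open>[a, a + 1 / n]\<close>.\<close>
lemma trig_closure_indicator_le:
  fixes x :: "(nat \<Rightarrow> complex) \<Rightarrow> real"
  assumes x: "(\<lambda>z. complex_of_real (x z)) \<in> trig_closure p"
    and x1: "\<And>z. z \<in> space \<T> \<Longrightarrow> x z \<in> {-1..1}"
  shows "(\<lambda>z. indicator {z \<in> space \<T>. x z \<le> a} z) \<in> trig_closure p"
proof (rule trig_closure_limit[OF p])
  define f where "f n t = min 1 (max 0 (1 - real n * (t - a)))" for n and t :: real
  show "(\<lambda>z. complex_of_real (f n (x z))) \<in> trig_closure p" for n
  proof (rule trig_closure_cont_compose[OF x x1])
    show "continuous_on {-1..1} (f n)" unfolding f_def by (intro continuous_intros)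
  qed
  show "cmod (complex_of_real (f n (x z))) \<le> 1" for n z by (simp add: f_def)
  fix z assume z: "z \<in> space \<T>"
  have "(\<lambda>n. f n (x z)) \<longlonglongrightarrow> (if x z \<le> a then 1 else 0)"
  proof (cases "x z \<le> a")
    case True
    then have "f n (x z) = 1" for n using mult_nonneg_nonpos[of "real n" "x z - a"]
      by (auto simp: f_def min_def max_def)
    then show ?thesis using True by simp
  next
    case False
    obtain N where N: "1 / (x z - a) < real N" using reals_Archimedean2 by blast
    have "f n (x z) = 0" if "n \<ge> N" for n
    proof -
      have "1 / (x z - a) < real n" using N that by linarith
      then have "1 < real n * (x z - a)" using False by (simp add: field_simps)
      then show ?thesis by (simp add: f_def)
    qed
    then have "\<forall>\<^sub>F n in sequentially. f n (x z) = 0" by (auto simp: eventually_sequentially)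
    then show ?thesis using False by (simp add: tendsto_eventually)
  qed
  then have "(\<lambda>n. complex_of_real (f n (x z))) \<longlonglongrightarrow> complex_of_real (if x z \<le> a then 1 else 0)"
    by (rule tendsto_of_real)
  then show "(\<lambda>n. complex_of_real (f n (x z))) \<longlonglongrightarrow> indicator {z \<in> space \<T>. x z \<le> a} z"
    using z by (cases "x z \<le> a") auto
qed

lemma trig_closure_coordinate:
  "(\<lambda>z. complex_of_real (Re (z j))) \<in> trig_closure p" "(\<lambda>z. complex_of_real (Im (z j))) \<in> trig_closure p"
proof -
  let ?e = "\<lambda>i. if i = j then 1 else (0 :: int)"
  have e: "?e \<in> eventually_null" "(\<lambda>i. - ?e i) \<in> eventually_null" by (simp_all add: eventually_null_def)
  have m: "monomial ?e z = z j" for z by (simp add: monomial_def)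
  have T: "trig_poly (\<lambda>z. monomial ?e z *\<^sub>C a + monomial (\<lambda>i. - ?e i) z *\<^sub>C b)" for a b :: complex
    by (intro trig_poly_add trig_poly_monomial e)
  have "trig_poly (\<lambda>z. complex_of_real (Re (z j)))"
  proof (rule trig_poly_cong[OF T[of "1/2" "1/2"]])
    fix z assume "z \<in> space \<T>"
    then show "monomial ?e z *\<^sub>C (1/2) + monomial (\<lambda>i. - ?e i) z *\<^sub>C (1/2) = complex_of_real (Re (z j))"
      unfolding monomial_minus[OF \<open>z \<in> space \<T>\<close>] m by (simp add: scaleC_complex_def complex_eq_iff)
  qed
  then show "(\<lambda>z. complex_of_real (Re (z j))) \<in> trig_closure p" by (rule trig_poly_closure[OF p])
  have "trig_poly (\<lambda>z. complex_of_real (Im (z j)))"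
  proof (rule trig_poly_cong[OF T[of "- \<i>/2" "\<i>/2"]])
    fix z assume "z \<in> space \<T>"
    then show "monomial ?e z *\<^sub>C (- \<i>/2) + monomial (\<lambda>i. - ?e i) z *\<^sub>C (\<i>/2) = complex_of_real (Im (z j))"
      unfolding monomial_minus[OF \<open>z \<in> space \<T>\<close>] m by (simp add: scaleC_complex_def complex_eq_iff)
  qed
  then show "(\<lambda>z. complex_of_real (Im (z j))) \<in> trig_closure p" by (rule trig_poly_closure[OF p])
qed

definition approximable :: "(nat \<Rightarrow> complex) set set" where
  "approximable = {A. A \<subseteq> space \<T> \<and> (\<lambda>z. indicator A z) \<in> trig_closure p}"

lemma sigma_algebra_approximable: "sigma_algebra (space \<T>) approximable"
  unfolding sigma_algebra_iff2
proof (intro conjI ballI allI impI)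
  have one: "(\<lambda>z. 1) \<in> trig_closure p" by (rule trig_poly_closure[OF p trig_poly_const])
  have minus: "(\<lambda>z. - g z) \<in> trig_closure p" if "g \<in> trig_closure p" for g
    using trig_closure_mult[OF p trig_poly_closure[OF p trig_poly_const[of "-1"]] that] by simp
  have compl: "(\<lambda>z. 1 - g z) \<in> trig_closure p" if "g \<in> trig_closure p" for g
    using trig_closure_add[OF p one minus[OF that]] by simp
  have eqI: "g \<in> trig_closure p" if f: "f \<in> trig_closure p" and eq: "\<And>z. z \<in> space \<T> \<Longrightarrow> f z = g z" for f g
  proof -
    obtain K where K: "\<forall>z\<in>space \<T>. cmod (f z) \<le> K" using trig_closureD(2)[OF p f] by blast
    show ?thesis by (rule trig_closure_limit[OF p f, of K]) (use K eq in auto)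
  qed
  show "approximable \<subseteq> Pow (space \<T>)" by (auto simp: approximable_def)
  have "(indicator {} :: (nat \<Rightarrow> complex) \<Rightarrow> complex) = (\<lambda>z. 0)" by (simp add: fun_eq_iff)
  then show "{} \<in> approximable" using trig_poly_closure[OF p trig_poly_const[of 0]]
    by (simp add: approximable_def)
  show "space \<T> - A \<in> approximable" if "A \<in> approximable" for A
  proof -
    have "(\<lambda>z. 1 - indicator A z) \<in> trig_closure p" using that by (intro compl) (simp add: approximable_def)
    then have "(\<lambda>z. indicator (space \<T> - A) z) \<in> trig_closure p"
      by (rule eqI) (auto split: split_indicator)
    then show ?thesis by (simp add: approximable_def)
  qed
  show "(\<Union>i::nat. A i) \<in> approximable" if "range A \<subseteq> approximable" for A
  proof -
    have A: "(\<lambda>z. indicator (A i) z) \<in> trig_closure p" "A i \<subseteq> space \<T>" for i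
      using that by (auto simp: approximable_def)
    have prod: "(\<lambda>z. \<Prod>i<n. 1 - indicator (A i) z) \<in> trig_closure p" for n
    proof (induction n)
      case (Suc n)
      show ?case using trig_closure_mult[OF p Suc compl[OF A(1)[of n]]] by simp
    qed (simp add: one)
    have bnd: "cmod (1 - (\<Prod>i<n. 1 - indicator (A i) z)) \<le> 1" for n z
    proof -
      have *: "cmod (1 - x) \<le> 1" if "x \<in> {0, 1}" for x
        using that by auto
      have "(\<Prod>i<n. 1 - indicator (A i) z :: complex) \<in> {0, 1}"
        by (induction n) (auto split: split_indicator)
      then show ?thesis by (rule *)
    qed
    have "(\<lambda>z. indicator (\<Union>i. A i) z) \<in> trig_closure p"
    proof (rule trig_closure_limit[OF p compl[OF prod] bnd])
      fix z
      show "(\<lambda>n. 1 - (\<Prod>i<n. 1 - indicator (A i) z)) \<longlonglongrightarrow> (indicator (\<Union>i. A i) z :: complex)"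
      proof (cases "z \<in> (\<Union>i. A i)")
        case True
        then obtain i where i: "z \<in> A i" by auto
        have "1 - (\<Prod>i<n. 1 - indicator (A i) z) = (1 :: complex)" if "n > i" for n
        proof -
          have "(\<Prod>i<n. 1 - indicator (A i) z :: complex) = 0"
            by (rule prod_zero) (use i that in \<open>auto intro!: bexI[of _ i]\<close>)
          then show ?thesis by simp
        qed
        then have ev: "\<forall>\<^sub>F n in sequentially. 1 - (\<Prod>i<n. 1 - indicator (A i) z) = (1 :: complex)"
          by (rule eventually_mono[OF eventually_gt_at_top[of i]])
        have "indicator (\<Union>i. A i) z = (1 :: complex)" using True by simp
        then show ?thesis by (simp only:) (rule tendsto_eventually[OF ev])
      next
        case False
        then have "indicator (A i) z = (0 :: complex)" for i by auto
        then show ?thesis using False by simp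
      qed
    qed
    then show ?thesis using A(2) by (auto simp: approximable_def)
  qed
qed

text \<open>With respect to the \<sigma>-algebra of approximable sets all coordinates are measurable, because this
  holds for their real and imaginary parts. The product \<sigma>-algebra is the smallest one with this
  property.\<close>
lemma sets_torus_approximable: "sets \<T> \<subseteq> approximable"
proof -
  interpret sigma_algebra "space \<T>" approximable by (rule sigma_algebra_approximable)
  define M where "M = sigma (space \<T>) approximable"
  have M: "sets M = approximable" "space M = space \<T>"
    unfolding M_def using space_closed by (auto simp: sets_measure_of_eq)
  have meas: "(\<lambda>z. x z) \<in> borel_measurable M"
    if x: "(\<lambda>z. complex_of_real (x z)) \<in> trig_closure p" "\<And>z. z \<in> space \<T> \<Longrightarrow> x z \<in> {-1..1}" for x
  proof (rule borel_measurable_iff_le[THEN iffD2], rule allI)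
    fix a
    show "{w \<in> space M. x w \<le> a} \<in> sets M"
      using trig_closure_indicator_le[OF x] by (auto simp: M approximable_def)
  qed
  have comp: "Re (z j) \<in> {-1..1}" "Im (z j) \<in> {-1..1}" if "z \<in> space \<T>" for z j
    using that abs_Re_le_cmod[of "z j"] abs_Im_le_cmod[of "z j"] by (auto simp: space_torus abs_le_iff)
  have "(\<lambda>z. Re (z j)) \<in> borel_measurable M" for j
    by (rule meas[OF trig_closure_coordinate(1)]) (rule comp(1))
  moreover have "(\<lambda>z. Im (z j)) \<in> borel_measurable M" for j
    by (rule meas[OF trig_closure_coordinate(2)]) (rule comp(2))
  ultimately have "(\<lambda>z. z j) \<in> borel_measurable M" for j
    by (subst borel_measurable_complex_iff) simp
  then have "(\<lambda>z. z j) \<in> M \<rightarrow>\<^sub>M \<S>" for j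
    unfolding measurable_cong_sets[OF refl sets_circle]
    by (intro measurable_restrict_space2) (auto simp: M space_torus)
  then have "(\<lambda>z j. z j) \<in> M \<rightarrow>\<^sub>M PiM UNIV (\<lambda>_. \<S>)"
    by (intro measurable_PiM_single') (auto simp: M space_torus)
  then have id: "(\<lambda>z. z) \<in> M \<rightarrow>\<^sub>M \<T>" by (simp add: torus_measure_def)
  show ?thesis
  proof
    fix A assume A: "A \<in> sets \<T>"
    have "(\<lambda>z. z) -` A \<inter> space M \<in> sets M" by (rule measurable_sets[OF id A])
    moreover have "(\<lambda>z. z) -` A \<inter> space M = A" using sets.sets_into_space[OF A] by (auto simp: M)
    ultimately show "A \<in> approximable" by (simp add: M)
  qed
qed

lemma trig_poly_dense_simple:
  fixes y :: "'i \<Rightarrow> 'a::complex_banach"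
  assumes "finite I" "\<And>i. i \<in> I \<Longrightarrow> g i \<in> trig_closure p" "\<epsilon> > 0"
  shows "\<exists>Q. trig_poly Q \<and> LpN \<T> p (\<lambda>z. (\<Sum>i\<in>I. g i z *\<^sub>C y i) - Q z) < ennreal \<epsilon>"
  using assms
proof (induction I arbitrary: \<epsilon> rule: finite_induct)
  case empty
  have "LpN \<T> p (\<lambda>z. 0 - 0 :: 'a) = 0" using p by (simp add: LpN_def)
  then show ?case using empty by (intro exI[of _ "\<lambda>_. 0"]) (auto simp: trig_poly_zero)
next
  case (insert i I)
  define e where "e = \<epsilon> / 2 / 2 powr p"
  have e: "e > 0" using insert.prems by (simp add: e_def)
  obtain Q :: "_ \<Rightarrow> 'a" where Q: "trig_poly Q" "LpN \<T> p (\<lambda>z. (\<Sum>i\<in>I. g i z *\<^sub>C y i) - Q z) < ennreal e"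
    using insert.IH[OF _ e] insert.prems(1) by blast
  define K where "K = norm (y i) + 1"
  have K: "K > 0" "norm (y i) \<le> K" by (auto simp: K_def add_nonneg_pos)
  have gi: "g i \<in> trig_closure p" using insert.prems(1) by simp
  have "e / K powr p > 0" using e K by simp
  from trig_closureD(3)[OF p gi this] obtain q where q: "trig_poly q"
    "LpN \<T> p (\<lambda>z. g i z - q z) < ennreal (e / K powr p)" by blast
  note m = trig_closure_norm_diff[OF p gi q(1)]
  have 1: "LpN \<T> p (\<lambda>z. (g i z - q z) *\<^sub>C y i) < ennreal e"
    by (rule LpN_cmult_less[OF p m K(1) q(2)]) (use K in \<open>auto simp: norm_scaleC mult.commute intro!: mult_right_mono\<close>)
  have 1: "LpN \<T> p (\<lambda>z. g i z *\<^sub>C y i - q z *\<^sub>C y i) < ennreal e"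
    using 1 by (simp add: scaleC.diff_left)
  have gm: "g j \<in> borel_measurable \<T>" if "j \<in> insert i I" for j
    using trig_closureD(1)[OF p] insert.prems(1) that by blast
  have sm: "strongly_measurable \<T> (\<lambda>z. \<Sum>i\<in>I. g i z *\<^sub>C y i)"
    using insert.hyps gm by (intro strongly_measurable_sum_scaleC) auto
  have smi: "strongly_measurable \<T> (\<lambda>z. g i z *\<^sub>C y i)"
    using strongly_measurable_add_scaleC[OF strongly_measurable_zero gm[of i], of "y i"] by simp
  have qt: "trig_poly (\<lambda>z. q z *\<^sub>C y i)" by (rule trig_poly_scaleC[OF q(1) trig_poly_const])
  have "LpN \<T> p (\<lambda>z. (\<Sum>i\<in>insert i I. g i z *\<^sub>C y i) - (q z *\<^sub>C y i + Q z)) < ennreal \<epsilon>"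
  proof (rule LpN_two_term_less[OF p _ _ _ 1[unfolded e_def] Q(2)[unfolded e_def]])
    show "norm ((\<Sum>i\<in>insert i I. g i z *\<^sub>C y i) - (q z *\<^sub>C y i + Q z))
        \<le> norm (g i z *\<^sub>C y i - q z *\<^sub>C y i) + norm ((\<Sum>i\<in>I. g i z *\<^sub>C y i) - Q z)" for z
      using insert.hyps norm_diff_triangle_ineq by simp
  qed (use insert.prems strongly_measurable_norm[OF trig_poly_diff_measurable[OF smi qt]]
        strongly_measurable_norm[OF trig_poly_diff_measurable[OF sm Q(1)]] in auto)
  then show ?case using trig_poly_add[OF qt Q(1)] by blast
qed

text \<open>A simple function close to F is a combination of vectors with indicators as coefficients, and the
  indicators are limits of scalar trigonometric polynomials.\<close>
theorem trig_poly_dense: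
  fixes F :: "(nat \<Rightarrow> complex) \<Rightarrow> 'a::complex_banach"
  assumes F: "strongly_measurable \<T> F" and fin: "LpN \<T> p F < \<infinity>" and \<epsilon>: "\<epsilon> > 0"
  obtains Q where "trig_poly Q" "LpN \<T> p (\<lambda>z. F z - Q z) < ennreal \<epsilon>"
proof -
  define e where "e = \<epsilon> / 2 / 2 powr p"
  have e: "e > 0" using \<epsilon> by (simp add: e_def)
  have p0: "p > 0" using p by simp
  obtain s where s: "\<And>i::nat. simple_function \<T> (s i)" "(\<lambda>i. LpN \<T> p (\<lambda>z. F z - s i z)) \<longlonglongrightarrow> 0"
    by (rule LpN_simple_approx[OF F p0 fin]) (rule that)
  have "\<forall>\<^sub>F i in sequentially. LpN \<T> p (\<lambda>z. F z - s i z) < ennreal e"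
    using e by (intro order_tendstoD[OF s(2)]) auto
  then obtain i where i: "LpN \<T> p (\<lambda>z. F z - s i z) < ennreal e"
    by (auto simp: eventually_sequentially)
  define Y where "Y = s i ` space \<T>"
  define g where "g y = (indicator (s i -` {y} \<inter> space \<T>) :: _ \<Rightarrow> complex)" for y
  have Y: "finite Y" using s(1)[of i] by (simp add: simple_function_def Y_def)
  have g: "g y \<in> trig_closure p" for y
  proof -
    have "s i -` {y} \<inter> space \<T> \<in> sets \<T>" using simple_functionD(2)[OF s(1)] by blast
    then show ?thesis using sets_torus_approximable by (auto simp: g_def approximable_def)
  qed
  have si: "s i z = (\<Sum>y\<in>Y. g y z *\<^sub>C y)" if z: "z \<in> space \<T>" for z
  proof -
    have "(\<Sum>y\<in>Y. g y z *\<^sub>C y) = (\<Sum>y\<in>Y. if y = s i z then y else 0)"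
      using z by (intro sum.cong) (auto simp: g_def scaleC.zero_left split: split_indicator)
    also have "\<dots> = s i z" using Y z by (simp add: Y_def)
    finally show ?thesis ..
  qed
  have "\<exists>Q. trig_poly Q \<and> LpN \<T> p (\<lambda>z. (\<Sum>y\<in>Y. g y z *\<^sub>C y) - Q z) < ennreal e"
    by (rule trig_poly_dense_simple[OF Y g e])
  then obtain Q :: "(nat \<Rightarrow> complex) \<Rightarrow> 'a" where Q: "trig_poly Q"
    "LpN \<T> p (\<lambda>z. (\<Sum>y\<in>Y. g y z *\<^sub>C y) - Q z) < ennreal e"
    by (elim exE conjE)
  have gm: "g y \<in> borel_measurable \<T>" for y using trig_closureD(1)[OF p g] .
  have sm: "strongly_measurable \<T> (\<lambda>z. \<Sum>y\<in>Y. g y z *\<^sub>C y)"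
    using Y gm by (intro strongly_measurable_sum_scaleC) auto
  have "LpN \<T> p (\<lambda>z. F z - Q z) < ennreal \<epsilon>"
  proof (rule LpN_two_term_less[OF p _ _ \<epsilon> i[unfolded e_def] Q(2)[unfolded e_def]])
    show "norm (F z - Q z) \<le> norm (F z - s i z) + norm ((\<Sum>y\<in>Y. g y z *\<^sub>C y) - Q z)" if "z \<in> space \<T>" for z
      using norm_triangle_ineq[of "F z - s i z" "s i z - Q z"] si[OF that] by simp
    show "(\<lambda>z. norm (F z - s i z)) \<in> borel_measurable \<T>"
      by (intro borel_measurable_norm_nonseparable borel_measurable_diff_simple strongly_measurable_borel F s)
  qed (rule strongly_measurable_norm[OF trig_poly_diff_measurable[OF sm Q(1)]])
  then show ?thesis using that Q(1) by blast
qed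

end

section \<open>Convergence of Fejer means\<close>

lemma has_bochner_int_cong:
  assumes "\<And>z. z \<in> space M \<Longrightarrow> F z = G z"
  shows "has_bochner_int M F x \<longleftrightarrow> has_bochner_int M G x"
proof -
  have "(\<integral>\<^sup>+ z. ennreal (norm (F z - s z)) \<partial>M) = (\<integral>\<^sup>+ z. ennreal (norm (G z - s z)) \<partial>M)" for s
    by (rule nn_integral_cong) (simp add: assms)
  moreover have "F \<in> borel_measurable M \<longleftrightarrow> G \<in> borel_measurable M"
    by (rule measurable_cong) (rule assms)
  ultimately show ?thesis unfolding has_bochner_int_def by simp
qed

lemma fourier_coeff_trig_poly:
  fixes c :: "_ \<Rightarrow> 'a::complex_banach"
  assumes B: "finite B" "B \<subseteq> eventually_null" and \<nu>: "\<nu> \<in> eventually_null"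
    and Q: "\<And>z. z \<in> space \<T> \<Longrightarrow> Q z = (\<Sum>\<alpha>\<in>B. monomial \<alpha> z *\<^sub>C c \<alpha>)"
  shows "fourier_coeff Q \<nu> = (if \<nu> \<in> B then c \<nu> else 0)"
proof -
  have mm: "monomial (\<lambda>j. - \<nu> j) z * monomial \<alpha> z = monomial (\<lambda>j. - \<nu> j + \<alpha> j) z"
    if "z \<in> space \<T>" "\<alpha> \<in> B" for z \<alpha>
    using monomial_add[OF eventually_null_minus[OF \<nu>], of \<alpha> z] that B by auto
  have "has_bochner_int \<T> (\<lambda>z. \<Sum>\<alpha>\<in>B. monomial (\<lambda>j. - \<nu> j + \<alpha> j) z *\<^sub>C c \<alpha>)
     (\<Sum>\<alpha>\<in>B. (\<integral>z. monomial (\<lambda>j. - \<nu> j + \<alpha> j) z \<partial>\<T>) *\<^sub>C c \<alpha>)"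
    by (rule has_bochner_int_sum_scaleC_const[OF B(1) integrable_monomial])
  also have "(\<Sum>\<alpha>\<in>B. (\<integral>z. monomial (\<lambda>j. - \<nu> j + \<alpha> j) z \<partial>\<T>) *\<^sub>C c \<alpha>) = (\<Sum>\<alpha>\<in>B. if \<alpha> = \<nu> then c \<alpha> else 0)"
  proof (rule sum.cong[OF refl])
    fix \<alpha> assume "\<alpha> \<in> B"
    then have "(\<lambda>j. - \<nu> j + \<alpha> j) \<in> eventually_null" using B \<nu>
      by (intro eventually_null_add eventually_null_minus) auto
    moreover have "(\<lambda>j. - \<nu> j + \<alpha> j) = (\<lambda>_. 0) \<longleftrightarrow> \<alpha> = \<nu>" by (auto simp: fun_eq_iff)
    ultimately show "(\<integral>z. monomial (\<lambda>j. - \<nu> j + \<alpha> j) z \<partial>\<T>) *\<^sub>C c \<alpha> = (if \<alpha> = \<nu> then c \<alpha> else 0)"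
      by (simp add: integral_monomial scaleC.zero_left)
  qed
  also have "\<dots> = (if \<nu> \<in> B then c \<nu> else 0)" using B(1) by simp
  finally have "has_bochner_int \<T> (\<lambda>z. monomial (\<lambda>j. - \<nu> j) z *\<^sub>C Q z) (if \<nu> \<in> B then c \<nu> else 0)"
    by (subst has_bochner_int_cong) (auto simp: Q scaleC.sum_right scaleC_scaleC mm)
  then show ?thesis unfolding fourier_coeff_def by (rule bochner_int_eqI)
qed

lemma fourier_coeff_add_trig_poly:
  fixes F :: "(nat \<Rightarrow> complex) \<Rightarrow> 'a::complex_banach"
  assumes F: "strongly_measurable \<T> F" and fin: "(\<integral>\<^sup>+ z. ennreal (norm (F z)) \<partial>\<T>) < \<infinity>"
    and Q: "trig_poly Q"
  shows "fourier_coeff (\<lambda>z. F z + Q z) \<nu> = fourier_coeff F \<nu> + fourier_coeff Q \<nu>"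
proof -
  obtain K where K: "0 \<le> K" "\<And>z. z \<in> space \<T> \<Longrightarrow> norm (Q z) \<le> K" by (rule trig_poly_bounded[OF Q]) (rule that)
  have "(\<integral>\<^sup>+ z. ennreal (norm (Q z)) \<partial>\<T>) \<le> (\<integral>\<^sup>+ z. ennreal K \<partial>\<T>)"
    by (intro nn_integral_mono ennreal_leI K)
  also have "\<dots> < \<infinity>" by (simp add: torus.emeasure_space_1)
  finally have finQ: "(\<integral>\<^sup>+ z. ennreal (norm (Q z)) \<partial>\<T>) < \<infinity>" .
  have "has_bochner_int \<T> (\<lambda>z. monomial (\<lambda>j. - \<nu> j) z *\<^sub>C F z + monomial (\<lambda>j. - \<nu> j) z *\<^sub>C Q z) (fourier_coeff F \<nu> + fourier_coeff Q \<nu>)"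
  proof (rule has_bochner_int_add)
    show "(\<lambda>z. monomial (\<lambda>j. - \<nu> j) z *\<^sub>C F z + monomial (\<lambda>j. - \<nu> j) z *\<^sub>C Q z) \<in> borel_measurable \<T>"
      unfolding scaleC_add_right[symmetric]
      by (intro borel_measurable_scaleC strongly_measurable_borel trig_poly_add_measurable F Q monomial_measurable)
  qed (intro has_bochner_int_fourier_coeff F fin finQ trig_poly_strongly_measurable Q)+
  then show ?thesis
    unfolding fourier_coeff_def scaleC_add_right[symmetric] by (rule bochner_int_eqI)
qed

lemma trig_poly_fejer: "trig_poly (fejer N c)"
proof -
  have "trig_poly (\<lambda>z. \<Sum>x\<in>index_box N \<times> index_box N. monomial (index_diff x) z *\<^sub>C ((1 / of_nat (card (index_box N))) *\<^sub>C c (index_diff x)))"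
    by (intro trig_poly_sum trig_poly_monomial index_diff_eventually_null)
  then show ?thesis by (rule trig_poly_cong) (simp add: fejer_def scaleC_scaleC)
qed

lemma fejer_add: "fejer N (\<lambda>\<nu>. c \<nu> + d \<nu>) z = fejer N c z + fejer N d z"
  by (simp add: fejer_def scaleC_add_right sum.distrib)

lemma fejer_cong:
  assumes "\<And>\<nu>. \<nu> \<in> eventually_null \<Longrightarrow> c \<nu> = d \<nu>"
  shows "fejer N c z = fejer N d z"
  unfolding fejer_def using assms index_diff_eventually_null by (intro sum.cong) auto

lemma trig_poly_norm_measurable: "trig_poly Q \<Longrightarrow> (\<lambda>z. norm (Q z)) \<in> borel_measurable \<T>"
  by (intro strongly_measurable_norm trig_poly_strongly_measurable)

lemma trig_poly_diff: "trig_poly P \<Longrightarrow> trig_poly Q \<Longrightarrow> trig_poly (\<lambda>z. P z - Q z)"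
  using trig_poly_add[OF _ trig_poly_uminus, of P Q] by simp

lemma fejer_trig_poly_tendsto:
  fixes Q :: "(nat \<Rightarrow> complex) \<Rightarrow> 'a::complex_banach"
  assumes p: "1 \<le> p" and Q: "trig_poly Q"
  shows "(\<lambda>N. LpN \<T> p (\<lambda>z. Q z - fejer N (fourier_coeff Q) z)) \<longlonglongrightarrow> 0"
proof -
  obtain B c where B: "finite B" "B \<subseteq> eventually_null"
    and Qeq: "\<And>z. z \<in> space \<T> \<Longrightarrow> Q z = (\<Sum>\<alpha>\<in>B. monomial \<alpha> z *\<^sub>C c \<alpha>)"
    using Q unfolding trig_poly_def by blast
  have fc: "fourier_coeff Q \<nu> = (if \<nu> \<in> B then c \<nu> else 0)" if "\<nu> \<in> eventually_null" for \<nu>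
    by (rule fourier_coeff_trig_poly[OF B that Qeq])
  have fej: "fejer N (fourier_coeff Q) z = (\<Sum>\<alpha>\<in>B. (of_real (fejer_coeff N \<alpha>) * monomial \<alpha> z) *\<^sub>C c \<alpha>)" for N z
  proof -
    have "fejer N (fourier_coeff Q) z = fejer N (\<lambda>\<nu>. if \<nu> \<in> B then c \<nu> else 0) z"
      by (rule fejer_cong) (rule fc)
    also have "\<dots> = (\<Sum>\<alpha>\<in>B. (of_real (fejer_coeff N \<alpha>) * monomial \<alpha> z) *\<^sub>C (if \<alpha> \<in> B then c \<alpha> else 0))"
      by (rule fejer_regroup[OF B(1)]) (auto split: if_splits)
    finally show ?thesis by simp
  qed
  define K where "K = (\<Sum>\<alpha>\<in>B. norm (c \<alpha>))"
  have QK: "norm (Q z) \<le> K" if "z \<in> space \<T>" for z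
    unfolding Qeq[OF that] K_def using that by (intro sum_norm_le) (simp add: norm_scaleC norm_monomial)
  have fK: "norm (fejer N (fourier_coeff Q) z) \<le> K" if "z \<in> space \<T>" for z N
    unfolding fej K_def using that fejer_coeff_bounds[of N]
    by (intro sum_norm_le) (auto simp: norm_scaleC norm_mult norm_monomial intro!: mult_left_le_one_le)
  have [measurable]: "(\<lambda>z. norm (Q z - fejer N (fourier_coeff Q) z)) \<in> borel_measurable \<T>" for N
    by (intro trig_poly_norm_measurable trig_poly_diff Q trig_poly_fejer)
  show ?thesis
  proof (rule LpN_dominated_convergence[where w = "\<lambda>_. 2 * K"])
    show "norm (Q z - fejer N (fourier_coeff Q) z) \<le> 2 * K" if "z \<in> space \<T>" for N z
      using norm_triangle_ineq4[of "Q z" "fejer N (fourier_coeff Q) z"] QK[OF that] fK[OF that, of N]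
        by linarith
    show "AE z in \<T>. (\<lambda>N. Q z - fejer N (fourier_coeff Q) z) \<longlonglongrightarrow> 0"
    proof (rule AE_I2)
      fix z assume z: "z \<in> space \<T>"
      have "(\<lambda>N. \<Sum>\<alpha>\<in>B. (of_real (fejer_coeff N \<alpha>) * monomial \<alpha> z) *\<^sub>C c \<alpha>)
          \<longlonglongrightarrow> (\<Sum>\<alpha>\<in>B. (of_real 1 * monomial \<alpha> z) *\<^sub>C c \<alpha>)"
        using B(2) by (intro tendsto_sum scaleC.tendsto tendsto_mult tendsto_of_real tendsto_const fejer_coeff_tendsto) auto
      then have "(\<lambda>N. fejer N (fourier_coeff Q) z) \<longlonglongrightarrow> Q z"
        unfolding fej Qeq[OF z] by simp
      from tendsto_diff[OF tendsto_const this, of "Q z"]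
      show "(\<lambda>N. Q z - fejer N (fourier_coeff Q) z) \<longlonglongrightarrow> 0" by simp
    qed
  qed (use p in \<open>auto simp: torus.emeasure_space_1\<close>)
qed

text \<open>Convergence is clear for a trigonometric polynomial Q. If Q is close to F, the Fejer means of
  \<open>F - Q\<close> are small uniformly in N by contractivity.\<close>
theorem fejer_tendsto:
  fixes F :: "(nat \<Rightarrow> complex) \<Rightarrow> 'a::complex_banach"
  assumes p: "1 \<le> p" and F: "strongly_measurable \<T> F" and fin: "LpN \<T> p F < \<infinity>"
  shows "(\<lambda>N. LpN \<T> p (\<lambda>z. F z - fejer N (fourier_coeff F) z)) \<longlonglongrightarrow> 0"
proof (rule ennreal_tendsto_0I)
  fix \<epsilon> :: real assume \<epsilon>: "0 < \<epsilon>"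
  define e1 where "e1 = \<epsilon> / 2 / 2 powr p"
  have e1: "e1 > 0" using \<epsilon> by (simp add: e1_def)
  define e2 where "e2 = e1 / 2 / 2 powr p"
  have e2: "e2 > 0" using e1 by (simp add: e2_def)
  have "2 powr p \<ge> 1" using p by (simp add: ge_one_powr_ge_zero)
  then have e21: "e2 \<le> e1" using e1 unfolding e2_def by (simp add: divide_simps)
  obtain Q where Q: "trig_poly Q" "LpN \<T> p (\<lambda>z. F z - Q z) < ennreal e2"
    by (rule trig_poly_dense[OF p F fin e2]) (rule that)
  define R where "R z = F z - Q z" for z
  have R: "strongly_measurable \<T> R" unfolding R_def by (rule trig_poly_diff_measurable[OF F Q(1)])
  have LR: "LpN \<T> p R < ennreal e2" using Q(2) by (simp add: R_def[abs_def])
  have finR: "(\<integral>\<^sup>+ z. ennreal (norm (R z)) \<partial>\<T>) < \<infinity>"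
    by (rule torus.nn_integral_norm_finite[OF strongly_measurable_norm[OF R] p]) (use LR less_trans[OF LR] in simp)
  have FRQ: "F = (\<lambda>z. R z + Q z)" by (simp add: R_def)
  have fc: "fourier_coeff F \<nu> = fourier_coeff R \<nu> + fourier_coeff Q \<nu>" for \<nu>
    by (subst FRQ) (rule fourier_coeff_add_trig_poly[OF R finR Q(1)])
  have fej: "fejer N (fourier_coeff F) z = fejer N (fourier_coeff R) z + fejer N (fourier_coeff Q) z" for N z
    unfolding fejer_add[symmetric] by (rule fejer_cong) (rule fc)
  have "\<forall>\<^sub>F N in sequentially. LpN \<T> p (\<lambda>z. Q z - fejer N (fourier_coeff Q) z) < ennreal e2"
    using e2 by (intro order_tendstoD[OF fejer_trig_poly_tendsto[OF p Q(1)]]) simp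
  then show "\<forall>\<^sub>F N in sequentially. LpN \<T> p (\<lambda>z. F z - fejer N (fourier_coeff F) z) < ennreal \<epsilon>"
  proof eventually_elim
    case (elim N)
    have 1: "LpN \<T> p (fejer N (fourier_coeff R)) < ennreal e2"
      using fejer_contraction[OF R p finR, of N] LR by (rule le_less_trans)
    have 2: "LpN \<T> p (\<lambda>z. (Q z - fejer N (fourier_coeff Q) z) - fejer N (fourier_coeff R) z) < ennreal e1"
      by (rule LpN_two_term_less[OF p _ _ e1 elim[unfolded e2_def] 1[unfolded e2_def]])
         (auto intro!: trig_poly_norm_measurable trig_poly_diff Q trig_poly_fejer norm_triangle_ineq4)
    have 3: "LpN \<T> p R < ennreal e1" using LR e21 by (rule less_le_trans[OF _ ennreal_leI])
    show ?case
    proof (rule LpN_two_term_less[OF p _ _ \<epsilon> 3[unfolded e1_def] 2[unfolded e1_def]])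
      show "norm (F z - fejer N (fourier_coeff F) z)
          \<le> norm (R z) + norm ((Q z - fejer N (fourier_coeff Q) z) - fejer N (fourier_coeff R) z)" for z
        using norm_triangle_ineq[of "R z" "(Q z - fejer N (fourier_coeff Q) z) - fejer N (fourier_coeff R) z"]
        by (simp add: fej R_def algebra_simps)
    qed (rule strongly_measurable_norm[OF R],
         rule trig_poly_norm_measurable[OF trig_poly_diff[OF trig_poly_diff[OF Q(1) trig_poly_fejer] trig_poly_fejer]])
  qed
qed

text \<open>The upper bound is a hypothesis. For the lower bound, \<open>\<parallel>F\<parallel>\<^sup>p\<close> is at most a factor close to 1 times
  \<open>\<parallel>P N\<parallel>\<^sup>p\<close>, up to a multiple of \<open>\<parallel>F - P N\<parallel>\<^sup>p\<close> that does not depend on N.\<close>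
lemma LpN_tendsto_of_diff:
  assumes p: "1 \<le> p" and P: "\<And>N::nat. (\<lambda>z. norm (P N z)) \<in> borel_measurable M"
    and D: "\<And>N. (\<lambda>z. norm (F z - P N z)) \<in> borel_measurable M"
    and fin: "LpN M p F < \<infinity>" and le: "\<And>N. LpN M p (P N) \<le> LpN M p F"
    and lim: "(\<lambda>N. LpN M p (\<lambda>z. F z - P N z)) \<longlonglongrightarrow> 0"
  shows "(\<lambda>N. LpN M p (P N)) \<longlonglongrightarrow> LpN M p F"
proof (rule order_tendstoI)
  fix a assume "LpN M p F < a"
  then show "\<forall>\<^sub>F N in sequentially. LpN M p (P N) < a"
    using le by (intro always_eventually allI) (rule le_less_trans)
next
  fix a assume a: "a < LpN M p F"
  define l where "l = enn2real (LpN M p F)"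
  have l: "LpN M p F = ennreal l" "0 \<le> l" using fin by (auto simp: l_def)
  obtain b where b: "a = ennreal b" "0 \<le> b" using a by (cases a) auto
  have bl: "b < l" using a b l by (simp add: ennreal_less_iff)
  define \<epsilon> where "\<epsilon> = l - b"
  have \<epsilon>: "\<epsilon> > 0" using bl by (simp add: \<epsilon>_def)
  have "((\<lambda>t. (1 - t) powr (1 - p) * l) \<longlongrightarrow> (1 - 0) powr (1 - p) * l) (at_right 0)"
    by (intro tendsto_intros) auto
  then have "\<forall>\<^sub>F t in at_right 0. (1 - t) powr (1 - p) * l < l + \<epsilon> / 2"
    using \<epsilon> by (intro order_tendstoD) auto
  moreover have "\<forall>\<^sub>F t in at_right (0::real). t \<in> {0<..<1}" by (rule eventually_at_right_real) simp
  ultimately have "\<forall>\<^sub>F t in at_right (0::real). t \<in> {0<..<1} \<and> (1 - t) powr (1 - p) * l < l + \<epsilon> / 2"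
    by eventually_elim simp
  then obtain t :: real where t: "0 < t" "t < 1" "(1 - t) powr (1 - p) * l < l + \<epsilon> / 2"
    using eventually_happens[of _ "at_right (0::real)"] by (auto simp: trivial_limit_at_right_real)
  define d where "d = \<epsilon> / 2 / t powr (1 - p)"
  have d: "d > 0" using \<epsilon> t by (simp add: d_def)
  have "\<forall>\<^sub>F N in sequentially. LpN M p (\<lambda>z. F z - P N z) < ennreal d"
    using d by (intro order_tendstoD[OF lim]) simp
  then show "\<forall>\<^sub>F N in sequentially. a < LpN M p (P N)"
  proof eventually_elim
    case (elim N)
    define x where "x = enn2real (LpN M p (P N))"
    have "LpN M p (P N) < top" using le_less_trans[OF le[of N] fin] by simp
    then have x: "LpN M p (P N) = ennreal x" "0 \<le> x" by (simp_all add: x_def)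
    have "x \<le> l" using le[of N] l(2) unfolding l(1) x(1) by (simp add: ennreal_le_iff)
    note x = x this
    have "ennreal l \<le> ennreal ((1 - t) powr (1 - p)) * ennreal x
        + ennreal (t powr (1 - p)) * LpN M p (\<lambda>z. F z - P N z)"
      unfolding l(1)[symmetric] x(1)[symmetric]
    proof (rule LpN_add_le_convex[OF P D p t(1,2)])
      show "norm (F z) \<le> norm (P N z) + norm (F z - P N z)" for z
        using norm_triangle_ineq[of "P N z" "F z - P N z"] by simp
    qed
    also have "\<dots> \<le> ennreal ((1 - t) powr (1 - p)) * ennreal x + ennreal (t powr (1 - p)) * ennreal d"
      using elim by (intro add_left_mono mult_left_mono) auto
    also have "\<dots> = ennreal ((1 - t) powr (1 - p) * x + \<epsilon> / 2)"
      using t \<epsilon> x by (simp add: d_def ennreal_mult[symmetric] flip: ennreal_plus)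
    finally have 1: "l \<le> (1 - t) powr (1 - p) * x + \<epsilon> / 2"
      using x \<epsilon> by (subst (asm) ennreal_le_iff) auto
    have "1 \<le> (1 - t) powr (1 - p)" using powr_mono'[of "1 - p" 0 "1 - t"] p t by auto
    then have "((1 - t) powr (1 - p) - 1) * x \<le> ((1 - t) powr (1 - p) - 1) * l"
      using x(3) by (intro mult_left_mono) auto
    then have "(1 - t) powr (1 - p) * x \<le> x + ((1 - t) powr (1 - p) * l - l)"
      by (simp add: algebra_simps)
    then have "b < x" using 1 t(3) by (simp add: \<epsilon>_def field_simps)
    then show ?case using b x by (simp add: ennreal_less_iff)
  qed
qed

section \<open>Fejer means of Hardy functions\<close>

lemma bij_nth_prime: "bij_betw nth_prime UNIV {p. prime p}"
  unfolding nth_prime_def using primes_infinite by (rule bij_enumerate)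

text \<open>Unique factorisation: together with the next lemma, \<open>prime_index\<close> is a bijection between the
  positive numbers and the nonnegative eventually null sequences.\<close>
lemma inj_prime_index: "inj_on prime_index {0<..}"
proof (rule inj_onI)
  fix m n assume "m \<in> {0<..}" "n \<in> {0<..}" "prime_index m = prime_index n"
  then show "m = n" using prime_index_correct(3)[of m] prime_index_correct(3)[of n] by simp
qed

lemma prime_index_surj:
  assumes "\<alpha> \<in> eventually_null" and nonneg: "\<And>j. 0 \<le> \<alpha> j"
  obtains n where "n > 0" "prime_index n = \<alpha>"
proof -
  let ?J = "{j. \<alpha> j \<noteq> 0}"
  define n where "n = (\<Prod>j\<in>?J. nth_prime j ^ nat (\<alpha> j))"
  have fin: "finite ?J" using assms(1) by (simp add: eventually_null_def)
  have inj: "inj nth_prime" and prime: "\<And>j. prime (nth_prime j)"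
    using bij_nth_prime by (auto simp: bij_betw_def)
  let ?g = "\<lambda>q. nat (\<alpha> (the_inv nth_prime q))"
  have n_eq: "n = (\<Prod>q\<in>nth_prime ` ?J. q ^ ?g q)"
    unfolding n_def using inj by (subst prod.reindex) (auto simp: the_inv_f_f intro: inj_on_subset)
  have "prime_index n j = \<alpha> j" for j
  proof -
    have "multiplicity (nth_prime j) n = (if nth_prime j \<in> nth_prime ` ?J then ?g (nth_prime j) else 0)"
      unfolding n_eq by (rule multiplicity_prod_prime_powers) (use fin prime in auto)
    also have "\<dots> = nat (\<alpha> j)" using inj by (auto simp: the_inv_f_f inj_image_mem_iff)
    finally show ?thesis using nonneg[of j] by (simp add: prime_index_def)
  qed
  moreover have "n > 0" unfolding n_def using prime by (intro prod_pos) (auto simp: prime_gt_0_nat)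
  ultimately show ?thesis using that by blast
qed

definition fejer_set :: "nat \<Rightarrow> nat set" where
  "fejer_set N = {n. 0 < n \<and> prime_index n \<in> index_diff ` (index_box N \<times> index_box N)}"

text \<open>The multipliers depend on n alone. Hence taking Fejer means commutes with translation and with
  differentiation of Dirichlet series.\<close>
definition fejer_ds :: "nat \<Rightarrow> (nat \<Rightarrow> 'a::complex_banach) \<Rightarrow> nat \<Rightarrow> 'a" where
  "fejer_ds N x n = of_real (fejer_coeff N (prime_index n)) *\<^sub>C x n"

lemma finite_fejer_set: "finite (fejer_set N)"
proof (rule finite_imageD)
  show "finite (prime_index ` fejer_set N)"
    by (rule finite_subset[of _ "index_diff ` (index_box N \<times> index_box N)"]) (auto simp: fejer_set_def)
  show "inj_on prime_index (fejer_set N)" by (rule inj_on_subset[OF inj_prime_index]) (auto simp: fejer_set_def)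
qed

lemma zero_notin_fejer_set: "0 \<notin> fejer_set N" by (simp add: fejer_set_def)

lemma fejer_Hardy:
  assumes "F \<in> Hardy_torus p"
  shows "fejer N (fourier_coeff F) z = dpoly (fejer_set N) (fejer_ds N (bohr F)) z"
proof -
  have "fejer N (fourier_coeff F) z
      = (\<Sum>\<alpha>\<in>prime_index ` fejer_set N. (of_real (fejer_coeff N \<alpha>) * monomial \<alpha> z) *\<^sub>C fourier_coeff F \<alpha>)"
  proof (rule fejer_regroup)
    show "finite (prime_index ` fejer_set N)" by (intro finite_imageI finite_fejer_set)
    fix \<alpha> assume \<alpha>: "\<alpha> \<in> index_diff ` (index_box N \<times> index_box N)" "fourier_coeff F \<alpha> \<noteq> 0"
    then have en: "\<alpha> \<in> eventually_null" using index_diff_eventually_null by blast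
    then have "\<forall>j. 0 \<le> \<alpha> j" using assms \<alpha>(2) unfolding Hardy_torus_def by blast
    then obtain n where "n > 0" "prime_index n = \<alpha>" using prime_index_surj[OF en] by blast
    then show "\<alpha> \<in> prime_index ` fejer_set N" using \<alpha>(1)
      by (intro image_eqI[of _ _ n]) (auto simp: fejer_set_def)
  qed
  also have "\<dots> = (\<Sum>n\<in>fejer_set N. (of_real (fejer_coeff N (prime_index n)) * monomial (prime_index n) z) *\<^sub>C fourier_coeff F (prime_index n))"
    by (subst sum.reindex[OF inj_on_subset[OF inj_prime_index]]) (auto simp: fejer_set_def)
  also have "\<dots> = dpoly (fejer_set N) (fejer_ds N (bohr F)) z"
    unfolding dpoly_def by (rule sum.cong) (auto simp: fejer_ds_def bohr_def fejer_set_def scaleC_scaleC mult.commute)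
  finally show ?thesis .
qed

lemma Lp_space_torus_iff:
  fixes F :: "(nat \<Rightarrow> complex) \<Rightarrow> 'a::banach"
  shows "F \<in> Lp_space \<T> p \<longleftrightarrow> strongly_measurable \<T> F \<and> LpN \<T> p F < \<infinity>"
proof -
  have "integrable \<T> (\<lambda>z. norm (F z) powr p) \<longleftrightarrow> LpN \<T> p F < \<infinity>" if "strongly_measurable \<T> F"
    using strongly_measurable_norm[OF that] by (simp add: integrable_iff_bounded LpN_def)
  then show ?thesis unfolding Lp_space_def by blast
qed

lemma LpN_eq_Lp_norm:
  fixes F :: "(nat \<Rightarrow> complex) \<Rightarrow> 'a::banach"
  assumes "F \<in> Lp_space \<T> p" "p > 0"
  shows "LpN \<T> p F = ennreal (Lp_norm \<T> p F powr p)"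
proof -
  have int: "integrable \<T> (\<lambda>z. norm (F z) powr p)" using assms by (simp add: Lp_space_def)
  have "LpN \<T> p F = ennreal (\<integral>z. norm (F z) powr p \<partial>\<T>)"
    unfolding LpN_def by (rule nn_integral_eq_integral[OF int]) simp
  moreover have "0 \<le> (\<integral>z. norm (F z) powr p \<partial>\<T>)" by (intro integral_nonneg_AE) simp
  ultimately show ?thesis using assms(2) by (simp add: Lp_norm_def powr_powr)
qed

lemma Hardy_torus_measurable:
  "F \<in> Hardy_torus p \<Longrightarrow> strongly_measurable \<T> F" "F \<in> Hardy_torus p \<Longrightarrow> LpN \<T> p F < \<infinity>"
  by (auto simp: Hardy_torus_def Lp_space_torus_iff)

lemma Hardy_preimage:
  assumes "f \<in> Hardy p"
  shows "inv_into (Hardy_torus p) bohr f \<in> Hardy_torus p" "bohr (inv_into (Hardy_torus p) bohr f) = f"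
  using assms inv_into_into[of f bohr "Hardy_torus p"] f_inv_into_f[of f bohr "Hardy_torus p"]
  unfolding Hardy_def by auto

lemma LpN_Hardy_preimage:
  assumes "f \<in> Hardy p" "p > 0"
  shows "LpN \<T> p (inv_into (Hardy_torus p) bohr f) = ennreal (Hardy_norm p f powr p)"
  unfolding Hardy_norm_def using Hardy_preimage(1)[OF assms(1)] assms(2)
  by (intro LpN_eq_Lp_norm) (auto simp: Hardy_torus_def)

lemma Hardy_norm_nonneg: "0 \<le> Hardy_norm p f"
  by (simp add: Hardy_norm_def Lp_norm_def)

text \<open>The Fejer means of a preimage of f under the Bohr transform are built from the coefficients of f
  alone. Hence the limit of their norms, the Hardy norm of f, does not depend on which preimage is
  taken.\<close>
theorem Hardy_fejer:
  fixes f :: "nat \<Rightarrow> 'a::complex_banach"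
  assumes p: "1 \<le> p" and f: "f \<in> Hardy p"
  shows LpN_fejer_le: "LpN \<T> p (dpoly (fejer_set N) (fejer_ds N f)) \<le> ennreal (Hardy_norm p f powr p)"
    and LpN_fejer_diff: "(\<lambda>N. LpN \<T> p (\<lambda>z. inv_into (Hardy_torus p) bohr f z - dpoly (fejer_set N) (fejer_ds N f) z)) \<longlonglongrightarrow> 0"
    and LpN_fejer_tendsto: "(\<lambda>N. LpN \<T> p (dpoly (fejer_set N) (fejer_ds N f)))
        \<longlonglongrightarrow> ennreal (Hardy_norm p f powr p)"
proof -
  define F where "F = inv_into (Hardy_torus p) bohr f"
  have F: "F \<in> Hardy_torus p" "bohr F = f" using Hardy_preimage[OF f] by (simp_all add: F_def)
  note Fm = Hardy_torus_measurable[OF F(1)]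
  have L: "LpN \<T> p F = ennreal (Hardy_norm p f powr p)"
    unfolding F_def using p by (intro LpN_Hardy_preimage f) auto
  have fin: "(\<integral>\<^sup>+ z. ennreal (norm (F z)) \<partial>\<T>) < \<infinity>"
    by (rule torus.nn_integral_norm_finite[OF strongly_measurable_norm[OF Fm(1)] p Fm(2)])
  have eq: "fejer N (fourier_coeff F) = dpoly (fejer_set N) (fejer_ds N f)" for N
    using fejer_Hardy[OF F(1)] F(2) by (simp add: fun_eq_iff)
  show 1: "LpN \<T> p (dpoly (fejer_set N) (fejer_ds N f)) \<le> ennreal (Hardy_norm p f powr p)" for N
    using fejer_contraction[OF Fm(1) p fin, of N] by (simp add: eq L)
  show 2: "(\<lambda>N. LpN \<T> p (\<lambda>z. inv_into (Hardy_torus p) bohr f z - dpoly (fejer_set N) (fejer_ds N f) z)) \<longlonglongrightarrow> 0"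
    using fejer_tendsto[OF p Fm] unfolding eq by (simp only: F_def)
  show "(\<lambda>N. LpN \<T> p (dpoly (fejer_set N) (fejer_ds N f))) \<longlonglongrightarrow> ennreal (Hardy_norm p f powr p)"
    unfolding L[symmetric]
  proof (rule LpN_tendsto_of_diff[OF p _ _ Fm(2)])
    show "(\<lambda>z. norm (dpoly (fejer_set N) (fejer_ds N f) z)) \<in> borel_measurable \<T>" for N
      unfolding eq[symmetric] by (rule trig_poly_norm_measurable[OF trig_poly_fejer])
    show "(\<lambda>z. norm (F z - dpoly (fejer_set N) (fejer_ds N f) z)) \<in> borel_measurable \<T>" for N
      unfolding eq[symmetric] by (rule strongly_measurable_norm[OF trig_poly_diff_measurable[OF Fm(1) trig_poly_fejer]])
  qed (use 1 2 L F_def in auto)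
qed

lemma fejer_ds_translate: "fejer_ds N (ds_translate s f) = ds_translate s (fejer_ds N f)"
  by (simp add: fejer_ds_def ds_translate_def scaleC_scaleC mult.commute fun_eq_iff)

lemma fejer_ds_deriv: "fejer_ds N (ds_deriv f) = ds_deriv (fejer_ds N f)"
  by (auto simp: fejer_ds_def ds_deriv_def fun_eq_iff scaleC.scaleR_right scaleC.minus_right scaleC.zero_right)

text \<open>The first coefficient is the mean of the preimage over the torus.\<close>
lemma norm_first_coeff_le:
  assumes p: "1 \<le> p" and f: "f \<in> Hardy p"
  shows "norm (f 1) \<le> Hardy_norm p f"
proof -
  define F where "F = inv_into (Hardy_torus p) bohr f"
  have F: "F \<in> Hardy_torus p" "bohr F = f" using Hardy_preimage[OF f] by (simp_all add: F_def)
  note Fm = Hardy_torus_measurable[OF F(1)]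
  have L: "LpN \<T> p F = ennreal (Hardy_norm p f powr p)"
    unfolding F_def using p by (intro LpN_Hardy_preimage f) auto
  have fin: "(\<integral>\<^sup>+ z. ennreal (norm (F z)) \<partial>\<T>) < \<infinity>"
    by (rule torus.nn_integral_norm_finite[OF strongly_measurable_norm[OF Fm(1)] p Fm(2)])
  have f1: "f 1 = fourier_coeff F (prime_index 1)" using F(2) by (auto simp: bohr_def)
  have "ennreal (norm (f 1)) \<le> (\<integral>\<^sup>+ z. ennreal (norm (monomial (\<lambda>j. - prime_index 1 j) z *\<^sub>C F z)) \<partial>\<T>)"
    unfolding f1 by (rule has_bochner_int_norm_bound[OF has_bochner_int_fourier_coeff[OF Fm(1) fin]])
  also have "\<dots> = (\<integral>\<^sup>+ z. ennreal (norm (F z)) \<partial>\<T>)"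
    by (rule nn_integral_cong) (simp add: norm_scaleC norm_monomial)
  finally have "ennreal (norm (f 1) powr p) \<le> LpN \<T> p F"
    by (rule torus.nn_integral_norm_le_LpN[OF strongly_measurable_norm[OF Fm(1)] p norm_ge_zero])
  then have "norm (f 1) powr p \<le> Hardy_norm p f powr p" by (simp add: L)
  then show ?thesis using p Hardy_norm_nonneg[of p f] powr_less_mono2[of p "Hardy_norm p f" "norm (f 1)"]
    by fastforce
qed

section \<open>Completeness\<close>

lemma AE_summable_of_nn_integral:
  fixes h :: "nat \<Rightarrow> 'b \<Rightarrow> real"
  assumes h: "\<And>k. h k \<in> borel_measurable M" and nonneg: "\<And>k z. 0 \<le> h k z"
    and le: "\<And>k. (\<integral>\<^sup>+ z. ennreal (h k z) \<partial>M) \<le> ennreal ((1 / 2) ^ k)"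
  shows "AE z in M. summable (\<lambda>k. h k z)"
proof -
  note [measurable] = h
  have "(\<integral>\<^sup>+ z. (\<Sum>k. ennreal (h k z)) \<partial>M) = (\<Sum>k. \<integral>\<^sup>+ z. ennreal (h k z) \<partial>M)"
    by (rule nn_integral_suminf) measurable
  also have "\<dots> \<le> (\<Sum>k. ennreal ((1 / 2) ^ k))" by (intro suminf_le le) auto
  also have "\<dots> = ennreal (\<Sum>k. (1 / 2) ^ k)" by (rule suminf_ennreal2) (auto intro: summable_geometric)
  also have "\<dots> < top" by simp
  finally have "(\<integral>\<^sup>+ z. (\<Sum>k. ennreal (h k z)) \<partial>M) \<noteq> \<infinity>" by simp
  then have "AE z in M. (\<Sum>k. ennreal (h k z)) \<noteq> \<infinity>" by (intro nn_integral_PInf_AE) auto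
  then show ?thesis
    by eventually_elim (intro summable_suminf_not_top nonneg, simp)
qed

lemma (in prob_space) LpN_less_imp_nn_integral_le:
  fixes F :: "'a \<Rightarrow> 'b::real_normed_vector"
  assumes "(\<lambda>z. norm (F z)) \<in> borel_measurable M" "1 \<le> p" "0 \<le> m" "LpN M p F < ennreal (m powr p)"
  shows "(\<integral>\<^sup>+ z. ennreal (norm (F z)) \<partial>M) \<le> ennreal m"
  using nn_integral_norm_le_LpN[OF assms(1,2,3)] assms(4) by (meson leD le_cases)

text \<open>As in the Riesz-Fischer theorem, a subsequence with summable \<open>L\<^sub>1\<close> distances converges almost
  everywhere, and Fatou's lemma turns the Cauchy condition into convergence to this limit. Simple
  functions at summable distances from the same subsequence show that the limit is strongly
  measurable.\<close>
theorem trig_poly_complete: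
  fixes Q :: "nat \<Rightarrow> (nat \<Rightarrow> complex) \<Rightarrow> 'a::complex_banach"
  assumes p: "1 \<le> p" and Q: "\<And>N. trig_poly (Q N)"
    and Cauchy: "\<And>\<epsilon>. \<epsilon> > 0 \<Longrightarrow> \<exists>K. \<forall>N\<ge>K. \<forall>N'\<ge>K. LpN \<T> p (\<lambda>z. Q N z - Q N' z) < ennreal \<epsilon>"
  obtains H where "strongly_measurable \<T> H" "LpN \<T> p H < \<infinity>"
    "(\<lambda>N. LpN \<T> p (\<lambda>z. H z - Q N z)) \<longlonglongrightarrow> 0"
proof -
  have p0: "p > 0" using p by simp
  have "\<exists>K. \<forall>N\<ge>K. \<forall>N'\<ge>K. LpN \<T> p (\<lambda>z. Q N z - Q N' z) < ennreal (((1 / 2) ^ k) powr p)" for k :: nat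
    by (rule Cauchy) simp
  then obtain K where K: "\<And>k N N'. N \<ge> K k \<Longrightarrow> N' \<ge> K k
      \<Longrightarrow> LpN \<T> p (\<lambda>z. Q N z - Q N' z) < ennreal (((1 / 2) ^ k) powr p)"
    by metis
  \<comment> \<open>an index beyond all of \<open>K 0, \<dots>, K k\<close>, so that consecutive terms of the subsequence are close; the summand k makes it tend to infinity\<close>
  define r where "r k = k + (\<Sum>i\<le>k. K i)" for k
  have rK: "K k \<le> r k" "K k \<le> r (Suc k)" "k \<le> r k" for k
  proof -
    have "K k \<le> (\<Sum>i\<le>k. K i)" by (intro member_le_sum) auto
    then show "K k \<le> r k" "K k \<le> r (Suc k)" by (simp_all add: r_def)
  qed (simp add: r_def)
  define q where "q k = Q (r k)" for k
  have q: "trig_poly (q k)" for k by (simp add: q_def Q)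
  have diffm: "(\<lambda>z. norm (q k z - q l z)) \<in> borel_measurable \<T>" for k l
    by (intro trig_poly_norm_measurable trig_poly_diff q)
  have "(\<integral>\<^sup>+ z. ennreal (norm (q (Suc k) z - q k z)) \<partial>\<T>) \<le> ennreal ((1 / 2) ^ k)" for k
    by (rule torus.LpN_less_imp_nn_integral_le[OF diffm p]) (use K[OF rK(2) rK(1)] in \<open>auto simp: q_def\<close>)
  then have AE1: "AE z in \<T>. summable (\<lambda>k. norm (q (Suc k) z - q k z))"
    by (intro AE_summable_of_nn_integral diffm) auto
  define E where "E = {z \<in> space \<T>. (\<Sum>k. ennreal (norm (q (Suc k) z - q k z))) \<noteq> \<infinity>}"
  note [measurable] = diffm
  have E [measurable]: "E \<in> sets \<T>" unfolding E_def by measurable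
  define H where "H z = (if z \<in> E then lim (\<lambda>k. q k z) else 0)" for z
  have limE: "(\<lambda>k. q k z) \<longlonglongrightarrow> H z" if z: "z \<in> E" for z
  proof -
    have "summable (\<lambda>k. norm (q (Suc k) z - q k z))"
      using z by (intro summable_suminf_not_top) (auto simp: E_def)
    then have "summable (\<lambda>k. q (Suc k) z - q k z)" by (rule summable_norm_cancel)
    then have "convergent (\<lambda>n. \<Sum>k<n. q (Suc k) z - q k z)" by (simp add: summable_iff_convergent)
    then have "convergent (\<lambda>n. q n z - q 0 z)"
      by (simp only: sum_lessThan_telescope[of "\<lambda>k. q k z"])
    then obtain L where "(\<lambda>n. q n z - q 0 z) \<longlonglongrightarrow> L" by (auto simp: convergent_def)
    then have "(\<lambda>n. (q n z - q 0 z) + q 0 z) \<longlonglongrightarrow> L + q 0 z" by (intro tendsto_intros)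
    then have "convergent (\<lambda>n. q n z)" by (auto simp: convergent_def)
    then show ?thesis using z by (simp add: H_def convergent_LIMSEQ_iff)
  qed
  have AEE: "AE z in \<T>. z \<in> E"
    using AE1 AE_space
  proof eventually_elim
    case (elim z)
    then have "(\<Sum>k. ennreal (norm (q (Suc k) z - q k z))) = ennreal (\<Sum>k. norm (q (Suc k) z - q k z))"
      by (intro suminf_ennreal2) auto
    then show ?case using elim by (simp add: E_def)
  qed
  have Hb: "H \<in> borel_measurable \<T>"
  proof (rule borel_measurable_LIMSEQ_metric)
    show "(\<lambda>z. if z \<in> E then q k z else 0) \<in> borel_measurable \<T>" for k
      by (intro measurable_If strongly_measurable_borel[OF trig_poly_strongly_measurable[OF q]]) auto
    show "(\<lambda>k. if z \<in> E then q k z else 0) \<longlonglongrightarrow> H z" for z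
      using limE[of z] by (cases "z \<in> E") (auto simp: H_def)
  qed
  have "\<exists>s. simple_function \<T> s \<and> (\<integral>\<^sup>+ z. ennreal (norm (q k z - s z)) \<partial>\<T>) < ennreal ((1 / 2) ^ k)" for k
  proof -
    have sm: "strongly_measurable \<T> (q k)" by (rule trig_poly_strongly_measurable[OF q])
    obtain B where B: "0 \<le> B" "\<And>z. z \<in> space \<T> \<Longrightarrow> norm (q k z) \<le> B"
      by (rule trig_poly_bounded[OF q[of k]]) (rule that)
    have "LpN \<T> 1 (q k) \<le> (\<integral>\<^sup>+ z. ennreal B \<partial>\<T>)"
      unfolding LpN_one using B by (intro nn_integral_mono ennreal_leI)
    also have "\<dots> < \<infinity>" by (simp add: torus.emeasure_space_1)
    finally have fin: "LpN \<T> 1 (q k) < \<infinity>" .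
    obtain s where s: "\<And>i::nat. simple_function \<T> (s i)" "(\<lambda>i. LpN \<T> 1 (\<lambda>z. q k z - s i z)) \<longlonglongrightarrow> 0"
      by (rule LpN_simple_approx[OF sm zero_less_one fin]) (rule that)
    have "\<forall>\<^sub>F i in sequentially. LpN \<T> 1 (\<lambda>z. q k z - s i z) < ennreal ((1 / 2) ^ k)"
      by (intro order_tendstoD[OF s(2)]) simp
    then obtain i where "LpN \<T> 1 (\<lambda>z. q k z - s i z) < ennreal ((1 / 2) ^ k)"
      by (auto simp: eventually_sequentially)
    then show ?thesis using s(1)[of i] by (intro exI[of _ "s i"]) (simp add: LpN_one)
  qed
  then obtain s where s: "\<And>k. simple_function \<T> (s k)"
    "\<And>k. (\<integral>\<^sup>+ z. ennreal (norm (q k z - s k z)) \<partial>\<T>) < ennreal ((1 / 2) ^ k)"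
    by metis
  have "AE z in \<T>. summable (\<lambda>k. norm (q k z - s k z))"
  proof (rule AE_summable_of_nn_integral)
    show "(\<lambda>z. norm (q k z - s k z)) \<in> borel_measurable \<T>" for k
      by (intro borel_measurable_norm_nonseparable borel_measurable_diff_simple s strongly_measurable_borel[OF trig_poly_strongly_measurable[OF q]])
  qed (use s(2) in \<open>auto intro: less_imp_le\<close>)
  then have "AE z in \<T>. (\<lambda>k. s k z) \<longlonglongrightarrow> H z"
    using AEE
  proof eventually_elim
    case (elim z)
    have "(\<lambda>k. q k z - s k z) \<longlonglongrightarrow> 0" by (rule summable_LIMSEQ_zero[OF summable_norm_cancel[OF elim(1)]])
    then have "(\<lambda>k. q k z - (q k z - s k z)) \<longlonglongrightarrow> H z - 0" by (intro tendsto_diff limE elim)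
    then show ?case by simp
  qed
  then have Hsm: "strongly_measurable \<T> H" unfolding strongly_measurable_def using Hb s(1) by blast
  have HQ: "LpN \<T> p (\<lambda>z. H z - Q N z) \<le> ennreal \<epsilon>"
    if KK: "\<forall>N\<ge>K'. \<forall>N'\<ge>K'. LpN \<T> p (\<lambda>z. Q N z - Q N' z) < ennreal \<epsilon>" and N: "N \<ge> K'" for N K' \<epsilon>
  proof -
    have [measurable]: "(\<lambda>z. norm (q k z - Q N z)) \<in> borel_measurable \<T>" for k
      by (intro trig_poly_norm_measurable trig_poly_diff q Q)
    have "LpN \<T> p (\<lambda>z. H z - Q N z) = (\<integral>\<^sup>+ z. liminf (\<lambda>k. ennreal (norm (q k z - Q N z) powr p)) \<partial>\<T>)"
      unfolding LpN_def
    proof (rule nn_integral_cong_AE)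
      show "AE z in \<T>. ennreal (norm (H z - Q N z) powr p) = liminf (\<lambda>k. ennreal (norm (q k z - Q N z) powr p))"
        using AEE
      proof eventually_elim
        case (elim z)
        have "(\<lambda>k. norm (q k z - Q N z)) \<longlonglongrightarrow> norm (H z - Q N z)" by (intro tendsto_intros limE elim)
        then have "(\<lambda>k. norm (q k z - Q N z) powr p) \<longlonglongrightarrow> norm (H z - Q N z) powr p"
          using p0 by (intro tendsto_powr2[OF _ tendsto_const]) auto
        then have "(\<lambda>k. ennreal (norm (q k z - Q N z) powr p)) \<longlonglongrightarrow> ennreal (norm (H z - Q N z) powr p)"
          by (intro tendsto_ennrealI)
        then show ?case by (intro lim_imp_Liminf[symmetric]) auto
      qed
    qed
    also have "\<dots> \<le> liminf (\<lambda>k. LpN \<T> p (\<lambda>z. q k z - Q N z))"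
      unfolding LpN_def by (rule nn_integral_liminf) measurable
    also have "\<dots> \<le> liminf (\<lambda>k. ennreal \<epsilon>)"
    proof (rule Liminf_mono)
      show "\<forall>\<^sub>F k in sequentially. LpN \<T> p (\<lambda>z. q k z - Q N z) \<le> ennreal \<epsilon>"
        using eventually_ge_at_top[of K']
      proof eventually_elim
        case (elim k)
        have "r k \<ge> K'" using rK(3)[of k] elim by simp
        then have "LpN \<T> p (\<lambda>z. Q (r k) z - Q N z) < ennreal \<epsilon>" using KK N by blast
        then show ?case by (simp add: q_def)
      qed
    qed
    also have "\<dots> = ennreal \<epsilon>" by (simp add: Liminf_const)
    finally show ?thesis .
  qed
  have lim: "(\<lambda>N. LpN \<T> p (\<lambda>z. H z - Q N z)) \<longlonglongrightarrow> 0"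
  proof (rule ennreal_tendsto_0I)
    fix \<epsilon> :: real assume \<epsilon>: "0 < \<epsilon>"
    then have "\<epsilon> / 2 > 0" by simp
    from Cauchy[OF this] obtain K' where K': "\<forall>N\<ge>K'. \<forall>N'\<ge>K'. LpN \<T> p (\<lambda>z. Q N z - Q N' z) < ennreal (\<epsilon> / 2)"
      by blast
    have "ennreal (\<epsilon> / 2) < ennreal \<epsilon>" using \<epsilon> by (simp add: ennreal_less_iff)
    then have "LpN \<T> p (\<lambda>z. H z - Q N z) < ennreal \<epsilon>" if "N \<ge> K'" for N
      using HQ[OF K' that] by (rule le_less_trans[rotated])
    then show "\<forall>\<^sub>F N in sequentially. LpN \<T> p (\<lambda>z. H z - Q N z) < ennreal \<epsilon>"
      using eventually_ge_at_top[of K'] by (rule eventually_mono[rotated])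
  qed
  have "LpN \<T> p H < \<infinity>"
  proof -
    have "\<forall>\<^sub>F N in sequentially. LpN \<T> p (\<lambda>z. H z - Q N z) < 1" by (intro order_tendstoD[OF lim]) simp
    then obtain N where N: "LpN \<T> p (\<lambda>z. H z - Q N z) < 1" by (auto simp: eventually_sequentially)
    obtain B where B: "0 \<le> B" "\<And>z. z \<in> space \<T> \<Longrightarrow> norm (Q N z) \<le> B"
      by (rule trig_poly_bounded[OF Q[of N]]) (rule that)
    have "LpN \<T> p (Q N) \<le> (\<integral>\<^sup>+ z. ennreal (B powr p) \<partial>\<T>)"
      unfolding LpN_def using B p0 by (intro nn_integral_mono ennreal_leI powr_mono2) auto
    also have "\<dots> < \<infinity>" by (simp add: torus.emeasure_space_1)
    finally have fQ: "LpN \<T> p (Q N) < \<infinity>" .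
    have "LpN \<T> p H \<le> ennreal (2 powr p) * (LpN \<T> p (\<lambda>z. H z - Q N z) + LpN \<T> p (Q N))"
    proof (rule LpN_add_le)
      show "norm (H z) \<le> norm (H z - Q N z) + norm (Q N z)" for z
        using norm_triangle_ineq[of "H z - Q N z" "Q N z"] by simp
    qed (use p strongly_measurable_norm[OF trig_poly_diff_measurable[OF Hsm Q]] trig_poly_norm_measurable[OF Q] in auto)
    also have "\<dots> < \<infinity>" using fQ less_trans[OF N, of top] by (simp add: ennreal_mult_less_top)
    finally show ?thesis .
  qed
  then show ?thesis using that Hsm lim by blast
qed

lemma fourier_coeff_LpN_limit:
  fixes H :: "(nat \<Rightarrow> complex) \<Rightarrow> 'a::complex_banach"
  assumes p: "1 \<le> p" and H: "strongly_measurable \<T> H" "LpN \<T> p H < \<infinity>"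
    and Q: "\<And>N::nat. trig_poly (Q N)" and lim: "(\<lambda>N. LpN \<T> p (\<lambda>z. H z - Q N z)) \<longlonglongrightarrow> 0"
  shows "(\<lambda>N. fourier_coeff (Q N) \<nu>) \<longlonglongrightarrow> fourier_coeff H \<nu>"
proof (rule metric_LIMSEQ_I)
  fix e :: real assume e: "0 < e"
  define m where "m = e / 2"
  have m: "0 < m" "m < e" using e by (auto simp: m_def)
  have "\<forall>\<^sub>F N in sequentially. LpN \<T> p (\<lambda>z. H z - Q N z) < ennreal (m powr p)"
    using m by (intro order_tendstoD[OF lim]) simp
  then obtain N0 where N0: "\<And>N. N \<ge> N0 \<Longrightarrow> LpN \<T> p (\<lambda>z. H z - Q N z) < ennreal (m powr p)"
    by (auto simp: eventually_sequentially)
  show "\<exists>N0. \<forall>N\<ge>N0. dist (fourier_coeff (Q N) \<nu>) (fourier_coeff H \<nu>) < e"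
  proof (intro exI allI impI)
    fix N assume N: "N \<ge> N0"
    define R where "R z = H z - Q N z" for z
    have R: "strongly_measurable \<T> R" unfolding R_def by (rule trig_poly_diff_measurable[OF H(1) Q])
    have LR: "LpN \<T> p R < ennreal (m powr p)" using N0[OF N] by (simp add: R_def[abs_def])
    have int: "(\<integral>\<^sup>+ z. ennreal (norm (R z)) \<partial>\<T>) \<le> ennreal m"
      by (rule torus.LpN_less_imp_nn_integral_le[OF strongly_measurable_norm[OF R] p _ LR]) (use m in simp)
    then have fin: "(\<integral>\<^sup>+ z. ennreal (norm (R z)) \<partial>\<T>) < \<infinity>" by (rule le_less_trans) simp
    have HRQ: "H = (\<lambda>z. R z + Q N z)" by (simp add: R_def)
    have "fourier_coeff H \<nu> = fourier_coeff R \<nu> + fourier_coeff (Q N) \<nu>"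
      by (subst HRQ) (rule fourier_coeff_add_trig_poly[OF R fin Q])
    then have "dist (fourier_coeff (Q N) \<nu>) (fourier_coeff H \<nu>) = norm (fourier_coeff R \<nu>)"
      by (simp add: dist_norm)
    moreover have "ennreal (norm (fourier_coeff R \<nu>)) \<le> ennreal m"
    proof -
      have "ennreal (norm (fourier_coeff R \<nu>)) \<le> (\<integral>\<^sup>+ z. ennreal (norm (monomial (\<lambda>j. - \<nu> j) z *\<^sub>C R z)) \<partial>\<T>)"
        by (rule has_bochner_int_norm_bound[OF has_bochner_int_fourier_coeff[OF R fin]])
      also have "\<dots> = (\<integral>\<^sup>+ z. ennreal (norm (R z)) \<partial>\<T>)"
        by (rule nn_integral_cong) (simp add: norm_scaleC norm_monomial)
      finally show ?thesis using int by (rule order_trans)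
    qed
    ultimately show "dist (fourier_coeff (Q N) \<nu>) (fourier_coeff H \<nu>) < e" using m by (simp add: ennreal_le_iff)
  qed
qed

section \<open>The derivative of a Hardy function\<close>

lemma trig_poly_dpoly:
  assumes "finite A" "0 \<notin> A"
  shows "trig_poly (dpoly A c)"
proof -
  have "prime_index n \<in> eventually_null" if "n \<in> A" for n
    using that assms(2) by (intro prime_index_correct(1)) (cases n, auto)
  then show ?thesis unfolding dpoly_def[abs_def] by (intro trig_poly_sum trig_poly_monomial)
qed

lemma fourier_coeff_dpoly:
  assumes A: "finite A" "0 \<notin> A" and \<nu>: "\<nu> \<in> eventually_null"
  shows "fourier_coeff (dpoly A c) \<nu> = (if \<nu> \<in> prime_index ` A then c (inv_into {0<..} prime_index \<nu>) else 0)"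
proof (rule fourier_coeff_trig_poly)
  have sub: "A \<subseteq> {0<..}" using A(2) by (auto intro: Suc_leI gr0I)
  show "finite (prime_index ` A)" using A(1) by simp
  show "prime_index ` A \<subseteq> eventually_null" using sub prime_index_correct(1) by auto
  show "dpoly A c z = (\<Sum>\<alpha>\<in>prime_index ` A. monomial \<alpha> z *\<^sub>C c (inv_into {0<..} prime_index \<alpha>))" for z
    unfolding dpoly_def using sub
    by (subst sum.reindex[OF inj_on_subset[OF inj_prime_index sub]])
       (auto intro!: sum.cong simp: inv_into_f_f[OF inj_prime_index] subset_iff)
qed (rule \<nu>)

text \<open>The coefficients of the difference of two Dirichlet polynomials with different sets of
  frequencies.\<close>
definition cut_diff :: "nat set \<Rightarrow> (nat \<Rightarrow> 'a) \<Rightarrow> nat set \<Rightarrow> (nat \<Rightarrow> 'a) \<Rightarrow> nat \<Rightarrow> 'a::complex_banach" where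
  "cut_diff A c B d n = (if n \<in> A then c n else 0) - (if n \<in> B then d n else 0)"

lemma dpoly_cut_diff:
  assumes "finite A" "finite B"
  shows "dpoly (A \<union> B) (cut_diff A c B d) z = dpoly A c z - dpoly B d z"
proof -
  have "dpoly A c z = (\<Sum>n\<in>A \<union> B. monomial (prime_index n) z *\<^sub>C (if n \<in> A then c n else 0))"
    unfolding dpoly_def by (rule sum.mono_neutral_cong_left) (use assms in \<open>auto simp: scaleC.zero_right\<close>)
  moreover have "dpoly B d z = (\<Sum>n\<in>A \<union> B. monomial (prime_index n) z *\<^sub>C (if n \<in> B then d n else 0))"
    unfolding dpoly_def by (rule sum.mono_neutral_cong_left) (use assms in \<open>auto simp: scaleC.zero_right\<close>)
  ultimately show ?thesis by (simp only: dpoly_def cut_diff_def scaleC.diff_right sum_subtractf)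
qed

lemma ds_translate_cut_diff: "ds_translate s (cut_diff A c B d)
    = cut_diff A (ds_translate s c) B (ds_translate s d)"
  by (auto simp: ds_translate_def cut_diff_def fun_eq_iff scaleC.diff_right scaleC.zero_right)

lemma ds_deriv_cut_diff: "ds_deriv (cut_diff A c B d) = cut_diff A (ds_deriv c) B (ds_deriv d)"
  by (auto simp: ds_deriv_def cut_diff_def fun_eq_iff scaleR_diff_right)

lemma Hardy_plus_translate:
  assumes "f \<in> Hardy_plus p" "\<sigma> > 0"
  shows "ds_translate (of_real \<sigma>) f \<in> Hardy p" "Hardy_norm p (ds_translate (of_real \<sigma>) f) \<le> Hardy_plus_norm p f"
proof -
  show "ds_translate (of_real \<sigma>) f \<in> Hardy p" using assms by (simp add: Hardy_plus_def)
  show "Hardy_norm p (ds_translate (of_real \<sigma>) f) \<le> Hardy_plus_norm p f"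
    unfolding Hardy_plus_norm_def using assms by (intro cSUP_upper) (auto simp: Hardy_plus_def)
qed

lemma Hardy_plus_norm_nonneg: "f \<in> Hardy_plus p \<Longrightarrow> 0 \<le> Hardy_plus_norm p f"
  using Hardy_plus_translate(2)[of f p 1] Hardy_norm_nonneg order_trans by (metis zero_less_one)

lemma Hardy_plus_fejer_le:
  assumes p: "1 \<le> p" and f: "f \<in> Hardy_plus p" and \<sigma>: "\<sigma> > 0"
  shows "LpN \<T> p (dpoly (fejer_set N) (ds_translate (of_real \<sigma>) (fejer_ds N f)))
      \<le> ennreal (Hardy_plus_norm p f powr p)"
proof -
  have "LpN \<T> p (dpoly (fejer_set N) (ds_translate (of_real \<sigma>) (fejer_ds N f)))
      \<le> ennreal (Hardy_norm p (ds_translate (of_real \<sigma>) f) powr p)"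
    using LpN_fejer_le[OF p Hardy_plus_translate(1)[OF f \<sigma>], of N] by (simp add: fejer_ds_translate)
  also have "\<dots> \<le> ennreal (Hardy_plus_norm p f powr p)"
    using p Hardy_plus_translate(2)[OF f \<sigma>] by (intro ennreal_leI powr_mono2 Hardy_norm_nonneg) auto
  finally show ?thesis .
qed

text \<open>The limit of the Fejer polynomials has the right Fourier coefficients, since \<open>fejer_coeff\<close> tends
  to 1 and the polynomials have no negative frequencies.\<close>
lemma HardyI_fejer_Cauchy:
  fixes x :: "nat \<Rightarrow> 'a::complex_banach"
  assumes p: "1 \<le> p" and x0: "x 0 = 0"
    and Cauchy: "\<And>\<epsilon>. \<epsilon> > 0 \<Longrightarrow> \<exists>K. \<forall>N\<ge>K. \<forall>N'\<ge>K. LpN \<T> p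
      (\<lambda>z. dpoly (fejer_set N) (fejer_ds N x) z - dpoly (fejer_set N') (fejer_ds N' x) z) < ennreal \<epsilon>"
  shows "x \<in> Hardy p"
proof -
  let ?Q = "\<lambda>N. dpoly (fejer_set N) (fejer_ds N x)"
  have Q: "trig_poly (?Q N)" for N by (rule trig_poly_dpoly[OF finite_fejer_set zero_notin_fejer_set])
  obtain H where H: "strongly_measurable \<T> H" "LpN \<T> p H < \<infinity>"
    "(\<lambda>N. LpN \<T> p (\<lambda>z. H z - ?Q N z)) \<longlonglongrightarrow> 0"
    by (rule trig_poly_complete[OF p Q Cauchy]) (assumption, rule that)
  note lim = fourier_coeff_LpN_limit[OF p H(1,2) Q H(3)]
  have "fourier_coeff H \<nu> = 0" if \<nu>: "\<nu> \<in> eventually_null - {\<nu>. \<forall>j. 0 \<le> \<nu> j}" for \<nu>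
  proof -
    have "\<nu> \<notin> prime_index ` fejer_set N" for N using \<nu> by (auto simp: prime_index_def)
    then have "fourier_coeff (?Q N) \<nu> = 0" for N
      using \<nu> by (simp add: fourier_coeff_dpoly[OF finite_fejer_set zero_notin_fejer_set])
    then show ?thesis using lim[of \<nu>] by (simp add: LIMSEQ_const_iff)
  qed
  then have HH: "H \<in> Hardy_torus p" using H(1,2) by (auto simp: Hardy_torus_def Lp_space_torus_iff)
  have "bohr H n = x n" for n
  proof (cases "n = 0")
    case False
    then have n: "n > 0" by simp
    have inv: "inv_into {0<..} prime_index (prime_index n) = n"
      by (rule inv_into_f_f[OF inj_prime_index]) (use n in simp)
    have "fourier_coeff (?Q N) (prime_index n) = of_real (fejer_coeff N (prime_index n)) *\<^sub>C x n" for N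
    proof (cases "prime_index n \<in> prime_index ` fejer_set N")
      case True
      then show ?thesis using fourier_coeff_dpoly[OF finite_fejer_set[of N] zero_notin_fejer_set[of N] prime_index_correct(1)[OF n],
        where c = "fejer_ds N x"]
        by (simp add: inv fejer_ds_def)
    next
      case False
      then have "prime_index n \<notin> index_diff ` (index_box N \<times> index_box N)" using n by (auto simp: fejer_set_def)
      then show ?thesis using False fourier_coeff_dpoly[OF finite_fejer_set[of N] zero_notin_fejer_set[of N] prime_index_correct(1)[OF n],
        where c = "fejer_ds N x"]
        by (simp add: fejer_coeff_eq_0 scaleC.zero_left)
    qed
    moreover have "(\<lambda>N. complex_of_real (fejer_coeff N (prime_index n)) *\<^sub>C x n) \<longlonglongrightarrow> complex_of_real 1 *\<^sub>C x n"
      by (intro scaleC.tendsto tendsto_of_real tendsto_const fejer_coeff_tendsto prime_index_correct(1) n)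
    ultimately have "(\<lambda>N. fourier_coeff (?Q N) (prime_index n)) \<longlonglongrightarrow> x n" by simp
    then have "fourier_coeff H (prime_index n) = x n" using lim[of "prime_index n"] LIMSEQ_unique by blast
    then show ?thesis using n by (simp add: bohr_def)
  qed (simp add: bohr_def x0)
  then have "bohr H = x" by (simp add: fun_eq_iff)
  then show ?thesis unfolding Hardy_def using HH by blast
qed

text \<open>The PL-inequality for the difference of two Fejer polynomials of f at \<open>\<sigma>\<close>, with radius \<open>\<sigma> / 2\<close>,
  bounds the difference of their derivatives by a mean of the differences of their translates. These
  tend to 0 for every translation, boundedly, so the derivatives form a Cauchy sequence.\<close>
theorem ds_deriv_translate_Hardy:
  fixes f :: "nat \<Rightarrow> 'a::complex_banach"
  assumes p: "1 \<le> p" and C: "C > 0"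
    and PL: "\<And>x y :: 'a. ennreal (norm x powr p) + ennreal C * ennreal (norm y powr p)
      \<le> (\<integral>\<^sup>+ \<xi>. ennreal (norm (x + \<xi> *\<^sub>C y) powr p) \<partial>\<S>)"
    and f: "f \<in> Hardy_plus p" and \<sigma>: "\<sigma> > 0"
  shows "ds_translate (of_real \<sigma>) (ds_deriv f) \<in> Hardy p"
proof (rule HardyI_fejer_Cauchy[OF p])
  show "ds_translate (of_real \<sigma>) (ds_deriv f) 0 = 0" by (simp add: ds_translate_def scaleC.zero_left)
  fix \<epsilon> :: real assume \<epsilon>: "\<epsilon> > 0"
  define P where "P N s = dpoly (fejer_set N) (ds_translate (complex_of_real s) (fejer_ds N f))" for N s
  define U where "U x s = LpN \<T> p (\<lambda>z. P (fst x) s z - P (snd x) s z)" for x s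
  have Pt: "trig_poly (P N s)" for N s unfolding P_def
    by (rule trig_poly_dpoly[OF finite_fejer_set zero_notin_fejer_set])
  note Pm = trig_poly_norm_measurable[OF Pt]
  let ?A = "\<lambda>x. fejer_set (fst x) \<union> fejer_set (snd x)"
  let ?e = "\<lambda>x. cut_diff (fejer_set (fst x)) (fejer_ds (fst x) f) (fejer_set (snd x)) (fejer_ds (snd x) f)"
  have A: "finite (?A x)" "0 \<notin> ?A x" for x using finite_fejer_set zero_notin_fejer_set by auto
  have U_eq: "U x s = LpN \<T> p (dpoly (?A x) (ds_translate (of_real s) (?e x)))" for x s
    unfolding U_def P_def ds_translate_cut_diff
      by (intro LpN_cong) (simp add: dpoly_cut_diff[OF finite_fejer_set finite_fejer_set])
  define B where "B = ennreal (2 powr p) * (ennreal (Hardy_plus_norm p f powr p) + ennreal (Hardy_plus_norm p f powr p))"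
  have UB: "U x s \<le> B" if "s > 0" for x s
  proof -
    have "U x s \<le> ennreal (2 powr p) * (LpN \<T> p (P (fst x) s) + LpN \<T> p (P (snd x) s))"
      unfolding U_def using p by (intro LpN_add_le Pm norm_triangle_ineq4) auto
    also have "\<dots> \<le> B" unfolding B_def P_def
      by (intro mult_left_mono add_mono Hardy_plus_fejer_le[OF p f that]) auto
    finally show ?thesis .
  qed
  \<comment> \<open>the largest distance beyond K: a bound that is uniform in both indices, measurable as a countable supremum, and accessible to dominated convergence in the single index K\<close>
  define E where "E K s = (SUP x\<in>{K..} \<times> {K..}. U x s)" for K s
  have Elim: "(\<lambda>K. E K s) \<longlonglongrightarrow> 0" if s: "s > 0" for s
  proof (rule ennreal_tendsto_0I)
    fix d :: real assume d: "0 < d"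
    let ?F = "inv_into (Hardy_torus p) bohr (ds_translate (of_real s) f)"
    have Fm: "strongly_measurable \<T> ?F"
      by (rule Hardy_torus_measurable(1)[OF Hardy_preimage(1)[OF Hardy_plus_translate(1)[OF f s]]])
    have "(\<lambda>N. LpN \<T> p (\<lambda>z. ?F z - P N s z)) \<longlonglongrightarrow> 0"
      using LpN_fejer_diff[OF p Hardy_plus_translate(1)[OF f s]] by (simp add: P_def fejer_ds_translate)
    then have "\<forall>\<^sub>F N in sequentially. LpN \<T> p (\<lambda>z. ?F z - P N s z) < ennreal (d / 2 / 2 / 2 powr p)"
      by (rule order_tendstoD) (use d in simp)
    then obtain N0 where N0: "\<And>N. N \<ge> N0 \<Longrightarrow> LpN \<T> p (\<lambda>z. ?F z - P N s z) < ennreal (d / 2 / 2 / 2 powr p)"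
      by (auto simp: eventually_sequentially)
    have Ux: "U x s < ennreal (d / 2)" if "x \<in> {N0..} \<times> {N0..}" for x
      unfolding U_def
    proof (rule LpN_two_term_less[OF p _ _ _ N0[of "snd x"] N0[of "fst x"]])
      show "norm (P (fst x) s z - P (snd x) s z)
          \<le> norm (?F z - P (snd x) s z) + norm (?F z - P (fst x) s z)" for z
        using norm_triangle_ineq4[of "?F z - P (snd x) s z" "?F z - P (fst x) s z"] by simp
    qed (use that strongly_measurable_norm[OF trig_poly_diff_measurable[OF Fm Pt]] d in auto)
    show "\<forall>\<^sub>F K in sequentially. E K s < ennreal d"
      using eventually_ge_at_top[of N0]
    proof eventually_elim
      case (elim K)
      have "E K s \<le> ennreal (d / 2)" unfolding E_def
      proof (rule SUP_least)
        fix x assume "x \<in> {K..} \<times> {K..}"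
        then have "x \<in> {N0..} \<times> {N0..}" using elim by auto
        then show "U x s \<le> ennreal (d / 2)" using Ux by (intro less_imp_le)
      qed
      also have "\<dots> < ennreal d" using d by (simp add: ennreal_less_iff)
      finally show ?case .
    qed
  qed
  let ?s = "\<lambda>\<xi>. \<sigma> + \<sigma> / 2 * Re \<xi>"
  have spos: "?s \<xi> > 0" if "\<xi> \<in> space \<S>" for \<xi>
  proof -
    have "- 1 \<le> Re \<xi>" using that abs_Re_le_cmod[of \<xi>] by simp
    then have "\<sigma> / 2 * (- 1) \<le> \<sigma> / 2 * Re \<xi>" using \<sigma> by (intro mult_left_mono) auto
    then show ?thesis using \<sigma> by simp
  qed
  have sm: "(\<lambda>\<xi>. complex_of_real (?s \<xi>)) \<in> borel_measurable \<S>"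
    by (intro borel_measurable_circle borel_measurable_continuous_onI continuous_intros)
  have Um: "(\<lambda>\<xi>. U x (?s \<xi>)) \<in> borel_measurable \<S>" for x
    unfolding U_eq by (rule borel_measurable_LpN_dpoly_translate[OF A(1) sm])
  have "(\<lambda>K. \<integral>\<^sup>+ \<xi>. E K (?s \<xi>) \<partial>\<S>) \<longlonglongrightarrow> (\<integral>\<^sup>+ \<xi>. 0 \<partial>\<S>)"
  proof (rule nn_integral_dominated_convergence[where w = "\<lambda>_. B"])
    show "(\<lambda>\<xi>. E K (?s \<xi>)) \<in> borel_measurable \<S>" for K
      unfolding E_def by (intro borel_measurable_SUP Um) auto
    show "AE \<xi> in \<S>. E K (?s \<xi>) \<le> B" for K
      unfolding E_def by (intro AE_I2 SUP_least UB spos)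
    show "AE \<xi> in \<S>. (\<lambda>K. E K (?s \<xi>)) \<longlonglongrightarrow> 0"
      by (intro AE_I2 Elim spos)
    show "(\<integral>\<^sup>+ \<xi>. B \<partial>\<S>) < \<infinity>"
      using circle.emeasure_space_1 by (simp add: B_def ennreal_mult_less_top del: space_circle)
  qed auto
  then have lim: "(\<lambda>K. \<integral>\<^sup>+ \<xi>. E K (?s \<xi>) \<partial>\<S>) \<longlonglongrightarrow> 0" by simp
  define k where "k = C * (\<sigma> / 2 / 2) powr p"
  have k: "k > 0" using C \<sigma> by (simp add: k_def)
  have "\<forall>\<^sub>F K in sequentially. (\<integral>\<^sup>+ \<xi>. E K (?s \<xi>) \<partial>\<S>) < ennreal (k * \<epsilon>)"
    by (rule order_tendstoD[OF lim]) (use k \<epsilon> in simp)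
  then obtain K where K: "(\<integral>\<^sup>+ \<xi>. E K (?s \<xi>) \<partial>\<S>) < ennreal (k * \<epsilon>)"
    by (auto simp: eventually_sequentially)
  show "\<exists>K. \<forall>N\<ge>K. \<forall>N'\<ge>K. LpN \<T> p (\<lambda>z. dpoly (fejer_set N) (fejer_ds N (ds_translate (of_real \<sigma>) (ds_deriv f))) z -
      dpoly (fejer_set N') (fejer_ds N' (ds_translate (of_real \<sigma>) (ds_deriv f))) z) < ennreal \<epsilon>"
  proof (intro exI allI impI)
    fix N N' assume N: "N \<ge> K" "N' \<ge> K"
    let ?x = "(N, N')"
    let ?D = "LpN \<T> p (dpoly (?A ?x) (ds_translate (of_real \<sigma>) (ds_deriv (?e ?x))))"
    have "ennreal k * ?D \<le> LpN \<T> p (dpoly (?A ?x) (ds_translate (of_real \<sigma>) (?e ?x)))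
        + ennreal C * ennreal ((\<sigma> / 2 / 2) powr p) * ?D"
      using C by (simp add: k_def ennreal_mult)
    also have "\<dots> \<le> (\<integral>\<^sup>+ \<xi>. LpN \<T> p (dpoly (?A ?x) (ds_translate (of_real (?s \<xi>)) (?e ?x))) \<partial>\<S>)"
      by (rule dpoly_PL_inequality[OF A p _ PL]) (use \<sigma> in simp)
    also have "\<dots> = (\<integral>\<^sup>+ \<xi>. U ?x (?s \<xi>) \<partial>\<S>)" by (simp only: U_eq)
    also have "\<dots> \<le> (\<integral>\<^sup>+ \<xi>. E K (?s \<xi>) \<partial>\<S>)"
      unfolding E_def using N by (intro nn_integral_mono SUP_upper) auto
    also have "\<dots> < ennreal k * ennreal \<epsilon>" using K k by (simp add: ennreal_mult')
    finally have "?D < ennreal \<epsilon>"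
      using mult_left_mono[of "ennreal \<epsilon>" ?D "ennreal k"] by (meson leD leI zero_le)
    moreover have "?D = LpN \<T> p (\<lambda>z. dpoly (fejer_set N) (fejer_ds N (ds_translate (of_real \<sigma>) (ds_deriv f))) z -
      dpoly (fejer_set N') (fejer_ds N' (ds_translate (of_real \<sigma>) (ds_deriv f))) z)"
      unfolding ds_translate_cut_diff ds_deriv_cut_diff fejer_ds_translate fejer_ds_deriv
      by (intro LpN_cong) (simp add: dpoly_cut_diff[OF finite_fejer_set finite_fejer_set])
    ultimately show "LpN \<T> p (\<lambda>z. dpoly (fejer_set N) (fejer_ds N (ds_translate (of_real \<sigma>) (ds_deriv f))) z -
      dpoly (fejer_set N') (fejer_ds N' (ds_translate (of_real \<sigma>) (ds_deriv f))) z) < ennreal \<epsilon>" by simp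
  qed
qed

section \<open>The Littlewood-Paley inequality\<close>

text \<open>The PL-inequality at \<open>\<sigma>\<close> with radius \<open>\<sigma> / 2\<close> is of the form required for a mean over dilations:
  the translations \<open>\<sigma> + \<sigma> / 2 * Re \<xi>\<close> are multiples of \<open>\<sigma>\<close> by factors between 1/2 and 3/2. The
  factor \<open>(\<sigma> / 4)\<^sup>p\<close> of the derivative, divided by \<open>\<sigma>\<close>, is the weight of the integral.\<close>
theorem dpoly_Littlewood_Paley:
  fixes c :: "nat \<Rightarrow> 'a::complex_banach"
  assumes A: "finite A" "0 \<notin> A" and p: "1 \<le> p" and C: "C > 0"
    and PL: "\<And>x y :: 'a. ennreal (norm x powr p) + ennreal C * ennreal (norm y powr p)
      \<le> (\<integral>\<^sup>+ \<xi>. ennreal (norm (x + \<xi> *\<^sub>C y) powr p) \<partial>\<S>)"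
    and B: "\<And>\<sigma>. \<sigma> > 0 \<Longrightarrow> LpN \<T> p (dpoly A (ds_translate (of_real \<sigma>) c)) \<le> ennreal B" "0 \<le> B"
  shows "(\<integral>\<^sup>+ \<sigma>. LpN \<T> p (dpoly A (ds_translate (of_real \<sigma>) (ds_deriv c))) * ennreal (\<sigma> powr (p - 1)) * indicator {0<..} \<sigma> \<partial>lborel)
    \<le> ennreal (3 / 2 * 4 powr p / C * B)"
proof -
  define u where "u \<sigma> = LpN \<T> p (dpoly A (ds_translate (of_real \<sigma>) c))" for \<sigma> :: real
  define w where "w \<sigma> = LpN \<T> p (dpoly A (ds_translate (of_real \<sigma>) (ds_deriv c)))" for \<sigma> :: real
  define v where "v \<sigma> = ennreal C * ennreal ((\<sigma> / 2 / 2) powr p) * w \<sigma>" for \<sigma>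
  have m: "complex_of_real \<in> borel_measurable borel"
    by (intro borel_measurable_continuous_onI continuous_intros)
  have [measurable]: "u \<in> borel_measurable borel" "w \<in> borel_measurable borel"
    unfolding u_def w_def by (rule borel_measurable_LpN_dpoly_translate[OF A(1) m])+
  have [measurable]: "v \<in> borel_measurable borel" unfolding v_def by measurable
  have "(\<integral>\<^sup>+ s. v s * ennreal (inverse s) * indicator {0<..} s \<partial>lborel) \<le> ennreal B * ennreal (3 / 2)"
  proof (rule nn_integral_mean_dilation_bound[OF prob_space_circle, where u = u and a = "\<lambda>\<xi>. 1 + Re \<xi> / 2"])
    show "(\<lambda>\<xi>. 1 + Re \<xi> / 2) \<in> borel_measurable \<S>"
      by (intro borel_measurable_circle borel_measurable_continuous_onI continuous_intros) simp
    show "1 / 2 \<le> 1 + Re \<xi> / 2 \<and> 1 + Re \<xi> / 2 \<le> 3 / 2" if "\<xi> \<in> space \<S>" for \<xi>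
      using that abs_Re_le_cmod[of \<xi>] by auto
    show "u s \<le> ennreal B" if "s > 0" for s unfolding u_def by (rule B(1)[OF that])
    show "u s + v s \<le> (\<integral>\<^sup>+ \<xi>. u ((1 + Re \<xi> / 2) * s) \<partial>\<S>)" if "s > 0" for s
    proof -
      have "u s + v s \<le> (\<integral>\<^sup>+ \<xi>. u (s + s / 2 * Re \<xi>) \<partial>\<S>)"
        unfolding u_def v_def w_def by (rule dpoly_PL_inequality[OF A p _ PL]) (use that in simp)
      moreover have "s + s / 2 * Re \<xi> = (1 + Re \<xi> / 2) * s" for \<xi> by (simp add: algebra_simps)
      ultimately show ?thesis by simp
    qed
  qed measurable
  moreover have "v s * ennreal (inverse s) * indicator {0<..} s
      = ennreal (C / 4 powr p) * (w s * ennreal (s powr (p - 1)) * indicator {0<..} s)" for s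
  proof (cases "s > 0")
    case True
    have 1: "(s / 2 / 2) powr p = s powr p / 4 powr p"
    proof -
      have "s / 2 / 2 = s / 4" by simp
      then show ?thesis by (simp only: powr_divide)
    qed
    have 2: "s powr (p - 1) = s powr p / s" using powr_diff[of s p 1] True by (simp only: powr_one)
    have "C * (s / 2 / 2) powr p * inverse s = C / 4 powr p * s powr (p - 1)"
      unfolding 1 2 by (simp add: divide_inverse mult_ac)
    then have "ennreal (C * (s / 2 / 2) powr p * inverse s) = ennreal (C / 4 powr p * s powr (p - 1))"
      by (simp only:)
    moreover have "ennreal (C * (s / 2 / 2) powr p * inverse s)
        = ennreal C * ennreal ((s / 2 / 2) powr p) * ennreal (inverse s)"
      using C True by (subst ennreal_mult, simp, simp, subst ennreal_mult) auto
    moreover have "ennreal (C / 4 powr p * s powr (p - 1)) = ennreal (C / 4 powr p) * ennreal (s powr (p - 1))"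
      using C by (intro ennreal_mult) auto
    ultimately have "ennreal C * ennreal ((s / 2 / 2) powr p) * ennreal (inverse s)
        = ennreal (C / 4 powr p) * ennreal (s powr (p - 1))"
      by (simp only:)
    then have e: "v s * ennreal (inverse s) = (ennreal (C / 4 powr p) * ennreal (s powr (p - 1))) * w s"
      unfolding v_def by (metis (no_types, lifting) mult.assoc mult.commute)
    show ?thesis unfolding e using True by (simp add: mult_ac)
  qed simp
  ultimately have le: "ennreal (C / 4 powr p) * (\<integral>\<^sup>+ s. w s * ennreal (s powr (p - 1)) * indicator {0<..} s \<partial>lborel)
      \<le> ennreal (3 / 2 * B)"
    using B(2) by (simp add: nn_integral_cmult ennreal_mult[symmetric] mult.commute)
  have "(\<integral>\<^sup>+ s. w s * ennreal (s powr (p - 1)) * indicator {0<..} s \<partial>lborel)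
    = ennreal (4 powr p / C) * (ennreal (C / 4 powr p) * (\<integral>\<^sup>+ s. w s * ennreal (s powr (p - 1)) * indicator {0<..} s \<partial>lborel))"
    using C by (simp add: mult.assoc[symmetric] ennreal_mult[symmetric])
  also have "\<dots> \<le> ennreal (4 powr p / C) * ennreal (3 / 2 * B)" using le by (rule mult_left_mono) simp
  also have "\<dots> = ennreal (3 / 2 * 4 powr p / C * B)"
    using C B(2) by (simp add: ennreal_mult[symmetric] mult_ac)
  finally show ?thesis by (simp add: w_def)
qed

theorem theorem1p2:
  fixes p :: real
  assumes "2 \<le> p"
    and "uniformly_PL_convex p TYPE('a::complex_banach)"
  shows "\<exists>C>0. \<forall>f \<in> (Hardy_plus p :: (nat \<Rightarrow> 'a) set).
    (\<forall>\<sigma>>0. ds_translate (complex_of_real \<sigma>) (ds_deriv f) \<in> Hardy p) \<and>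
    set_integrable lborel {0<..}
      (\<lambda>\<sigma>. Hardy_norm p (ds_translate (complex_of_real \<sigma>) (ds_deriv f)) powr p * \<sigma> powr (p - 1)) \<and>
    norm (ds_at_infinity f) +
      (LBINT \<sigma>:{0<..}. Hardy_norm p (ds_translate (complex_of_real \<sigma>) (ds_deriv f)) powr p * \<sigma> powr (p - 1))
        powr (1 / p)
    \<le> C * Hardy_plus_norm p f"
proof -
  have p: "1 \<le> p" "0 < p" using assms(1) by auto
  have p0: "0 \<le> p" using p by simp
  obtain C where C: "C > 0" and PL: "\<And>x y :: 'a. ennreal (norm x powr p) + ennreal C * ennreal (norm y powr p)
      \<le> (\<integral>\<^sup>+ \<xi>. ennreal (norm (x + \<xi> *\<^sub>C y) powr p) \<partial>\<S>)"
    by (rule uniformly_PL_convex_nn_integral[OF assms(2) p0]) (rule that)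
  define D where "D = 3 / 2 * 4 powr p / C"
  have D: "D > 0" using C by (simp add: D_def)
  show ?thesis
  proof (intro exI[of _ "1 + D powr (1 / p)"] conjI ballI)
    show "1 + D powr (1 / p) > 0" by (simp add: add_pos_nonneg)
    fix f :: "nat \<Rightarrow> 'a" assume f: "f \<in> Hardy_plus p"
    define B where "B = Hardy_plus_norm p f"
    have B: "0 \<le> B" unfolding B_def by (rule Hardy_plus_norm_nonneg[OF f])
    define V where "V \<sigma> = Hardy_norm p (ds_translate (complex_of_real \<sigma>) (ds_deriv f)) powr p" for \<sigma>
    define W where "W N \<sigma> = LpN \<T> p (dpoly (fejer_set N) (ds_translate (of_real \<sigma>) (ds_deriv (fejer_ds N f))))" for N and \<sigma> :: real
    have H: "ds_translate (complex_of_real \<sigma>) (ds_deriv f) \<in> Hardy p" if "\<sigma> > 0" for \<sigma>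
      by (rule ds_deriv_translate_Hardy[OF p(1) C PL f that])
    then show "\<forall>\<sigma>>0. ds_translate (complex_of_real \<sigma>) (ds_deriv f) \<in> Hardy p" by blast
    have WV: "(\<lambda>N. W N \<sigma>) \<longlonglongrightarrow> ennreal (V \<sigma>)" if "\<sigma> > 0" for \<sigma>
      using LpN_fejer_tendsto[OF p(1) H[OF that]] by (simp add: W_def V_def fejer_ds_translate fejer_ds_deriv)
    have [measurable]: "W N \<in> borel_measurable borel" for N
      unfolding W_def by (rule borel_measurable_LpN_dpoly_translate[OF finite_fejer_set])
        (intro borel_measurable_continuous_onI continuous_intros)
    define g where "g \<sigma> = indicator {0<..} \<sigma> *\<^sub>R (V \<sigma> * \<sigma> powr (p - 1))" for \<sigma> :: real
    have V0: "0 \<le> V \<sigma>" for \<sigma> by (simp add: V_def)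
    have g0: "0 \<le> g \<sigma>" for \<sigma> using V0 by (simp add: g_def)
    have lim: "(\<lambda>N. W N \<sigma> * ennreal (\<sigma> powr (p - 1)) * indicator {0<..} \<sigma>) \<longlonglongrightarrow> ennreal (g \<sigma>)" for \<sigma>
    proof (cases "\<sigma> > 0")
      case True
      have "(\<lambda>N. ennreal (\<sigma> powr (p - 1)) * W N \<sigma>) \<longlonglongrightarrow> ennreal (\<sigma> powr (p - 1)) * ennreal (V \<sigma>)"
        by (rule ennreal_tendsto_cmult[OF _ WV[OF True]]) simp
      then show ?thesis using True V0 by (simp add: g_def ennreal_mult mult.commute)
    qed (simp add: g_def)
    have gm: "(\<lambda>\<sigma>. ennreal (g \<sigma>)) \<in> borel_measurable lborel"
      by (rule borel_measurable_LIMSEQ_order[OF lim]) measurable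
    then have "(\<lambda>\<sigma>. enn2real (ennreal (g \<sigma>))) \<in> borel_measurable lborel" by measurable
    then have g_meas: "g \<in> borel_measurable lborel" using g0 by simp
    have Wle: "(\<integral>\<^sup>+ \<sigma>. W N \<sigma> * ennreal (\<sigma> powr (p - 1)) * indicator {0<..} \<sigma> \<partial>lborel) \<le> ennreal (D * B powr p)" for N
      unfolding W_def D_def
      by (rule dpoly_Littlewood_Paley[OF finite_fejer_set zero_notin_fejer_set p(1) C PL])
         (use Hardy_plus_fejer_le[OF p(1) f] in \<open>auto simp: B_def\<close>)
    have "(\<integral>\<^sup>+ \<sigma>. ennreal (g \<sigma>) \<partial>lborel) = (\<integral>\<^sup>+ \<sigma>. liminf (\<lambda>N. W N \<sigma> * ennreal (\<sigma> powr (p - 1)) * indicator {0<..} \<sigma>) \<partial>lborel)"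
      by (intro nn_integral_cong lim_imp_Liminf[symmetric] lim) simp
    also have "\<dots> \<le> liminf (\<lambda>N. \<integral>\<^sup>+ \<sigma>. W N \<sigma> * ennreal (\<sigma> powr (p - 1)) * indicator {0<..} \<sigma> \<partial>lborel)"
      by (rule nn_integral_liminf) measurable
    also have "\<dots> \<le> liminf (\<lambda>N. ennreal (D * B powr p))"
      by (intro Liminf_mono always_eventually allI Wle)
    also have "\<dots> = ennreal (D * B powr p)" by (simp add: Liminf_const)
    finally have I: "(\<integral>\<^sup>+ \<sigma>. ennreal (g \<sigma>) \<partial>lborel) \<le> ennreal (D * B powr p)" .
    have int: "integrable lborel g"
      using g_meas g0 le_less_trans[OF I] by (intro integrableI_nonneg) auto
    then show "set_integrable lborel {0<..}
      (\<lambda>\<sigma>. Hardy_norm p (ds_translate (complex_of_real \<sigma>) (ds_deriv f)) powr p * \<sigma> powr (p - 1))"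
      by (simp add: set_integrable_def g_def[abs_def] V_def)
    have "ennreal (\<integral>\<sigma>. g \<sigma> \<partial>lborel) \<le> ennreal (D * B powr p)"
      using I nn_integral_eq_integral[OF int] g0 by simp
    then have "(\<integral>\<sigma>. g \<sigma> \<partial>lborel) \<le> D * B powr p" using D by (subst (asm) ennreal_le_iff) auto
    moreover have "0 \<le> (\<integral>\<sigma>. g \<sigma> \<partial>lborel)" using g0 by (intro integral_nonneg_AE) simp
    ultimately have "(\<integral>\<sigma>. g \<sigma> \<partial>lborel) powr (1 / p) \<le> (D * B powr p) powr (1 / p)"
      using p by (intro powr_mono2) auto
    also have "\<dots> = D powr (1 / p) * (B powr p) powr (1 / p)" using D by (intro powr_mult)
    also have "(B powr p) powr (1 / p) = B" using B p by (simp add: powr_powr)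
    finally have 1: "(\<integral>\<sigma>. g \<sigma> \<partial>lborel) powr (1 / p) \<le> D powr (1 / p) * B" .
    have "norm (ds_translate (complex_of_real 1) f 1) \<le> B"
      using norm_first_coeff_le[OF p(1) Hardy_plus_translate(1)[OF f zero_less_one]] Hardy_plus_translate(2)[OF f zero_less_one]
      unfolding B_def by (rule order_trans)
    then have 2: "norm (ds_at_infinity f) \<le> B" by (simp add: ds_translate_def ds_at_infinity_def)
    have "(LBINT \<sigma>:{0<..}. Hardy_norm p (ds_translate (complex_of_real \<sigma>) (ds_deriv f)) powr p * \<sigma> powr (p - 1)) = (\<integral>\<sigma>. g \<sigma> \<partial>lborel)"
      by (simp add: set_lebesgue_integral_def g_def[abs_def] V_def)
    then show "norm (ds_at_infinity f) +
      (LBINT \<sigma>:{0<..}. Hardy_norm p (ds_translate (complex_of_real \<sigma>) (ds_deriv f)) powr p * \<sigma> powr (p - 1)) powr (1 / p)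
      \<le> (1 + D powr (1 / p)) * Hardy_plus_norm p f"
      using 1 2 by (simp add: B_def distrib_right)
  qed
qed

end
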